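(* Let $X=\mathbb R^d$ and let $m$ be a measure on $X\times\mathbb R_+$ with $m(\{x\}\times\mathbb R_+)=0$ for each $x\in X$. For $\varphi\in\operatorname{Diff}_0(X)$ let $m_\varphi$ be the pushforward of $m$ under the map $(x,s)\mapsto(\varphi(x),s)$ of $X\times\mathbb R_+$. Assume that, for each $\varphi\in\operatorname{Diff}_0(X)$, the measures $m$ and $m_\varphi$ are equivalent, and that $$m(\Lambda\times\mathbb R_+)<\infty,\quad\Lambda\in\mathcal B_0(X).$$ Then $\mu_m$ is quasi-invariant with respect to the action of $\operatorname{Diff}_0(X)$ and for each $\varphi\in\operatorname{Diff}_0(X)$ the corresponding Radon--Nikodym density is given by $$\frac{d\mu_m^\varphi}{d\mu_m}(\eta)=\prod_{x\in\tau(\eta)}\frac{dm_\varphi}{dm}(x,s_x).$$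
   Context: $\mathbb R_+=(0,\infty)$. $\mathcal B_0(X)$ is the collection of Borel subsets of $X$ with compact closure. $\mathbb M(X)$ is the set of Radon measures on $X$ (finite on compact sets) with the vague topology and its Borel $\sigma$-algebra. $\mathbb K(X)\subset\mathbb M(X)$ is the set of discrete Radon measures $\eta=\sum_i s_i\delta_{x_i}$ with $s_i>0$, the $x_i\in X$ distinct and at most countably many (the zero measure included), with the trace $\sigma$-algebra. For $\eta\in\mathbb K(X)$, $\tau(\eta)=\{x_i\}$ is its set of atoms and $s_x:=\eta(\{x\})$ for $x\in\tau(\eta)$. $\mu_m$ denotes the unique probability measure on $\mathbb K(X)$ with Fourier transform $\int_{\mathbb K(X)}e^{i\int f\,d\eta}\,d\mu_m(\eta)=\exp\left[\int_X\int_{\mathbb R_+}(e^{isf(x)}-1)\,dm(x,s)\right]$ for all continuous compactly supported $f:X\to\mathbb R$; it exists whenever $m(\{x\}\times\mathbb R_+)=0$ for all $x$ and $\int_{A\times\mathbb R_+}\min\{s,1\}\,dm<\infty$ for all $A\in\mathcal B_0(X)$. $\operatorname{Diff}_0(X)$ is the group (under composition) of $C^\infty$ diffeomorphisms of $X$ that equal the identity outside a compact set. It acts on $\mathbb K(X)$ by pushforward: $\varphi^*\eta=\sum_i s_i\delta_{\varphi(x_i)}$ for $\eta=\sum_i s_i\delta_{x_i}$. $\mu_m^\varphi$ is the pushforward of $\mu_m$ under $\eta\mapsto\varphi^*\eta$; $\mu_m$ is quasi-invariant with respect to $\operatorname{Diff}_0(X)$ if $\mu_m^\varphi$ is equivalent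 to $\mu_m$ for each $\varphi$. *)

theory Defs
  imports "HOL-Probability.Probability"
begin

section \<open>Discrete Radon measures\<close>

definition compactly_supported_continuous :: "('a::euclidean_space \<Rightarrow> real) set" where
  "compactly_supported_continuous = {f. continuous_on UNIV f \<and> compact (closure {x. f x \<noteq> 0})}"

definition relatively_compact_borel :: "'a::euclidean_space set set" where
  "relatively_compact_borel = {A \<in> sets borel. compact (closure A)}"

definition radon_measures :: "'a::euclidean_space measure set" where
  "radon_measures = {\<eta>. sets \<eta> = sets borel \<and> (\<forall>C. compact C \<longrightarrow> emeasure \<eta> C < \<infinity>)}"

text \<open>The coarsest topology on the Radon measures for which \<open>\<eta> \<mapsto> \<integral>f d\<eta>\<close> is continuous
  for every compactly supported continuous \<open>f\<close>.\<close>

definition vague_topology :: "'a::euclidean_space measure topology" where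
  "vague_topology = topology_generated_by
     {{\<eta> \<in> radon_measures. (\<integral>x. f x \<partial>\<eta>) \<in> U} | f U. f \<in> compactly_supported_continuous \<and> open U}"

lemma topspace_vague_topology: "topspace vague_topology = radon_measures"
proof -
  have "radon_measures \<in> {{\<eta> \<in> radon_measures. (\<integral>x. f x \<partial>\<eta>) \<in> U} | f U.
      f \<in> compactly_supported_continuous \<and> open (U :: real set)}"
    by (rule CollectI, rule exI[of _ "\<lambda>_. 0"], rule exI[of _ UNIV])
       (simp add: compactly_supported_continuous_def)
  then show ?thesis
    unfolding vague_topology_def topology_generated_by_topspace by blast
qed

definition vague_borel :: "'a::euclidean_space measure measure" where
  "vague_borel = sigma radon_measures {U. openin vague_topology U}"

text \<open>The measures \<open>\<Sum>\<^sub>x s\<^sub>x \<delta>\<^sub>x\<close>, with \<open>x\<close> ranging over a countable set; the \<open>nn_integral\<close> with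
  respect to \<open>count_space S\<close> is the sum over \<open>S\<close>.\<close>

definition discrete_radon_measures :: "'a::euclidean_space measure set" where
  "discrete_radon_measures = {\<eta> \<in> radon_measures. \<exists>S s. countable S \<and> (\<forall>x\<in>S. 0 < s x) \<and>
     (\<forall>A\<in>sets borel. emeasure \<eta> A =
        (\<integral>\<^sup>+x. ennreal (s x) * emeasure (return borel x) A \<partial>count_space S))}"

definition discrete_radon_space :: "'a::euclidean_space measure measure" where
  "discrete_radon_space = restrict_space vague_borel discrete_radon_measures"

lemma space_discrete_radon_space:
  "space discrete_radon_space = (discrete_radon_measures :: 'a::euclidean_space measure set)"
proof -
  have "{U. openin vague_topology U} \<subseteq> Pow (radon_measures :: 'a measure set)"
    using openin_subset topspace_vague_topology by blast
  then have "space (vague_borel :: 'a measure measure) = radon_measures"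
    unfolding vague_borel_def by (rule space_measure_of)
  then show ?thesis
    by (auto simp: discrete_radon_space_def space_restrict_space discrete_radon_measures_def)
qed

definition atoms :: "'a::euclidean_space measure \<Rightarrow> 'a set" where
  "atoms \<eta> = {x. measure \<eta> {x} > 0}"


section \<open>The random measure with a given Levy measure\<close>

definition marked_space :: "('a::euclidean_space \<times> real) measure" where
  "marked_space = restrict_space borel (UNIV \<times> {0<..})"

definition law_of_levy_measure ::
  "('a::euclidean_space \<times> real) measure \<Rightarrow> 'a measure measure" where
  "law_of_levy_measure m = (THE \<mu>. prob_space \<mu> \<and> sets \<mu> = sets discrete_radon_space \<and>
     (\<forall>f\<in>compactly_supported_continuous.
        (\<integral>\<eta>. iexp (\<integral>x. f x \<partial>\<eta>) \<partial>\<mu>) = exp (\<integral>(x, s). (iexp (s * f x) - 1) \<partial>m)))"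


section \<open>Compactly supported diffeomorphisms and their action\<close>

text \<open>\<open>n_times_cont_diff n f\<close>: \<open>f\<close> is of class \<open>C\<^sup>n\<close> on the whole space.\<close>

fun n_times_cont_diff :: "nat \<Rightarrow> ('a::euclidean_space \<Rightarrow> 'b::euclidean_space) \<Rightarrow> bool" where
  "n_times_cont_diff 0 f \<longleftrightarrow> continuous_on UNIV f"
| "n_times_cont_diff (Suc n) f \<longleftrightarrow> (\<forall>x. f differentiable (at x)) \<and>
     (\<forall>v. n_times_cont_diff n (\<lambda>x. frechet_derivative f (at x) v))"

definition smooth :: "('a::euclidean_space \<Rightarrow> 'b::euclidean_space) \<Rightarrow> bool" where
  "smooth f \<longleftrightarrow> (\<forall>n. n_times_cont_diff n f)"

definition Diff0 :: "('a::euclidean_space \<Rightarrow> 'a) set" where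
  "Diff0 = {\<phi>. bij \<phi> \<and> smooth \<phi> \<and> smooth (inv \<phi>) \<and> (\<exists>C. compact C \<and> (\<forall>x. x \<notin> C \<longrightarrow> \<phi> x = x))}"

definition push_marked ::
  "('a::euclidean_space \<Rightarrow> 'a) \<Rightarrow> ('a \<times> real) measure \<Rightarrow> ('a \<times> real) measure" where
  "push_marked \<phi> m = distr m marked_space (\<lambda>(x, s). (\<phi> x, s))"

definition push_law ::
  "('a::euclidean_space \<Rightarrow> 'a) \<Rightarrow> 'a measure measure \<Rightarrow> 'a measure measure" where
  "push_law \<phi> \<mu> = distr \<mu> discrete_radon_space (\<lambda>\<eta>. distr \<eta> borel \<phi>)"

definition equivalent_measures :: "'a measure \<Rightarrow> 'a measure \<Rightarrow> bool" where
  "equivalent_measures M N \<longleftrightarrow>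
     sets M = sets N \<and> absolutely_continuous M N \<and> absolutely_continuous N M"

definition quasi_invariant_Diff0 :: "'a::euclidean_space measure measure \<Rightarrow> bool" where
  "quasi_invariant_Diff0 \<mu> \<longleftrightarrow> (\<forall>\<phi>\<in>Diff0. equivalent_measures (push_law \<phi> \<mu>) \<mu>)"


section \<open>Unordered products\<close>

text \<open>The product over a possibly infinite set \<open>A\<close> is the limit of the net of finite subproducts.
  (The library's \<open>prod f A\<close> is \<open>1\<close> for every infinite \<open>A\<close>.)\<close>

definition has_unordered_prod :: "('a \<Rightarrow> ennreal) \<Rightarrow> 'a set \<Rightarrow> ennreal \<Rightarrow> bool" where
  "has_unordered_prod f A p \<longleftrightarrow> (prod f \<longlongrightarrow> p) (finite_subsets_at_top A)"

end

theory Submission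
  imports Defs
begin

text \<open>
The law of the random measure is that of \<open>\<Sum> s\<^sub>i \<delta>(x\<^sub>i)\<close> for a Poisson point process of points
\<open>(x\<^sub>i, s\<^sub>i)\<close> with intensity \<open>m\<close>. A diffeomorphism \<open>\<phi>\<close> moves the points, and the moved points form a
Poisson process with intensity \<open>m\<^sub>\<phi>\<close>. As \<open>m\<close> has finite mass above bounded sets, only finitely many
points lie above a ball that contains the support of \<open>\<phi>\<close>, and the densities of the two finite
Poisson processes there have the ratio \<open>\<Prod> dm\<^sub>\<phi>/dm (x\<^sub>i, s\<^sub>i)\<close> times \<open>exp (m(B) - m\<^sub>\<phi>(B))\<close>, where \<open>B\<close> is
the strip above the ball. The last factor is \<open>1\<close> because \<open>\<phi>\<close> maps the ball onto itself. Off the ball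
nothing moves.

This comparison is carried out with Fourier transforms. For a function \<open>F\<close> that is \<open>1\<close> off a bounded
strip, the exponential formula (\<open>integral_point_prod\<close>) says that the expectation of \<open>\<Prod> F (x\<^sub>i, s\<^sub>i)\<close>
is \<open>exp (\<integral>(F - 1) dm)\<close>. With \<open>F = exp (\<i> s f x)\<close> it identifies the law of the constructed random
measure (\<open>law_of_levy_measure_eq\<close>); with \<open>F = r exp (\<i> s f x)\<close>, where \<open>r\<close> is a version of the density
of \<open>m\<^sub>\<phi>\<close>, it shows that the law reweighted by \<open>\<Prod> r (x\<^sub>i, s\<^sub>i)\<close> has the Fourier transform of the
transported law (\<open>push_law_density\<close>).

Two ingredients make this rigorous. First, a law on the discrete Radon measures is determined by its
Fourier transform (\<open>discrete_law_eqI\<close>). The vague topology is generated by countably many integrals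
of test functions (\<open>vague_open_preimage\<close>), which embeds the laws into those on a compact cube, and
there trigonometric functions are dense by the Stone-Weierstrass theorem. Second, products over the
atoms have to be measurable functions of \<open>\<eta>\<close> (\<open>measurable_atom_sum\<close>). For this a sum over atoms is
written as an integral \<open>\<integral>F (x, \<eta>{x}) / \<eta>{x} d\<eta>(x)\<close>, whose measurability follows from that of kernels.

The construction samples, independently for each annulus of integer radii, a Poisson number of
points with the normalised restriction of \<open>m\<close> as common law. Almost surely all locations differ,
since \<open>m\<close> does not charge fibres; hence the atoms of the random measure are exactly the points
(\<open>atom_sum_random_measure\<close>).
\<close>

section \<open>A countable family of test functions\<close>

abbreviation test_functions :: "('a::euclidean_space \<Rightarrow> real) set" where
  "test_functions \<equiv> compactly_supported_continuous"

lemma test_function_iff: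
  "f \<in> test_functions \<longleftrightarrow> continuous_on UNIV f \<and> (\<exists>R. \<forall>x. f x \<noteq> 0 \<longrightarrow> norm x < R)"
proof -
  have "bounded {x. f x \<noteq> 0}" if "\<forall>x. f x \<noteq> 0 \<longrightarrow> norm x < R" for R
    using that by (intro boundedI[of _ R]) (auto intro: less_imp_le)
  moreover have "\<exists>R. \<forall>x. f x \<noteq> 0 \<longrightarrow> norm x < R" if "bounded {x. f x \<noteq> 0}"
    using that unfolding bounded_pos_less by auto
  ultimately have "compact (closure {x. f x \<noteq> 0}) \<longleftrightarrow> (\<exists>R. \<forall>x. f x \<noteq> 0 \<longrightarrow> norm x < R)"
    unfolding compact_closure by blast
  then show ?thesis
    unfolding compactly_supported_continuous_def by auto
qed

lemma test_function_continuous: "f \<in> test_functions \<Longrightarrow> continuous_on S f"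
  by (meson continuous_on_subset test_function_iff top_greatest)

lemma test_function_support:
  assumes "f \<in> test_functions"
  obtains k :: nat where "\<And>x. f x \<noteq> 0 \<Longrightarrow> norm x < k"
proof -
  obtain R where "\<And>x. f x \<noteq> 0 \<Longrightarrow> norm x < R"
    using assms by (auto simp: test_function_iff)
  with that show thesis
    using real_arch_simple[of R] by (metis order_less_le_trans)
qed

lemma test_function_add:
  assumes "f \<in> test_functions" "g \<in> test_functions"
  shows "(\<lambda>x. f x + g x) \<in> test_functions"
proof -
  obtain R S where "\<And>x. f x \<noteq> 0 \<Longrightarrow> norm x < R" "\<And>x. g x \<noteq> 0 \<Longrightarrow> norm x < S"
    using assms by (auto simp: test_function_iff)
  then have "\<forall>x. f x + g x \<noteq> 0 \<longrightarrow> norm x < max R S"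
    by (metis add.right_neutral less_max_iff_disj)
  with assms show ?thesis
    by (auto simp: test_function_iff intro!: continuous_intros)
qed

lemma test_function_cmult:
  assumes "f \<in> test_functions" shows "(\<lambda>x. c * f x) \<in> test_functions"
  using assms by (auto simp: test_function_iff intro!: continuous_intros)

lemma test_function_diff:
  assumes "f \<in> test_functions" "g \<in> test_functions"
  shows "(\<lambda>x. f x - g x) \<in> test_functions"
  using test_function_add[OF assms(1) test_function_cmult[OF assms(2), of "-1"]] by simp

lemma test_function_zero: "(\<lambda>x. 0) \<in> test_functions"
  by (simp add: test_function_iff)

lemma test_function_bounded:
  assumes "f \<in> test_functions"
  obtains B where "\<And>x. \<bar>f x\<bar> \<le> B"
proof -
  obtain k :: nat where k: "\<And>x. f x \<noteq> 0 \<Longrightarrow> norm x < k"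
    using test_function_support[OF assms] by blast
  have "compact (f ` cball 0 (real k))"
    by (intro compact_continuous_image test_function_continuous assms) auto
  then obtain B where B: "\<And>x. x \<in> cball 0 (real k) \<Longrightarrow> \<bar>f x\<bar> \<le> B"
    unfolding bounded_iff by (metis compact_imp_bounded bounded_iff imageI real_norm_def)
  have "\<bar>f x\<bar> \<le> B" for x
    using B[of x] B[of 0] k[of x] by (cases "f x = 0") auto
  with that show thesis by blast
qed

lemma test_function_measurable [measurable]: "f \<in> test_functions \<Longrightarrow> f \<in> borel_measurable borel"
  by (intro borel_measurable_continuous_onI test_function_continuous)

lemma radon_measureD:
  assumes "\<eta> \<in> radon_measures"
  shows "sets \<eta> = sets borel" and "space \<eta> = UNIV" and "compact C \<Longrightarrow> emeasure \<eta> C < \<infinity>"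
  using assms by (auto simp: radon_measures_def dest: sets_eq_imp_space_eq)

lemma radon_measure_bounded_finite:
  assumes "\<eta> \<in> radon_measures" "bounded A"
  shows "emeasure \<eta> A < \<infinity>"
proof -
  have "emeasure \<eta> A \<le> emeasure \<eta> (closure A)"
    using radon_measureD(1)[OF assms(1)] by (intro emeasure_mono closure_subset) auto
  also have "\<dots> < \<infinity>"
    using radon_measureD(3)[OF assms(1)] assms(2) by (simp add: compact_closure)
  finally show ?thesis .
qed

lemma integrable_test_function:
  assumes \<eta>: "\<eta> \<in> radon_measures" and f: "f \<in> test_functions"
  shows "integrable \<eta> f"
proof -
  obtain k :: nat where k: "\<And>x. f x \<noteq> 0 \<Longrightarrow> norm x < k"
    using test_function_support[OF f] by blast
  obtain B where B: "\<And>x. \<bar>f x\<bar> \<le> B"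
    using test_function_bounded[OF f] by blast
  have "emeasure \<eta> (ball 0 k) < \<infinity>"
    by (rule radon_measure_bounded_finite[OF \<eta>]) auto
  then show ?thesis
    using k B radon_measureD[OF \<eta>] test_function_measurable[OF f]
    by (intro integrableI_bounded_set[of "ball 0 k" _ _ B] AE_I2)
       (force cong: measurable_cong_sets)+
qed

fun tent :: "('a::euclidean_space \<times> real \<times> real) list \<Rightarrow> 'a \<Rightarrow> real" where
  "tent [] x = 0"
| "tent ((q, c, L) # l) x = max (c - L * dist x q) (tent l x)"

lemma tent_nonneg: "0 \<le> tent l x"
  by (induction l) (auto simp: le_max_iff_disj)

lemma tent_ge: "(q, c, L) \<in> set l \<Longrightarrow> c - L * dist x q \<le> tent l x"
  by (induction l) (auto simp: le_max_iff_disj)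

lemma tent_le:
  assumes "0 \<le> b" "\<And>q c L. (q, c, L) \<in> set l \<Longrightarrow> c - L * dist x q \<le> b"
  shows "tent l x \<le> b"
  using assms(2) by (induction l) (auto simp: assms(1))

lemma tent_test_function:
  assumes "\<And>q c L. (q, c, L) \<in> set l \<Longrightarrow> 0 < L"
  shows "tent l \<in> test_functions"
  using assms
proof (induction l)
  case Nil
  have "tent [] = (\<lambda>x. 0)" by (rule ext) simp
  then show ?case using test_function_zero by simp
next
  case (Cons p l)
  obtain q c L where p: "p = (q, c, L)" by (cases p)
  then have L: "0 < L" using Cons.prems by auto
  have l: "tent l \<in> test_functions" using Cons by auto
  then obtain R where R: "\<And>x. tent l x \<noteq> 0 \<Longrightarrow> norm x < R"
    by (auto simp: test_function_iff)
  have "norm x < max R (norm q + c / L)" if "tent (p # l) x \<noteq> 0" for x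
  proof (cases "tent l x = 0")
    case True
    then have "0 < c - L * dist x q" using that by (auto simp: p max_def split: if_splits)
    then have "dist x q < c / L" using L by (simp add: field_simps)
    moreover have "norm x \<le> norm q + dist x q"
      by (metis dist_norm norm_triangle_sub)
    ultimately show ?thesis by auto
  next
    case False
    then show ?thesis using R[of x] by auto
  qed
  moreover have "continuous_on UNIV (tent (p # l))"
    using test_function_continuous[OF l] by (auto simp: p intro!: continuous_intros)
  ultimately show ?case by (auto simp: test_function_iff)
qed

text \<open>The last clause provides dominating functions: on the support of \<open>f\<close>, a uniform error \<open>e\<close> is then at
most \<open>e\<close> times a member of the family, and such an error can be integrated against a Radon
measure.\<close>

definition test_family :: "(nat \<Rightarrow> 'a::euclidean_space \<Rightarrow> real) \<Rightarrow> bool" where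
  "test_family g \<longleftrightarrow> (\<forall>n. g n \<in> test_functions) \<and> (\<forall>n x. 0 \<le> g n x) \<and>
     (\<forall>f e. f \<in> test_functions \<longrightarrow> (\<forall>x. 0 \<le> f x) \<longrightarrow> 0 < e \<longrightarrow>
        (\<exists>n. \<forall>x. g n x \<le> f x \<and> f x \<le> g n x + e)) \<and>
     (\<forall>f. f \<in> test_functions \<longrightarrow> (\<exists>n. \<forall>x. f x \<noteq> 0 \<longrightarrow> 1 \<le> g n x))"

text \<open>The tents with apex data from a countable dense set and the rationals form such a family. The
rational cones below a continuous \<open>f \<ge> 0\<close> have supremum \<open>f\<close>, and by compactness of \<open>{f \<ge> e}\<close> finitely
many of them come within \<open>e\<close> of it. Approximation from below keeps the approximant inside the
support of \<open>f\<close>.\<close>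

lemma test_family_exists: "\<exists>g :: nat \<Rightarrow> 'a::euclidean_space \<Rightarrow> real. test_family g"
proof -
  obtain D :: "'a set" where D: "countable D" "\<And>X. open X \<Longrightarrow> X \<noteq> {} \<Longrightarrow> \<exists>d\<in>D. d \<in> X"
    by (rule countable_dense_setE) blast
  define P where "P = D \<times> ((\<rat> \<inter> {0<..}) \<times> (\<rat> \<inter> {0<..}) :: (real \<times> real) set)"
  have P: "countable P" unfolding P_def by (intro countable_SIGMA D countable_Int1 countable_rat)
  define T where "T = tent ` lists P"
  have T: "countable T" "T \<noteq> {}" unfolding T_def using P by auto
  define g where "g = from_nat_into T"
  have g: "\<exists>l\<in>lists P. g n = tent l" for n
    using from_nat_into[OF T(2), of n] by (auto simp: g_def T_def)
  have g': "\<exists>n. g n = tent l" if "l \<in> lists P" for l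
    using from_nat_into_surj[OF T(1), of "tent l"] that unfolding g_def T_def by blast
  have "test_family g"
    unfolding test_family_def
  proof (intro conjI allI impI)
    fix n x
    show "g n \<in> test_functions" using g[of n] by (force simp: P_def intro!: tent_test_function)
    show "0 \<le> g n x" using g[of n] tent_nonneg by auto
  next
    fix f :: "'a \<Rightarrow> real" and e :: real
    assume f: "f \<in> test_functions" and "\<forall>x. 0 \<le> f x" and e: "0 < e"
    then have pos: "0 \<le> f x" for x by blast
    define K where "K = {x. e \<le> f x}"
    obtain R where R: "\<And>x. f x \<noteq> 0 \<Longrightarrow> norm x < R" using f by (auto simp: test_function_iff)
    have "norm x \<le> R" if "x \<in> K" for x
      using R[of x] e that by (auto simp: K_def)
    then have "bounded K" by (rule boundedI)
    moreover have "closed K" unfolding K_def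
      by (intro closed_Collect_le continuous_intros test_function_continuous f)
    ultimately have K: "compact K" by (simp add: compact_eq_bounded_closed)
    define G where "G = {(q, c, L) \<in> P. \<forall>x. c - L * dist x q \<le> f x}"
    define V where "V = (\<lambda>(q, c, L). {x. f x - e < c - L * dist x q})"
    have V: "open (V p)" for p
      unfolding V_def split_beta
      by (intro open_Collect_less continuous_intros test_function_continuous f)
    have "K \<subseteq> \<Union> (V ` G)"
    proof
      fix x0 assume x0: "x0 \<in> K"
      then have a: "0 \<le> f x0 - e" by (simp add: K_def)
      obtain c where c: "c \<in> \<rat>" "f x0 - e < c" "c < f x0"
        using Rats_dense_in_real[of "f x0 - e" "f x0"] e by auto
      have "open {x. c < f x}"
        by (intro open_Collect_less continuous_intros test_function_continuous f)
      then obtain d where d: "0 < d" "ball x0 d \<subseteq> {x. c < f x}"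
        using c(3) by (metis mem_Collect_eq openE)
      obtain L where L: "L \<in> \<rat>" "2 * c / d < L"
        using Rats_dense_in_real[of "2 * c / d" "2 * c / d + 1"] by auto
      have c0: "0 < c" using a c by linarith
      have "0 < 2 * c / d" using c0 d by simp
      then have L0: "0 < L" using L by linarith
      have "0 < min (d / 2) ((c - (f x0 - e)) / L)"
        using d c L0 by simp
      then have "ball x0 (min (d / 2) ((c - (f x0 - e)) / L)) \<noteq> {}" by (simp add: not_le)
      then obtain q where q: "q \<in> D" "q \<in> ball x0 (min (d / 2) ((c - (f x0 - e)) / L))"
        using D(2) open_ball by blast
      have q1: "dist x0 q < d / 2" and q2: "L * dist x0 q < c - (f x0 - e)"
        using q(2) L0 by (auto simp: field_simps)
      have "c - L * dist x q \<le> f x" for x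
      proof (cases "dist x q < d / 2")
        case True
        then have "dist x0 x < d" using q1 dist_triangle[of x0 x q] by (simp add: dist_commute)
        then have "c < f x" using d(2) by auto
        moreover have "0 \<le> L * dist x q" using L0 by simp
        ultimately show ?thesis by linarith
      next
        case False
        then have "L * (d / 2) \<le> L * dist x q" using L0 by (intro mult_left_mono) auto
        moreover have "c \<le> L * (d / 2)" using L d by (simp add: field_simps)
        ultimately show ?thesis using pos[of x] by linarith
      qed
      then have "(q, c, L) \<in> G"
        using q c L c0 L0 by (auto simp: G_def P_def)
      moreover have "x0 \<in> V (q, c, L)" using q2 by (simp add: V_def)
      ultimately show "x0 \<in> \<Union> (V ` G)" by blast
    qed
    then obtain G' where G': "G' \<subseteq> G" "finite G'" "K \<subseteq> \<Union> (V ` G')"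
      using compactE_image[OF K, of G V] V by metis
    obtain l where l: "set l = G'" using finite_list[OF G'(2)] by blast
    have "l \<in> lists P" using l G'(1) by (auto simp: G_def)
    then obtain n where n: "g n = tent l" using g' by blast
    have "tent l x \<le> f x" for x
      using pos[of x] l G'(1) by (intro tent_le) (auto simp: G_def)
    moreover have "f x \<le> tent l x + e" for x
    proof (cases "x \<in> K")
      case True
      then obtain q c L where "(q, c, L) \<in> G'" "f x - e < c - L * dist x q"
        using G'(3) by (auto simp: V_def)
      with tent_ge[of q c L l x] l show ?thesis by simp
    next
      case False
      then show ?thesis using tent_nonneg[of l x] by (simp add: K_def)
    qed
    ultimately show "\<exists>n. \<forall>x. g n x \<le> f x \<and> f x \<le> g n x + e"
      using n by (metis)
  next
    fix f :: "'a \<Rightarrow> real" assume f: "f \<in> test_functions"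
    then obtain k :: nat where k: "\<And>x. f x \<noteq> 0 \<Longrightarrow> norm x < k" using test_function_support by blast
    obtain q where q: "q \<in> D" using D(2)[of UNIV] by auto
    obtain c where c: "c \<in> \<rat>" "1 + norm q + k < c"
      using Rats_dense_in_real[of "1 + norm q + k" "2 + norm q + k"] by auto
    have c0: "0 < c" using c(2) norm_ge_zero[of q] by linarith
    have "[(q, c, 1)] \<in> lists P" using q c c0 by (auto simp: P_def)
    then obtain n where n: "g n = tent [(q, c, 1)]" using g' by blast
    have "1 \<le> g n x" if "f x \<noteq> 0" for x
    proof -
      have "dist x q \<le> norm x + norm q" by (simp add: dist_norm norm_triangle_ineq4)
      with k[OF that] c(2) show ?thesis by (simp add: n)
    qed
    then show "\<exists>n. \<forall>x. f x \<noteq> 0 \<longrightarrow> 1 \<le> g n x" by blast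
  qed
  then show ?thesis by blast
qed

definition test_seq :: "nat \<Rightarrow> 'a::euclidean_space \<Rightarrow> real" where
  "test_seq = (SOME g. test_family g)"

lemma
  fixes f :: "'a::euclidean_space \<Rightarrow> real" and x :: 'a
  shows test_seq: "(test_seq n :: 'a \<Rightarrow> real) \<in> test_functions"
    and test_seq_nonneg: "0 \<le> test_seq n x"
    and test_seq_approx: "f \<in> test_functions \<Longrightarrow> (\<And>x. 0 \<le> f x) \<Longrightarrow> 0 < e \<Longrightarrow>
      \<exists>n. \<forall>x. test_seq n x \<le> f x \<and> f x \<le> test_seq n x + e"
    and test_seq_dominates: "f \<in> test_functions \<Longrightarrow> \<exists>n. \<forall>x. f x \<noteq> 0 \<longrightarrow> 1 \<le> test_seq n x"
proof -
  have *: "test_family (test_seq :: nat \<Rightarrow> 'a \<Rightarrow> real)"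
    unfolding test_seq_def by (rule someI_ex[OF test_family_exists])
  show "(test_seq n :: 'a \<Rightarrow> real) \<in> test_functions" "0 \<le> test_seq n x"
    "f \<in> test_functions \<Longrightarrow> (\<And>x. 0 \<le> f x) \<Longrightarrow> 0 < e \<Longrightarrow>
      \<exists>n. \<forall>x. test_seq n x \<le> f x \<and> f x \<le> test_seq n x + e"
    "f \<in> test_functions \<Longrightarrow> \<exists>n. \<forall>x. f x \<noteq> 0 \<longrightarrow> 1 \<le> test_seq n x"
    using * unfolding test_family_def by blast+
qed

text \<open>The positive and negative parts are approximated separately. The index \<open>k\<close> of the dominating
function has to be chosen before the tolerance \<open>e\<close>, since \<open>e\<close> will later depend on the integral of
that function.\<close>

lemma test_seq_approx_signed:
  assumes f: "f \<in> test_functions"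
  shows "\<exists>k. \<forall>e>0. \<exists>i j. \<forall>x. \<bar>f x - (test_seq i x - test_seq j x)\<bar> \<le> e * test_seq k x"
proof -
  have pos: "(\<lambda>x. max (h x) 0) \<in> test_functions" if h: "h \<in> test_functions" for h :: "'a \<Rightarrow> real"
  proof -
    obtain R where "\<And>x. h x \<noteq> 0 \<Longrightarrow> norm x < R" using h by (auto simp: test_function_iff)
    then have "\<forall>x. max (h x) 0 \<noteq> 0 \<longrightarrow> norm x < R" by (metis max.idem)
    moreover have "continuous_on UNIV (\<lambda>x. max (h x) 0)"
      by (intro continuous_intros test_function_continuous h)
    ultimately show ?thesis unfolding test_function_iff by blast
  qed
  have mf: "(\<lambda>x. - f x) \<in> test_functions"
    using test_function_cmult[OF f, of "-1"] by simp
  obtain k where k: "\<And>x. f x \<noteq> 0 \<Longrightarrow> 1 \<le> test_seq k x" using test_seq_dominates[OF f] by blast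
  have "\<exists>i j. \<forall>x. \<bar>f x - (test_seq i x - test_seq j x)\<bar> \<le> e * test_seq k x" if e: "0 < e" for e
  proof -
    obtain i where i: "\<And>x. test_seq i x \<le> max (f x) 0 \<and> max (f x) 0 \<le> test_seq i x + e"
      using test_seq_approx[OF pos[OF f] _ e] by (metis max.cobounded2)
    obtain j where j: "\<And>x. test_seq j x \<le> max (- f x) 0 \<and> max (- f x) 0 \<le> test_seq j x + e"
      using test_seq_approx[OF pos[OF mf] _ e] by (metis max.cobounded2)
    have "\<bar>f x - (test_seq i x - test_seq j x)\<bar> \<le> e * test_seq k x" for x
    proof (cases "f x = 0")
      case True
      then have "test_seq i x = 0" "test_seq j x = 0"
        using i[of x] j[of x] test_seq_nonneg[of i x] test_seq_nonneg[of j x] by auto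
      then show ?thesis using True e test_seq_nonneg[of k x] by simp
    next
      case False
      have "f x = max (f x) 0 - max (- f x) 0" by (simp add: max_def)
      then have "\<bar>f x - (test_seq i x - test_seq j x)\<bar> \<le> e * 1"
        using i[of x] j[of x] by linarith
      also have "\<dots> \<le> e * test_seq k x" using k[OF False] e by (intro mult_left_mono) auto
      finally show ?thesis .
    qed
    then show ?thesis by blast
  qed
  then show ?thesis by blast
qed

section \<open>The vague Borel sets\<close>

text \<open>The integrals against the countable family determine all others continuously, so each vaguely
  open set is the preimage of an open set of sequences. The second countability of the space of
  sequences then makes the integrals of test functions generate the vague Borel sets.\<close>

definition test_coordinates :: "'a::euclidean_space measure \<Rightarrow> nat \<Rightarrow> real" where
  "test_coordinates \<eta> n = (\<integral>x. test_seq n x \<partial>\<eta>)"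

text \<open>Near a measure \<open>\<eta>0\<close> with \<open>\<integral>f d\<eta>0 \<in> U\<close>, three coordinates suffice: two whose difference approximates
\<open>f\<close>, and the dominating one, which bounds the error uniformly in the neighbourhood.\<close>

lemma vague_subbasic_preimage:
  fixes f :: "'a::euclidean_space \<Rightarrow> real"
  assumes f: "f \<in> test_functions" and U: "open U"
  shows "\<exists>W. open W \<and> {\<eta> \<in> radon_measures. (\<integral>x. f x \<partial>\<eta>) \<in> U} = {\<eta> \<in> radon_measures. test_coordinates \<eta> \<in> W}"
proof -
  let ?T = "test_coordinates :: 'a measure \<Rightarrow> nat \<Rightarrow> real"
  let ?I = "\<lambda>\<eta>. \<integral>x. f x \<partial>\<eta>"
  obtain k where k: "\<And>e. 0 < e \<Longrightarrow> \<exists>i j. \<forall>x. \<bar>f x - (test_seq i x - test_seq j x)\<bar> \<le> e * test_seq k x"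
    using test_seq_approx_signed[OF f] by blast
  have "\<exists>W. open W \<and> ?T \<eta>0 \<in> W \<and> (\<forall>\<eta>\<in>radon_measures. ?T \<eta> \<in> W \<longrightarrow> ?I \<eta> \<in> U)"
    if \<eta>0: "\<eta>0 \<in> radon_measures" "?I \<eta>0 \<in> U" for \<eta>0
  proof -
    obtain d where d: "0 < d" "ball (?I \<eta>0) d \<subseteq> U" using U \<eta>0(2) by (auto elim: openE)
    \<comment> \<open>On the neighbourhood the dominating integral stays below its value at \<open>\<eta>0\<close> plus one, so this
      tolerance makes both approximation errors at most \<open>d / 4\<close>.\<close>
    define e where "e = d / (4 * (?T \<eta>0 k + 1))"
    have T0: "0 \<le> ?T \<eta> n" for \<eta> n
      unfolding test_coordinates_def by (intro integral_nonneg_AE AE_I2 test_seq_nonneg)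
    have T1: "0 < ?T \<eta>0 k + 1" using T0[of \<eta>0 k] by linarith
    have e: "0 < e" using d T1 unfolding e_def by simp
    have e': "e * (?T \<eta>0 k + 1) = d / 4"
      using T1 unfolding e_def by (simp add: field_simps)
    obtain i j where ij: "\<And>x. \<bar>f x - (test_seq i x - test_seq j x)\<bar> \<le> e * test_seq k x"
      using k[OF e] by blast
    have approx: "\<bar>?I \<eta> - (?T \<eta> i - ?T \<eta> j)\<bar> \<le> e * ?T \<eta> k" if \<eta>: "\<eta> \<in> radon_measures" for \<eta>
    proof -
      note int = integrable_test_function[OF \<eta>]
      have "?I \<eta> - (?T \<eta> i - ?T \<eta> j) = (\<integral>x. f x - (test_seq i x - test_seq j x) \<partial>\<eta>)"
        by (simp add: test_coordinates_def int f test_seq)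
      also have "\<bar>\<dots>\<bar> \<le> (\<integral>x. \<bar>f x - (test_seq i x - test_seq j x)\<bar> \<partial>\<eta>)"
        by (rule integral_abs_bound)
      also have "\<dots> \<le> (\<integral>x. e * test_seq k x \<partial>\<eta>)"
        by (intro integral_mono ij integrable_abs Bochner_Integration.integrable_diff
              integrable_mult_right int f test_seq)
      also have "\<dots> = e * ?T \<eta> k" by (simp add: test_coordinates_def)
      finally show ?thesis .
    qed
    define W where "W = {u. \<bar>(u i - u j) - (?T \<eta>0 i - ?T \<eta>0 j)\<bar> < d / 4} \<inter> {u :: nat \<Rightarrow> real. u k < ?T \<eta>0 k + 1}"
    have "open W" unfolding W_def
      by (intro open_Int open_Collect_less continuous_intros continuous_on_product_coordinates)
    moreover have "?T \<eta>0 \<in> W" using d by (simp add: W_def)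
    moreover have "?I \<eta> \<in> U" if \<eta>: "\<eta> \<in> radon_measures" and W: "?T \<eta> \<in> W" for \<eta>
    proof -
      have "e * ?T \<eta> k \<le> e * (?T \<eta>0 k + 1)" "e * ?T \<eta>0 k \<le> e * (?T \<eta>0 k + 1)"
        using W e by (intro mult_left_mono; simp add: W_def)+
      moreover have "\<bar>(?T \<eta> i - ?T \<eta> j) - (?T \<eta>0 i - ?T \<eta>0 j)\<bar> < d / 4"
        using W by (simp add: W_def)
      ultimately have "\<bar>?I \<eta>0 - ?I \<eta>\<bar> < d"
        using approx[OF \<eta>] approx[OF \<eta>0(1)] d(1) e' by linarith
      then have "?I \<eta> \<in> ball (?I \<eta>0) d" by (simp add: dist_real_def)
      then show ?thesis using d(2) by blast
    qed
    ultimately show ?thesis by blast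
  qed
  then obtain W where W: "\<And>\<eta>. \<eta> \<in> radon_measures \<Longrightarrow> ?I \<eta> \<in> U \<Longrightarrow> open (W \<eta>) \<and> ?T \<eta> \<in> W \<eta>"
    "\<And>\<eta> \<eta>'. \<eta> \<in> radon_measures \<Longrightarrow> ?I \<eta> \<in> U \<Longrightarrow> \<eta>' \<in> radon_measures \<Longrightarrow> ?T \<eta>' \<in> W \<eta> \<Longrightarrow> ?I \<eta>' \<in> U"
    by metis
  show ?thesis
  proof (intro exI[of _ "\<Union>\<eta>\<in>{\<eta> \<in> radon_measures. ?I \<eta> \<in> U}. W \<eta>"] conjI)
    show "open (\<Union>\<eta>\<in>{\<eta> \<in> radon_measures. ?I \<eta> \<in> U}. W \<eta>)" using W(1) by blast
  qed (use W in blast)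
qed

lemma vague_open_preimage:
  assumes "openin vague_topology U"
  shows "\<exists>W. open W \<and> U = {\<eta> \<in> radon_measures. test_coordinates \<eta> \<in> W}"
proof -
  let ?pre = "\<lambda>U. \<exists>W. open W \<and> U = {\<eta> \<in> radon_measures. test_coordinates \<eta> \<in> W}"
  have "generate_topology_on {{\<eta> \<in> radon_measures. (\<integral>x. f x \<partial>\<eta>) \<in> U} | f U. f \<in> test_functions \<and> open U} U"
    using assms by (simp add: vague_topology_def openin_topology_generated_by_iff)
  then show ?thesis
  proof induction
    case Empty
    show ?case by (rule exI[of _ "{}"]) simp
  next
    case (Int a b)
    then obtain A B where "open A" "a = {\<eta> \<in> radon_measures. test_coordinates \<eta> \<in> A}"
      "open B" "b = {\<eta> \<in> radon_measures. test_coordinates \<eta> \<in> B}" by blast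
    then show ?case by (intro exI[of _ "A \<inter> B"]) (auto intro: open_Int)
  next
    case (UN K)
    then obtain W where "\<And>k. k \<in> K \<Longrightarrow> open (W k) \<and> k = {\<eta> \<in> radon_measures. test_coordinates \<eta> \<in> W k}"
      by metis
    note W = this
    have "\<Union>K = {\<eta> \<in> radon_measures. test_coordinates \<eta> \<in> (\<Union>k\<in>K. W k)}"
    proof (intro equalityI subsetI)
      fix \<eta> :: "'a measure" assume "\<eta> \<in> \<Union>K"
      then obtain k where "k \<in> K" "\<eta> \<in> k" by blast
      then show "\<eta> \<in> {\<eta> \<in> radon_measures. test_coordinates \<eta> \<in> (\<Union>k\<in>K. W k)}"
        using W[of k] by auto
    next
      fix \<eta> :: "'a measure" assume "\<eta> \<in> {\<eta> \<in> radon_measures. test_coordinates \<eta> \<in> (\<Union>k\<in>K. W k)}"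
      then obtain k where "k \<in> K" "test_coordinates \<eta> \<in> W k" "\<eta> \<in> radon_measures" by blast
      then show "\<eta> \<in> \<Union>K" using W[of k] by auto
    qed
    moreover have "open (\<Union>k\<in>K. W k)" using W by blast
    ultimately show ?case by blast
  next
    case (Basis s)
    then show ?case using vague_subbasic_preimage by blast
  qed
qed

lemma
  shows space_vague_borel: "space (vague_borel :: 'a::euclidean_space measure measure) = radon_measures"
    and sets_vague_borel: "sets (vague_borel :: 'a measure measure) =
      sigma_sets radon_measures {U. openin vague_topology U}"
proof -
  have "{U. openin vague_topology U} \<subseteq> Pow (radon_measures :: 'a measure set)"
    using openin_subset topspace_vague_topology by blast
  then show "space (vague_borel :: 'a measure measure) = radon_measures"
    "sets (vague_borel :: 'a measure measure) = sigma_sets radon_measures {U. openin vague_topology U}"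
    unfolding vague_borel_def by simp_all
qed

lemma discrete_imp_radon: "\<eta> \<in> discrete_radon_measures \<Longrightarrow> \<eta> \<in> radon_measures"
  by (simp add: discrete_radon_measures_def)

lemma measurable_integral_test_function [measurable]:
  assumes f: "f \<in> test_functions"
  shows "(\<lambda>\<eta>. \<integral>x. f x \<partial>\<eta>) \<in> borel_measurable discrete_radon_space"
proof -
  have "(\<lambda>\<eta>. \<integral>x. f x \<partial>\<eta>) \<in> borel_measurable vague_borel"
  proof (rule borel_measurableI)
    fix U :: "real set" assume "open U"
    then have "openin vague_topology {\<eta> \<in> radon_measures. (\<integral>x. f x \<partial>\<eta>) \<in> U}"
      unfolding vague_topology_def using f by (intro topology_generated_by_Basis) blast
    then have "{\<eta> \<in> radon_measures. (\<integral>x. f x \<partial>\<eta>) \<in> U} \<in> sets vague_borel"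
      unfolding sets_vague_borel by auto
    also have "{\<eta> \<in> radon_measures. (\<integral>x. f x \<partial>\<eta>) \<in> U} = (\<lambda>\<eta>. \<integral>x. f x \<partial>\<eta>) -` U \<inter> space vague_borel"
      by (auto simp: space_vague_borel)
    finally show "(\<lambda>\<eta>. \<integral>x. f x \<partial>\<eta>) -` U \<inter> space vague_borel \<in> sets vague_borel" .
  qed
  then show ?thesis unfolding discrete_radon_space_def by (rule measurable_restrict_space1)
qed

text \<open>By the preimage description of vaguely open sets, measurability into the vague Borel sets reduces
to measurability of countably many real functions.\<close>

lemma measurable_discrete_radon_spaceI:
  assumes space: "\<And>\<omega>. \<omega> \<in> space M \<Longrightarrow> Y \<omega> \<in> discrete_radon_measures"
    and int: "\<And>n. (\<lambda>\<omega>. \<integral>x. test_seq n x \<partial>Y \<omega>) \<in> borel_measurable M"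
  shows "Y \<in> measurable M discrete_radon_space"
proof -
  have T: "(\<lambda>\<omega>. test_coordinates (Y \<omega>)) \<in> borel_measurable M"
    unfolding test_coordinates_def
    by (intro measurable_coordinatewise_then_product int)
  have "Y \<in> measurable M vague_borel"
    unfolding vague_borel_def
  proof (rule measurable_measure_of)
    show "{U. openin vague_topology U} \<subseteq> Pow (radon_measures :: 'b measure set)"
      using openin_subset topspace_vague_topology by blast
    show "Y \<in> space M \<rightarrow> radon_measures"
      using space discrete_imp_radon by blast
    fix U :: "'b measure set" assume "U \<in> {U. openin vague_topology U}"
    then obtain W where W: "open W" "U = {\<eta> \<in> radon_measures. test_coordinates \<eta> \<in> W}"
      using vague_open_preimage by blast
    have "Y -` U \<inter> space M = (\<lambda>\<omega>. test_coordinates (Y \<omega>)) -` W \<inter> space M"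
      using space discrete_imp_radon by (auto simp: W)
    then show "Y -` U \<inter> space M \<in> sets M"
      using measurable_sets[OF T, of W] W(1) by simp
  qed
  then show ?thesis
    unfolding discrete_radon_space_def by (intro measurable_restrict_space2) (use space in auto)
qed

section \<open>The Fourier transform determines the law\<close>

text \<open>The real algebra generated by the real and imaginary parts of \<open>\<eta> \<mapsto> exp (\<i> \<integral>f d\<eta>)\<close>; by the
addition theorems it is no larger than their linear span. The closure under equality on Radon measures is needed because
\<open>\<integral>f d\<eta> + \<integral>g d\<eta> = \<integral>f + g d\<eta>\<close> may fail for other measures.\<close>

inductive_set trig_functions :: "('a::euclidean_space measure \<Rightarrow> real) set" where
  cos: "f \<in> test_functions \<Longrightarrow> (\<lambda>\<eta>. cos (\<integral>x. f x \<partial>\<eta>)) \<in> trig_functions"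
| sin: "f \<in> test_functions \<Longrightarrow> (\<lambda>\<eta>. sin (\<integral>x. f x \<partial>\<eta>)) \<in> trig_functions"
| add: "s \<in> trig_functions \<Longrightarrow> t \<in> trig_functions \<Longrightarrow> (\<lambda>\<eta>. s \<eta> + t \<eta>) \<in> trig_functions"
| cmult: "t \<in> trig_functions \<Longrightarrow> (\<lambda>\<eta>. c * t \<eta>) \<in> trig_functions"
| cong: "t \<in> trig_functions \<Longrightarrow> (\<forall>\<eta>\<in>radon_measures. s \<eta> = t \<eta>) \<Longrightarrow> s \<in> trig_functions"

lemma integral_test_function_add_diff:
  assumes "f \<in> test_functions" "g \<in> test_functions" "\<eta> \<in> radon_measures"
  shows "(\<integral>x. f x \<partial>\<eta>) + (\<integral>x. g x \<partial>\<eta>) = (\<integral>x. f x + g x \<partial>\<eta>)"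
    and "(\<integral>x. f x \<partial>\<eta>) - (\<integral>x. g x \<partial>\<eta>) = (\<integral>x. f x - g x \<partial>\<eta>)"
  using assms by (simp_all add: integrable_test_function)

lemma trig_functions_cos_mult:
  assumes f: "f \<in> test_functions" and t: "t \<in> trig_functions"
  shows "(\<lambda>\<eta>. cos (\<integral>x. f x \<partial>\<eta>) * t \<eta>) \<in> trig_functions"
  using t
proof induction
  case (cos g)
  show ?case
    by (rule trig_functions.cong[where t = "\<lambda>\<eta>. (1/2) * (cos (\<integral>x. f x - g x \<partial>\<eta>) + cos (\<integral>x. f x + g x \<partial>\<eta>))"],
        intro trig_functions.intros(1-4) test_function_add test_function_diff f cos,
        simp add: cos_times_cos integral_test_function_add_diff[OF f cos])
next
  case (sin g)
  show ?case
    by (rule trig_functions.cong[where t = "\<lambda>\<eta>. (1/2) * (sin (\<integral>x. f x + g x \<partial>\<eta>) + (-1) * sin (\<integral>x. f x - g x \<partial>\<eta>))"],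
        intro trig_functions.intros(1-4) test_function_add test_function_diff f sin,
        simp add: cos_times_sin integral_test_function_add_diff[OF f sin])
next
  case (add s t)
  then show ?case
    by (intro trig_functions.cong[OF trig_functions.add[OF add.IH]]) (simp add: distrib_left)
next
  case (cmult t c)
  then show ?case
    by (intro trig_functions.cong[OF trig_functions.cmult[OF cmult.IH, of c]]) simp
next
  case (cong t s)
  then show ?case
    by (intro trig_functions.cong[OF cong.IH]) simp
qed

lemma trig_functions_sin_mult:
  assumes f: "f \<in> test_functions" and t: "t \<in> trig_functions"
  shows "(\<lambda>\<eta>. sin (\<integral>x. f x \<partial>\<eta>) * t \<eta>) \<in> trig_functions"
  using t
proof induction
  case (cos g)
  show ?case
    by (rule trig_functions.cong[where t = "\<lambda>\<eta>. (1/2) * (sin (\<integral>x. f x + g x \<partial>\<eta>) + sin (\<integral>x. f x - g x \<partial>\<eta>))"],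
        intro trig_functions.intros(1-4) test_function_add test_function_diff f cos,
        simp add: sin_times_cos integral_test_function_add_diff[OF f cos])
next
  case (sin g)
  show ?case
    by (rule trig_functions.cong[where t = "\<lambda>\<eta>. (1/2) * (cos (\<integral>x. f x - g x \<partial>\<eta>) + (-1) * cos (\<integral>x. f x + g x \<partial>\<eta>))"],
        intro trig_functions.intros(1-4) test_function_add test_function_diff f sin,
        simp add: sin_times_sin integral_test_function_add_diff[OF f sin])
next
  case (add s t)
  then show ?case
    by (intro trig_functions.cong[OF trig_functions.add[OF add.IH]]) (simp add: distrib_left)
next
  case (cmult t c)
  then show ?case
    by (intro trig_functions.cong[OF trig_functions.cmult[OF cmult.IH, of c]]) simp
next
  case (cong t s)
  then show ?case
    by (intro trig_functions.cong[OF cong.IH]) simp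
qed

lemma trig_functions_mult:
  assumes s: "s \<in> trig_functions" and t: "t \<in> trig_functions"
  shows "(\<lambda>\<eta>. s \<eta> * t \<eta>) \<in> trig_functions"
  using s
proof induction
  case (add s s')
  then show ?case
    by (intro trig_functions.cong[OF trig_functions.add[OF add.IH]]) (simp add: distrib_right)
next
  case (cmult s c)
  then show ?case
    by (intro trig_functions.cong[OF trig_functions.cmult[OF cmult.IH, of c]]) simp
next
  case (cong s s')
  then show ?case
    by (intro trig_functions.cong[OF cong.IH]) simp
qed (use t trig_functions_cos_mult trig_functions_sin_mult in auto)

lemma trig_functions_const: "(\<lambda>\<eta>. c) \<in> trig_functions"
  by (rule trig_functions.cong[OF trig_functions.cmult[OF trig_functions.cos[OF test_function_zero], of c]])
     simp

lemma space_discrete_sets: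
  "sets M = sets discrete_radon_space \<Longrightarrow> space M = discrete_radon_measures"
  by (metis sets_eq_imp_space_eq space_discrete_radon_space)

lemma integrable_trig_function:
  fixes t :: "'a::euclidean_space measure \<Rightarrow> real"
  assumes t: "t \<in> trig_functions" and M: "prob_space M" "sets M = sets discrete_radon_space"
  shows "integrable M t"
proof -
  interpret prob_space M by (fact M)
  have X: "(\<lambda>\<eta>. \<integral>x. f x \<partial>\<eta>) \<in> borel_measurable M" if "f \<in> test_functions" for f :: "'a \<Rightarrow> real"
    using measurable_integral_test_function[OF that] M(2) by (simp cong: measurable_cong_sets)
  from t show ?thesis
  proof induction
    case (cos f)
    then show ?case
      using X by (intro integrable_const_bound[where B = 1]) auto
  next
    case (sin f)
    then show ?case
      using X by (intro integrable_const_bound[where B = 1]) auto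
  next
    case (cong t s)
    have "integrable M s \<longleftrightarrow> integrable M t"
      using cong.hyps(2) discrete_imp_radon
      by (intro Bochner_Integration.integrable_cong) (auto simp: space_discrete_sets[OF M(2)])
    then show ?case using cong.IH by simp
  qed auto
qed

lemma integral_trig_function_eq:
  fixes t :: "'a::euclidean_space measure \<Rightarrow> real"
  assumes M: "prob_space M" "sets M = sets discrete_radon_space"
    and N: "prob_space N" "sets N = sets discrete_radon_space"
    and eq: "\<And>f :: 'a \<Rightarrow> real. f \<in> test_functions \<Longrightarrow>
      (\<integral>\<eta>. iexp (\<integral>x. f x \<partial>\<eta>) \<partial>M) = (\<integral>\<eta>. iexp (\<integral>x. f x \<partial>\<eta>) \<partial>N)"
    and t: "t \<in> trig_functions"
  shows "(\<integral>\<eta>. t \<eta> \<partial>M) = (\<integral>\<eta>. t \<eta> \<partial>N)"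
proof -
  have X: "integrable M' (\<lambda>\<eta>. iexp (\<integral>x. f x \<partial>\<eta>))"
    if "f \<in> test_functions" "prob_space M'" "sets M' = sets discrete_radon_space"
    for f :: "'a \<Rightarrow> real" and M'
  proof -
    interpret prob_space M' by (fact that)
    have "(\<lambda>\<eta>. \<integral>x. f x \<partial>\<eta>) \<in> borel_measurable M'"
      using measurable_integral_test_function[OF that(1)] that(3) by (simp cong: measurable_cong_sets)
    then show ?thesis by (intro integrable_const_bound[where B = 1]) auto
  qed
  from t show ?thesis
  proof induction
    case (cos f)
    have "(\<integral>\<eta>. cos (\<integral>x. f x \<partial>\<eta>) \<partial>M') = Re (\<integral>\<eta>. iexp (\<integral>x. f x \<partial>\<eta>) \<partial>M')"
      if "prob_space M'" "sets M' = sets discrete_radon_space" for M'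
      using integral_Re[OF X[OF cos that]] by (simp add: Re_exp)
    then show ?case using M N eq[OF cos] by simp
  next
    case (sin f)
    have "(\<integral>\<eta>. sin (\<integral>x. f x \<partial>\<eta>) \<partial>M') = Im (\<integral>\<eta>. iexp (\<integral>x. f x \<partial>\<eta>) \<partial>M')"
      if "prob_space M'" "sets M' = sets discrete_radon_space" for M'
      using integral_Im[OF X[OF sin that]] by (simp add: Im_exp)
    then show ?case using M N eq[OF sin] by simp
  next
    case (add s t)
    then show ?case
      using integrable_trig_function[OF _ M] integrable_trig_function[OF _ N] by simp
  next
    case (cong t s)
    have "(\<integral>\<eta>. s \<eta> \<partial>M') = (\<integral>\<eta>. t \<eta> \<partial>M')" if "sets M' = sets discrete_radon_space" for M'
      using cong.hyps(2) discrete_imp_radon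
      by (intro Bochner_Integration.integral_cong) (auto simp: space_discrete_sets[OF that])
    then show ?case using cong.IH M N by simp
  qed simp
qed

text \<open>Bounded coordinates, so that the Stone-Weierstrass theorem applies on a compact cube. A single sine
does not determine the integral \<open>c\<close>, but \<open>(k + 1) sin (c / (k + 1)) \<longlonglongrightarrow> c\<close> does.\<close>

definition sine_coordinates :: "'a::euclidean_space measure \<Rightarrow> nat \<Rightarrow> real" where
  "sine_coordinates \<eta> n =
     (case prod_decode n of (i, k) \<Rightarrow> sin ((\<integral>x. test_seq i x \<partial>\<eta>) / real (Suc k)))"

lemma sine_coordinates_trig: "(\<lambda>\<eta>. sine_coordinates \<eta> n) \<in> trig_functions"
proof -
  obtain i k where ik: "prod_decode n = (i, k)" by (cases "prod_decode n")
  have "(\<lambda>\<eta>. sin (\<integral>x. (1 / real (Suc k)) * test_seq i x \<partial>\<eta>)) \<in> trig_functions"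
    by (intro trig_functions.sin test_function_cmult test_seq)
  then show ?thesis
    by (rule trig_functions.cong) (simp add: sine_coordinates_def ik)
qed

lemma integral_limit_sine_coordinates:
  "(\<lambda>k. real (Suc k) * sine_coordinates \<eta> (prod_encode (i, k))) \<longlonglongrightarrow> (\<integral>x. test_seq i x \<partial>\<eta>)"
proof -
  let ?c = "\<integral>x. test_seq i x \<partial>\<eta>"
  have "((\<lambda>h. sin (?c * h)) has_real_derivative ?c) (at 0)"
    by (auto intro!: derivative_eq_intros)
  then have "((\<lambda>h. sin (?c * h) / h) \<longlongrightarrow> ?c) (at 0)"
    by (simp add: DERIV_def)
  moreover have "filterlim (\<lambda>k. inverse (real (Suc k))) (at 0) sequentially"
    using LIMSEQ_inverse_real_of_nat by (simp add: filterlim_at)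
  ultimately have "(\<lambda>k. sin (?c * inverse (real (Suc k))) / inverse (real (Suc k))) \<longlonglongrightarrow> ?c"
    by (rule filterlim_compose)
  then show ?thesis
    by (simp add: sine_coordinates_def field_simps)
qed

lemma measurable_sine_coordinates:
  "sine_coordinates \<in> borel_measurable (discrete_radon_space :: 'a::euclidean_space measure measure)"
proof (rule measurable_coordinatewise_then_product)
  fix n
  obtain i k where "prod_decode n = (i, k)" by (cases "prod_decode n")
  then show "(\<lambda>\<eta> :: 'a measure. sine_coordinates \<eta> n) \<in> borel_measurable discrete_radon_space"
    using borel_measurable_divide[OF measurable_integral_test_function[OF test_seq, of i]
        borel_measurable_const[of "real (Suc k)"]]
    by (auto simp: sine_coordinates_def simp del: of_nat_Suc
        intro!: measurable_compose[where g = sin, OF _ borel_measurable_continuous_onI] continuous_intros)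
qed

lemma discrete_sets_sine_coordinates:
  fixes A :: "'a::euclidean_space measure set"
  assumes "A \<in> sets discrete_radon_space"
  obtains B where "B \<in> sets borel" "A = sine_coordinates -` B \<inter> discrete_radon_measures"
proof -
  let ?V = "vimage_algebra (discrete_radon_measures :: 'a measure set) sine_coordinates borel"
  have S: "sine_coordinates \<in> borel_measurable ?V"
    by (rule measurable_vimage_algebra1) simp
  have "(\<lambda>\<eta>. \<eta>) \<in> measurable ?V discrete_radon_space"
  proof (rule measurable_discrete_radon_spaceI)
    fix i
    have "(\<lambda>\<eta>. real (Suc k) * sine_coordinates \<eta> (prod_encode (i, k))) \<in> borel_measurable ?V" for k
      using measurable_product_then_coordinatewise[OF S] by (intro borel_measurable_times) auto
    then show "(\<lambda>\<eta>. \<integral>x. test_seq i x \<partial>\<eta>) \<in> borel_measurable ?V"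
      by (rule borel_measurable_LIMSEQ_real[OF integral_limit_sine_coordinates])
  qed simp
  from measurable_sets[OF this assms] have "A \<inter> discrete_radon_measures \<in> sets ?V" by simp
  moreover have "A \<subseteq> discrete_radon_measures"
    using sets.sets_into_space[OF assms] by (simp add: space_discrete_radon_space)
  ultimately show thesis
    using that by (auto simp: sets_vimage_algebra2 Int_absorb2)
qed

lemma compact_cube: "compact (PiE UNIV (\<lambda>_. {-1..1}) :: (nat \<Rightarrow> real) set)"
proof -
  have "compactin (product_topology (\<lambda>_. euclidean) UNIV) (PiE UNIV (\<lambda>_. {-1..1}) :: (nat \<Rightarrow> real) set)"
    unfolding compactin_PiE by simp
  then show ?thesis by (simp add: euclidean_product_topology)
qed

text \<open>The trigonometric functions that factor through the sine coordinates form an algebra of continuous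
functions on the cube, and it separates points because it contains the coordinates. Both laws
integrate its members equally, hence by the Stone-Weierstrass theorem all continuous functions of
the coordinates, hence all Borel sets of coordinates, and these exhaust the measurable sets.\<close>

theorem discrete_law_eqI:
  fixes M N :: "'a::euclidean_space measure measure"
  assumes M: "prob_space M" "sets M = sets discrete_radon_space"
    and N: "prob_space N" "sets N = sets discrete_radon_space"
    and eq: "\<And>f :: 'a \<Rightarrow> real. f \<in> test_functions \<Longrightarrow>
      (\<integral>\<eta>. iexp (\<integral>x. f x \<partial>\<eta>) \<partial>M) = (\<integral>\<eta>. iexp (\<integral>x. f x \<partial>\<eta>) \<partial>N)"
  shows "M = N"
proof -
  let ?S = "sine_coordinates :: 'a measure \<Rightarrow> nat \<Rightarrow> real"
  define C where "C = (PiE UNIV (\<lambda>_. {-1..1}) :: (nat \<Rightarrow> real) set)"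
  define R where "R = {h. continuous_on C h \<and> (\<exists>t\<in>trig_functions. \<forall>\<eta>. h (?S \<eta>) = t \<eta>)}"
  interpret M: prob_space M by (fact M)
  interpret N: prob_space N by (fact N)
  have SC: "?S \<eta> \<in> C" for \<eta>
    unfolding C_def sine_coordinates_def by (auto split: prod.split)
  interpret function_ring_on R C
  proof
    show "compact C" unfolding C_def by (rule compact_cube)
    show "continuous_on C f" if "f \<in> R" for f using that by (simp add: R_def)
    show "(\<lambda>x. f x + g x) \<in> R" if "f \<in> R" "g \<in> R" for f g
      using that unfolding R_def by (force intro: continuous_on_add trig_functions.add)
    show "(\<lambda>x. f x * g x) \<in> R" if "f \<in> R" "g \<in> R" for f g
      using that unfolding R_def by (force intro: continuous_on_mult trig_functions_mult)
    show "(\<lambda>_. c) \<in> R" for c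
      unfolding R_def by (auto intro: trig_functions_const)
    fix x y :: "nat \<Rightarrow> real" assume "x \<noteq> y"
    then obtain n where "x n \<noteq> y n" by auto
    moreover have "(\<lambda>u. u n) \<in> R"
      unfolding R_def using sine_coordinates_trig[of n]
      by (auto intro: continuous_on_subset[OF continuous_on_product_coordinates])
    ultimately show "\<exists>f\<in>R. f x \<noteq> f y" by (intro bexI[of _ "\<lambda>u. u n"])
  qed
  have S: "?S \<in> borel_measurable M" "?S \<in> borel_measurable N"
    using measurable_sine_coordinates M(2) N(2) by (simp_all cong: measurable_cong_sets)
  have int: "integrable M' (\<lambda>\<eta>. h (?S \<eta>))"
    if h: "continuous_on UNIV h" and M': "prob_space M'" "?S \<in> borel_measurable M'"
    for h :: "(nat \<Rightarrow> real) \<Rightarrow> real" and M'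
  proof -
    interpret prob_space M' by (fact M')
    have "compact (h ` C)"
      using h compact by (intro compact_continuous_image) (auto intro: continuous_on_subset)
    then have "bounded (h ` C)" by (rule compact_imp_bounded)
    then obtain B where "\<And>y. y \<in> h ` C \<Longrightarrow> norm y \<le> B"
      unfolding bounded_iff by blast
    then have "AE \<eta> in M'. norm (h (?S \<eta>)) \<le> B" using SC by auto
    moreover have "(\<lambda>\<eta>. h (?S \<eta>)) \<in> borel_measurable M'"
      using M'(2) borel_measurable_continuous_onI[OF h] by (rule measurable_compose)
    ultimately show ?thesis by (rule integrable_const_bound)
  qed
  have cont: "(\<integral>\<eta>. h (?S \<eta>) \<partial>M) = (\<integral>\<eta>. h (?S \<eta>) \<partial>N)"
    if h: "continuous_on UNIV h" for h :: "(nat \<Rightarrow> real) \<Rightarrow> real"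
  proof -
    have close: "\<bar>(\<integral>\<eta>. h (?S \<eta>) \<partial>M) - (\<integral>\<eta>. h (?S \<eta>) \<partial>N)\<bar> \<le> 2 * e" if e: "0 < e" for e
    proof -
      obtain g where g: "g \<in> R" "\<And>x. x \<in> C \<Longrightarrow> \<bar>h x - g x\<bar> < e"
        using Stone_Weierstrass_basic[OF continuous_on_subset[OF h subset_UNIV] e] by blast
      then obtain t where t: "t \<in> trig_functions" "\<And>\<eta>. g (?S \<eta>) = t \<eta>"
        by (auto simp: R_def)
      have bound: "\<bar>(\<integral>\<eta>. h (?S \<eta>) \<partial>M') - (\<integral>\<eta>. t \<eta> \<partial>M')\<bar> \<le> e"
        if M': "prob_space M'" "sets M' = sets discrete_radon_space" "?S \<in> borel_measurable M'" for M'
      proof -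
        interpret prob_space M' by (fact M')
        note i = int[OF h M'(1,3)] integrable_trig_function[OF t(1) M'(1,2)]
        have "\<bar>\<integral>\<eta>. h (?S \<eta>) - t \<eta> \<partial>M'\<bar> \<le> (\<integral>\<eta>. \<bar>h (?S \<eta>) - t \<eta>\<bar> \<partial>M')"
          by (rule integral_abs_bound)
        also have "\<dots> \<le> (\<integral>\<eta>. e \<partial>M')"
          using i g(2)[OF SC] t(2) by (intro integral_mono) (auto intro: less_imp_le)
        finally show ?thesis using i by (simp add: prob_space)
      qed
      show ?thesis
        using bound[OF M S(1)] bound[OF N S(2)] integral_trig_function_eq[OF M N eq t(1)] by linarith
    qed
    have "\<bar>(\<integral>\<eta>. h (?S \<eta>) \<partial>M) - (\<integral>\<eta>. h (?S \<eta>) \<partial>N)\<bar> \<le> 0"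
    proof (rule field_le_epsilon)
      fix e :: real assume "0 < e"
      then show "\<bar>(\<integral>\<eta>. h (?S \<eta>) \<partial>M) - (\<integral>\<eta>. h (?S \<eta>) \<partial>N)\<bar> \<le> 0 + e" using close[of "e / 2"] by simp
    qed
    then show ?thesis by simp
  qed
  have closed: "measure M (?S -` F \<inter> space M) = measure N (?S -` F \<inter> space N)"
    if F: "closed F" "F \<noteq> {}" for F
  proof -
    \<comment> \<open>Continuous functions that decrease to the indicator of \<open>F\<close>.\<close>
    define h where "h k u = max 0 (1 - real k * infdist u F)" for k u
    have h: "continuous_on UNIV (h k)" for k
      unfolding h_def by (intro continuous_intros)
    have lim: "(\<lambda>k. h k u) \<longlonglongrightarrow> indicat_real F u" for u
    proof (cases "u \<in> F")
      case True
      then show ?thesis by (simp add: h_def)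
    next
      case False
      then have "0 < infdist u F"
        using F in_closed_iff_infdist_zero[of F u] infdist_nonneg[of u F] by force
      then obtain k0 :: nat where k0: "1 < real k0 * infdist u F"
        using reals_Archimedean3 by blast
      have "h k u = 0" if "k0 \<le> k" for k
      proof -
        have "real k0 * infdist u F \<le> real k * infdist u F"
          using that by (intro mult_right_mono infdist_nonneg) simp
        then show ?thesis using k0 by (simp add: h_def)
      qed
      then have "eventually (\<lambda>k. h k u = 0) sequentially"
        unfolding eventually_sequentially by blast
      then show ?thesis using False by (simp add: tendsto_eventually)
    qed
    have h01: "norm (h k u) \<le> 1" for k u
      using infdist_nonneg[of u F] by (simp add: h_def)
    have *: "(\<lambda>k. \<integral>\<eta>. h k (?S \<eta>) \<partial>M') \<longlonglongrightarrow> measure M' (?S -` F \<inter> space M')"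
      if M': "prob_space M'" "?S \<in> borel_measurable M'" for M'
    proof -
      interpret prob_space M' by (fact M')
      have Fm: "?S -` F \<inter> space M' \<in> sets M'"
        using F by (intro measurable_sets[OF M'(2)]) simp
      have "(\<lambda>k. \<integral>\<eta>. h k (?S \<eta>) \<partial>M') \<longlonglongrightarrow> (\<integral>\<eta>. indicat_real F (?S \<eta>) \<partial>M')"
        using lim h01 integrable_const[of 1] F
        by (intro integral_dominated_convergence[where w = "\<lambda>_. 1"])
           (auto intro!: measurable_compose[OF M'(2)] borel_measurable_continuous_onI[OF h] borel_measurable_indicator borel_closed)
      also have "(\<integral>\<eta>. indicat_real F (?S \<eta>) \<partial>M') = (\<integral>\<eta>. indicat_real (?S -` F \<inter> space M') \<eta> \<partial>M')"
        by (intro Bochner_Integration.integral_cong) (auto simp: indicator_def)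
      also have "\<dots> = measure M' (?S -` F \<inter> space M')"
        using Fm by simp
      finally show ?thesis .
    qed
    show ?thesis
      using *[OF M(1) S(1)] *[OF N(1) S(2)] unfolding cont[OF h] by (rule LIMSEQ_unique)
  qed
  have "distr M borel ?S = distr N borel ?S"
  proof (rule measure_eqI_generator_eq[where E = "Collect closed" and \<Omega> = UNIV and A = "\<lambda>_. UNIV"])
    show "Int_stable (Collect closed :: (nat \<Rightarrow> real) set set)" by (auto simp: Int_stable_def)
    fix F :: "(nat \<Rightarrow> real) set" assume F: "F \<in> Collect closed"
    then show "emeasure (distr M borel ?S) F = emeasure (distr N borel ?S) F"
      using closed[of F] S by (cases "F = {}") (auto simp: emeasure_distr M.emeasure_eq_measure N.emeasure_eq_measure)
  next
    interpret D: prob_space "distr M borel ?S" by (rule M.prob_space_distr[OF S(1)])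
    show "emeasure (distr M borel ?S) UNIV \<noteq> \<infinity>" by simp
  qed (auto simp: borel_eq_closed)
  show ?thesis
  proof (rule measure_eqI)
    show "sets M = sets N" using M N by simp
    fix A assume "A \<in> sets M"
    then obtain B where B: "B \<in> sets borel" "A = ?S -` B \<inter> discrete_radon_measures"
      using M(2) discrete_sets_sine_coordinates by metis
    have "emeasure M A = emeasure (distr M borel ?S) B"
      using B S by (simp add: emeasure_distr space_discrete_sets[OF M(2)])
    also have "\<dots> = emeasure (distr N borel ?S) B"
      using \<open>distr M borel ?S = distr N borel ?S\<close> by simp
    also have "\<dots> = emeasure N A"
      using B S by (simp add: emeasure_distr space_discrete_sets[OF N(2)])
    finally show "emeasure M A = emeasure N A" .
  qed
qed

section \<open>Measurable functions of the atoms\<close>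

text \<open>The indicator of a bounded open set is the limit of test functions with support in that set, and
dominated convergence applies because the set has finite measure.\<close>

lemma measurable_emeasure_open:
  fixes U :: "'a::euclidean_space set"
  assumes U: "open U" "bounded U"
  shows "(\<lambda>\<eta>. emeasure \<eta> U) \<in> borel_measurable discrete_radon_space"
proof -
  define f where "f k x = min 1 (real k * infdist x (- U))" for k and x :: 'a
  have ne: "- U \<noteq> {}" using U(2) not_bounded_UNIV by (metis Compl_empty_eq double_compl)
  have zero: "x \<in> U" if "f k x \<noteq> 0" for k x
    using that infdist_zero[of x "- U"] by (cases "x \<in> U") (auto simp: f_def)
  have f: "f k \<in> test_functions" for k
  proof -
    obtain R where "\<forall>x\<in>U. norm x < R" using U(2) unfolding bounded_pos_less by blast
    then have "\<forall>x. f k x \<noteq> 0 \<longrightarrow> norm x < R" using zero by blast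
    moreover have "continuous_on UNIV (f k)" unfolding f_def by (intro continuous_intros)
    ultimately show ?thesis unfolding test_function_iff by blast
  qed
  have lim: "(\<lambda>k. f k x) \<longlonglongrightarrow> indicat_real U x" for x
  proof (cases "x \<in> U")
    case False
    then have "(\<lambda>k. f k x) = (\<lambda>k. 0)" using zero[of _ x] by auto
    then show ?thesis using False by simp
  next
    case True
    have "closed (- U)" using U(1) by (rule closed_Compl)
    then have "0 < infdist x (- U)"
      using in_closed_iff_infdist_zero[OF _ ne, of x] True infdist_nonneg[of x "- U"] by force
    then obtain k0 :: nat where k0: "1 < real k0 * infdist x (- U)"
      using reals_Archimedean3 by blast
    have "f k x = 1" if "k0 \<le> k" for k
    proof -
      have "real k0 * infdist x (- U) \<le> real k * infdist x (- U)"
        using that by (intro mult_right_mono infdist_nonneg) simp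
      then show ?thesis using k0 by (simp add: f_def)
    qed
    then have "eventually (\<lambda>k. f k x = 1) sequentially"
      unfolding eventually_sequentially by blast
    then show ?thesis using True by (simp add: tendsto_eventually)
  qed
  have bound: "norm (f k x) \<le> indicat_real U x" for k x
    using zero[of k x] infdist_nonneg[of x "- U"] by (cases "x \<in> U") (auto simp: f_def)
  have "(\<lambda>k. \<integral>x. f k x \<partial>\<eta>) \<longlonglongrightarrow> measure \<eta> U" if \<eta>: "\<eta> \<in> radon_measures" for \<eta>
  proof -
    have Um: "U \<in> sets \<eta>" using radon_measureD(1)[OF \<eta>] U by simp
    moreover have "emeasure \<eta> U < \<infinity>" by (rule radon_measure_bounded_finite[OF \<eta> U(2)])
    ultimately have "integrable \<eta> (indicat_real U)"
      by (simp add: integrable_indicator_iff)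
    then have "(\<lambda>k. \<integral>x. f k x \<partial>\<eta>) \<longlonglongrightarrow> (\<integral>x. indicat_real U x \<partial>\<eta>)"
      using lim bound integrable_test_function[OF \<eta> f]
      by (intro integral_dominated_convergence[where w = "indicat_real U"])
         (auto dest: borel_measurable_integrable)
    also have "(\<integral>x. indicat_real U x \<partial>\<eta>) = measure \<eta> U" using Um by simp
    finally show ?thesis .
  qed
  note lim_integral = this
  have "(\<lambda>\<eta>. measure \<eta> U) \<in> borel_measurable discrete_radon_space"
  proof (rule borel_measurable_LIMSEQ_metric)
    show "(\<lambda>\<eta>. \<integral>x. f k x \<partial>\<eta>) \<in> borel_measurable discrete_radon_space" for k
      by (rule measurable_integral_test_function[OF f])
    show "(\<lambda>k. \<integral>x. f k x \<partial>\<eta>) \<longlonglongrightarrow> measure \<eta> U" if "\<eta> \<in> space discrete_radon_space" for \<eta>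
      using that by (intro lim_integral discrete_imp_radon) (simp add: space_discrete_radon_space)
  qed
  then have "(\<lambda>\<eta>. ennreal (measure \<eta> U)) \<in> borel_measurable discrete_radon_space" by simp
  also have "?this \<longleftrightarrow> ?thesis"
    using radon_measure_bounded_finite[OF discrete_imp_radon U(2)]
    by (intro measurable_cong) (simp add: space_discrete_radon_space emeasure_eq_ennreal_measure less_top)
  finally show ?thesis .
qed

lemma measurable_emeasure_ball:
  fixes A :: "'a::euclidean_space set"
  assumes "A \<in> sets borel"
  shows "(\<lambda>\<eta>. emeasure \<eta> (A \<inter> ball 0 r)) \<in> borel_measurable discrete_radon_space"
proof -
  let ?K = "discrete_radon_space :: 'a measure measure" and ?B = "ball (0::'a) r"
  have sets: "sets \<eta> = sets borel" if "\<eta> \<in> space ?K" for \<eta>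
    using that radon_measureD(1) discrete_imp_radon by (auto simp: space_discrete_radon_space)
  have "Int_stable {U :: 'a set. open U}" "{U :: 'a set. open U} \<subseteq> Pow UNIV"
    by (auto simp: Int_stable_def)
  moreover have "A \<in> sigma_sets UNIV {U. open U}" using assms by (simp add: borel_def)
  ultimately show ?thesis
  proof (induction rule: sigma_sets_induct_disjoint)
    case (basic U)
    then show ?case by (intro measurable_emeasure_open) auto
  next
    case (compl A)
    then have A: "A \<in> sets borel" by (simp add: borel_def)
    have "(\<lambda>\<eta>. emeasure \<eta> ?B - emeasure \<eta> (A \<inter> ?B)) \<in> borel_measurable ?K"
      by (intro borel_measurable_minus_ennreal compl measurable_emeasure_open) auto
    also have "?this \<longleftrightarrow> (\<lambda>\<eta>. emeasure \<eta> ((UNIV - A) \<inter> ?B)) \<in> borel_measurable ?K"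
    proof (intro measurable_cong)
      fix \<eta> :: "'a measure" assume \<eta>: "\<eta> \<in> space ?K"
      then have \<eta>': "\<eta> \<in> radon_measures" using discrete_imp_radon by (auto simp: space_discrete_radon_space)
      have "emeasure \<eta> (?B - A \<inter> ?B) = emeasure \<eta> ?B - emeasure \<eta> (A \<inter> ?B)"
        using A sets[OF \<eta>] radon_measure_bounded_finite[OF \<eta>', of "A \<inter> ?B"]
        by (intro emeasure_Diff) (auto simp: bounded_Int less_top)
      moreover have "?B - A \<inter> ?B = (UNIV - A) \<inter> ?B" by auto
      ultimately show "emeasure \<eta> ?B - emeasure \<eta> (A \<inter> ?B) = emeasure \<eta> ((UNIV - A) \<inter> ?B)" by simp
    qed
    finally show ?case .
  next
    case (union A)
    then have A: "A i \<in> sets borel" for i by (auto simp: borel_def)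
    have "(\<lambda>\<eta>. \<Sum>i. emeasure \<eta> (A i \<inter> ?B)) \<in> borel_measurable ?K"
      by (intro borel_measurable_suminf_order union)
    also have "?this \<longleftrightarrow> (\<lambda>\<eta>. emeasure \<eta> (\<Union> (range A) \<inter> ?B)) \<in> borel_measurable ?K"
    proof (intro measurable_cong)
      fix \<eta> :: "'a measure" assume \<eta>: "\<eta> \<in> space ?K"
      have "(\<Sum>i. emeasure \<eta> (A i \<inter> ?B)) = emeasure \<eta> (\<Union>i. A i \<inter> ?B)"
        using A sets[OF \<eta>] disjoint_family_subset[OF union(1), of "\<lambda>i. A i \<inter> ?B"]
        by (intro suminf_emeasure) auto
      then show "(\<Sum>i. emeasure \<eta> (A i \<inter> ?B)) = emeasure \<eta> (\<Union> (range A) \<inter> ?B)" by simp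
    qed
    finally show ?case .
  qed auto
qed

text \<open>Normalising by \<open>1 + \<eta>(B)\<close> turns the restriction of \<open>\<eta>\<close> to a ball \<open>B\<close> into a subprobability
  kernel, for which joint measurability of parameter integrals is known.\<close>

lemma measurable_nn_integral_ball:
  fixes Y :: "'b \<Rightarrow> 'a::euclidean_space measure"
  assumes Y: "Y \<in> measurable M discrete_radon_space"
    and g: "(\<lambda>(\<omega>, x). g \<omega> x) \<in> borel_measurable (M \<Otimes>\<^sub>M borel)"
  shows "(\<lambda>\<omega>. \<integral>\<^sup>+x. g \<omega> x * indicator (ball 0 r) x \<partial>Y \<omega>) \<in> borel_measurable M"
proof -
  let ?B = "ball (0::'a) r"
  define c where "c \<omega> = 1 + emeasure (Y \<omega>) ?B" for \<omega>
  define L where "L \<omega> = scale_measure (1 / c \<omega>) (density (Y \<omega>) (indicator ?B))" for \<omega>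
  have Y': "Y \<omega> \<in> radon_measures" "sets (Y \<omega>) = sets borel" "emeasure (Y \<omega>) ?B < \<infinity>"
    if "\<omega> \<in> space M" for \<omega>
  proof -
    show *: "Y \<omega> \<in> radon_measures"
      using measurable_space[OF Y that] discrete_imp_radon by (auto simp: space_discrete_radon_space)
    show "sets (Y \<omega>) = sets borel" by (rule radon_measureD(1)[OF *])
    show "emeasure (Y \<omega>) ?B < \<infinity>" by (rule radon_measure_bounded_finite[OF * bounded_ball])
  qed
  have c: "c \<omega> \<noteq> 0" "c \<omega> < \<infinity>" if "\<omega> \<in> space M" for \<omega>
    using Y'(3)[OF that] by (auto simp: c_def)
  have cm: "c \<in> borel_measurable M"
    using measurable_compose[OF Y measurable_emeasure_open[of ?B]] unfolding c_def by simp
  have emL: "emeasure (L \<omega>) A = 1 / c \<omega> * emeasure (Y \<omega>) (A \<inter> ?B)"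
    if "\<omega> \<in> space M" "A \<in> sets borel" for \<omega> A
  proof -
    have "emeasure (density (Y \<omega>) (indicator ?B)) A = (\<integral>\<^sup>+x. indicator ?B x * indicator A x \<partial>Y \<omega>)"
      using Y'(2)[OF that(1)] that(2) by (intro emeasure_density borel_measurable_indicator) auto
    also have "\<dots> = (\<integral>\<^sup>+x. indicator (A \<inter> ?B) x \<partial>Y \<omega>)"
      by (intro nn_integral_cong) (auto simp: indicator_def)
    also have "\<dots> = emeasure (Y \<omega>) (A \<inter> ?B)"
      using Y'(2)[OF that(1)] that(2) by (intro nn_integral_indicator) auto
    finally show ?thesis by (simp add: L_def)
  qed
  have L: "L \<in> measurable M (subprob_algebra borel)"
  proof (rule measurable_subprob_algebra)
    fix \<omega> assume \<omega>: "\<omega> \<in> space M"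
    show "sets (L \<omega>) = sets borel" using Y'(2)[OF \<omega>] by (simp add: L_def)
    then have [simp]: "space (L \<omega>) = UNIV" by (metis sets_eq_imp_space_eq space_borel)
    show "subprob_space (L \<omega>)"
    proof
      have "emeasure (L \<omega>) UNIV = 1 / c \<omega> * emeasure (Y \<omega>) ?B"
        using emL[OF \<omega>, of UNIV] by simp
      also have "\<dots> \<le> 1 / c \<omega> * c \<omega>" by (intro mult_left_mono) (simp_all add: c_def)
      also have "\<dots> = 1" using c[OF \<omega>] by (simp add: ennreal_divide_times less_top)
      finally show "emeasure (L \<omega>) (space (L \<omega>)) \<le> 1" by simp
    qed simp
  next
    fix A :: "'a set" assume A: "A \<in> sets borel"
    have "(\<lambda>\<omega>. 1 / c \<omega> * emeasure (Y \<omega>) (A \<inter> ?B)) \<in> borel_measurable M"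
      using cm measurable_compose[OF Y measurable_emeasure_ball[OF A]] by simp
    then show "(\<lambda>\<omega>. emeasure (L \<omega>) A) \<in> borel_measurable M"
      by (rule measurable_cong[THEN iffD2, rotated]) (rule emL[OF _ A])
  qed
  have "(\<lambda>\<omega>. c \<omega> * (\<integral>\<^sup>+x. g \<omega> x \<partial>L \<omega>)) \<in> borel_measurable M"
    by (intro borel_measurable_times_ennreal cm nn_integral_measurable_subprob_algebra2[OF g L])
  also have "?this \<longleftrightarrow> ?thesis"
  proof (intro measurable_cong)
    fix \<omega> assume \<omega>: "\<omega> \<in> space M"
    have gm: "g \<omega> \<in> borel_measurable (Y \<omega>)"
      using measurable_compose[OF measurable_Pair1'[OF \<omega>] g] Y'(2)[OF \<omega>]
      by (simp cong: measurable_cong_sets)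
    have ind: "indicator ?B \<in> borel_measurable (Y \<omega>)"
      by (intro borel_measurable_indicator) (simp add: Y'(2)[OF \<omega>])
    have "c \<omega> * (\<integral>\<^sup>+x. g \<omega> x \<partial>L \<omega>) = (c \<omega> * (1 / c \<omega>)) * (\<integral>\<^sup>+x. g \<omega> x \<partial>density (Y \<omega>) (indicator ?B))"
      using gm unfolding L_def by (simp add: nn_integral_scale_measure mult.assoc)
    also have "\<dots> = (\<integral>\<^sup>+x. g \<omega> x \<partial>density (Y \<omega>) (indicator ?B))"
      using c[OF \<omega>] by (simp add: ennreal_times_divide less_top ennreal_divide_self)
    also have "\<dots> = (\<integral>\<^sup>+x. g \<omega> x * indicator ?B x \<partial>Y \<omega>)"
      by (subst nn_integral_density[OF ind gm]) (simp add: mult.commute)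
    finally show "c \<omega> * (\<integral>\<^sup>+x. g \<omega> x \<partial>L \<omega>) = (\<integral>\<^sup>+x. g \<omega> x * indicator ?B x \<partial>Y \<omega>)" .
  qed
  finally show ?thesis .
qed

text \<open>The weight \<open>\<eta>{x}\<close> is itself the integral of a function of \<open>(x, y)\<close> against \<open>\<eta>(dy)\<close>, namely of the
indicator of the diagonal; so the kernel lemma, applied twice, gives joint measurability.\<close>

lemma measurable_nn_integral_atom:
  fixes G :: "'a::euclidean_space \<times> real \<Rightarrow> ennreal"
  assumes G: "G \<in> borel_measurable borel"
  shows "(\<lambda>\<eta>. \<integral>\<^sup>+x. G (x, measure \<eta> {x}) * indicator (ball 0 r) x \<partial>\<eta>) \<in> borel_measurable discrete_radon_space"
proof -
  let ?K = "discrete_radon_space :: 'a measure measure" and ?B = "ball (0::'a) r"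
  define h where "h = (\<lambda>p. \<integral>\<^sup>+y. indicator {snd p} y * indicator ?B y \<partial>fst p :: ennreal)"
  have "(\<lambda>(p, y). indicator {snd p} y :: ennreal) \<in> borel_measurable ((?K \<Otimes>\<^sub>M borel) \<Otimes>\<^sub>M (borel :: 'a measure))"
  proof -
    have "(\<lambda>q. if snd q = snd (fst q) then 1 else 0 :: ennreal) \<in> borel_measurable ((?K \<Otimes>\<^sub>M borel) \<Otimes>\<^sub>M (borel :: 'a measure))"
      by measurable
    also have "(\<lambda>q. if snd q = snd (fst q) then 1 else 0 :: ennreal) = (\<lambda>(p, y). indicator {snd p} y)"
      by (auto simp: indicator_def)
    finally show ?thesis by (simp add: case_prod_unfold)
  qed
  then have "h \<in> borel_measurable (?K \<Otimes>\<^sub>M borel)"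
    unfolding h_def by (intro measurable_nn_integral_ball) simp_all
  then have "(\<lambda>p. (snd p, enn2real (h p))) \<in> measurable (?K \<Otimes>\<^sub>M borel) borel"
    by (intro borel_measurable_Pair borel_measurable_enn2real) simp_all
  from measurable_compose[OF this G]
  have "(\<lambda>(\<eta>, x). G (x, enn2real (h (\<eta>, x)))) \<in> borel_measurable (?K \<Otimes>\<^sub>M borel)"
    by (simp add: case_prod_unfold)
  then have "(\<lambda>\<eta>. \<integral>\<^sup>+x. G (x, enn2real (h (\<eta>, x))) * indicator ?B x \<partial>\<eta>) \<in> borel_measurable ?K"
    by (intro measurable_nn_integral_ball) simp_all
  also have "?this \<longleftrightarrow> ?thesis"
  proof (intro measurable_cong nn_integral_cong)
    fix \<eta> :: "'a measure" and x assume \<eta>: "\<eta> \<in> space ?K"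
    have "sets \<eta> = sets borel"
      using \<eta> discrete_imp_radon radon_measureD(1) by (auto simp: space_discrete_radon_space)
    then have "h (\<eta>, x) = emeasure \<eta> {x}" if "x \<in> ?B"
    proof -
      have "h (\<eta>, x) = (\<integral>\<^sup>+y. indicator {x} y \<partial>\<eta>)"
        unfolding h_def fst_conv snd_conv using that
        by (intro nn_integral_cong) (auto simp: indicator_def)
      also have "\<dots> = emeasure \<eta> {x}" using \<open>sets \<eta> = sets borel\<close> by (intro nn_integral_indicator) simp
      finally show ?thesis .
    qed
    then show "G (x, enn2real (h (\<eta>, x))) * indicator ?B x = G (x, measure \<eta> {x}) * indicator ?B x"
      by (auto simp: indicator_def measure_def)
  qed
  finally show ?thesis .
qed

lemma discrete_radon_nn_integral:
  assumes \<eta>: "\<eta> \<in> discrete_radon_measures" and h: "h \<in> borel_measurable borel"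
  shows "(\<integral>\<^sup>+x. h x \<partial>\<eta>) = (\<integral>\<^sup>+x. ennreal (measure \<eta> {x}) * h x \<partial>count_space (atoms \<eta>))"
    and "countable (atoms \<eta>)"
proof -
  obtain S s where S: "countable S" "\<And>x. x \<in> S \<Longrightarrow> 0 < s x"
    and em: "\<And>A. A \<in> sets borel \<Longrightarrow> emeasure \<eta> A =
      (\<integral>\<^sup>+x. ennreal (s x) * emeasure (return borel x) A \<partial>count_space S)"
    using \<eta> by (auto simp: discrete_radon_measures_def)
  have sets: "sets \<eta> = sets borel" using radon_measureD(1)[OF discrete_imp_radon[OF \<eta>]] .
  have "emeasure \<eta> {y} = (if y \<in> S then ennreal (s y) else 0)" for y
  proof -
    have "emeasure \<eta> {y} = (\<integral>\<^sup>+x. ennreal (s x) * indicator {y} x \<partial>count_space S)"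
      by (simp add: em)
    also have "\<dots> = (if y \<in> S then ennreal (s y) else 0)"
    proof (cases "y \<in> S")
      case True
      then show ?thesis by (subst nn_integral_count_space'[where A = "{y}"]) auto
    next
      case False
      then show ?thesis by (subst nn_integral_count_space'[where A = "{}"]) (auto simp: indicator_def)
    qed
    finally show ?thesis .
  qed
  then have m: "measure \<eta> {y} = (if y \<in> S then s y else 0)" for y
    using S(2)[of y] by (simp add: measure_def)
  have atoms: "atoms \<eta> = S" using S(2) by (auto simp: atoms_def m)
  show "countable (atoms \<eta>)" using S atoms by simp
  have "\<eta> = distr (density (count_space S) (\<lambda>x. ennreal (s x))) borel (\<lambda>x. x)"
  proof (rule measure_eqI)
    fix A assume "A \<in> sets \<eta>"
    then have A: "A \<in> sets borel" using sets by simp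
    have "emeasure (distr (density (count_space S) (\<lambda>x. ennreal (s x))) borel (\<lambda>x. x)) A =
        emeasure (density (count_space S) (\<lambda>x. ennreal (s x))) (A \<inter> S)"
      using A by (subst emeasure_distr) auto
    also have "\<dots> = (\<integral>\<^sup>+x. ennreal (s x) * indicator (A \<inter> S) x \<partial>count_space S)"
      by (subst emeasure_density) auto
    also have "\<dots> = emeasure \<eta> A"
      unfolding em[OF A] using A by (intro nn_integral_cong) (auto simp: indicator_def)
    finally show "emeasure \<eta> A = emeasure (distr (density (count_space S) (\<lambda>x. ennreal (s x))) borel (\<lambda>x. x)) A"
      by simp
  qed (simp add: sets)
  then have "(\<integral>\<^sup>+x. h x \<partial>\<eta>) = (\<integral>\<^sup>+x. h x \<partial>distr (density (count_space S) (\<lambda>x. ennreal (s x))) borel (\<lambda>x. x))"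
    by simp
  also have "\<dots> = (\<integral>\<^sup>+x. ennreal (s x) * h x \<partial>count_space S)"
    using h by (simp add: nn_integral_distr nn_integral_density)
  also have "\<dots> = (\<integral>\<^sup>+x. ennreal (measure \<eta> {x}) * h x \<partial>count_space (atoms \<eta>))"
    unfolding atoms by (intro nn_integral_cong) (simp add: m)
  finally show "(\<integral>\<^sup>+x. h x \<partial>\<eta>) = (\<integral>\<^sup>+x. ennreal (measure \<eta> {x}) * h x \<partial>count_space (atoms \<eta>))" .
qed

definition atom_sum :: "nat \<Rightarrow> ('a::euclidean_space \<times> real \<Rightarrow> ennreal) \<Rightarrow> 'a measure \<Rightarrow> ennreal" where
  "atom_sum n F \<eta> = (\<integral>\<^sup>+x. F (x, measure \<eta> {x}) \<partial>count_space (atoms \<eta> \<inter> ball 0 (real n)))"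

lemma measurable_measure_singleton:
  assumes "\<eta> \<in> discrete_radon_measures"
  shows "(\<lambda>x. measure \<eta> {x}) \<in> borel_measurable borel"
proof -
  have c: "countable (atoms \<eta>)"
    using discrete_radon_nn_integral(2)[OF assms borel_measurable_const] .
  have "(\<lambda>x. measure \<eta> {x}) = (\<lambda>x. if x \<in> atoms \<eta> then measure \<eta> {x} else 0)"
    by (auto simp: atoms_def not_less fun_eq_iff antisym)
  also have "\<dots> \<in> borel_measurable borel"
    using measurable_discrete_difference[where f = "\<lambda>x. 0 :: real" and M = borel and N = borel and X = "atoms \<eta>"] c
    by auto
  finally show ?thesis .
qed

text \<open>Dividing by the weight of the atom turns an integral against \<open>\<eta>\<close> into a sum over the
  atoms.\<close>

lemma measurable_atom_sum:
  fixes F :: "'a::euclidean_space \<times> real \<Rightarrow> ennreal"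
  assumes F: "F \<in> borel_measurable borel"
  shows "atom_sum n F \<in> borel_measurable discrete_radon_space"
proof -
  define G where "G p = F p / ennreal (snd p)" for p
  have G: "G \<in> borel_measurable borel"
  proof -
    have "(snd :: 'a \<times> real \<Rightarrow> real) \<in> borel_measurable borel"
      by (intro borel_measurable_continuous_onI continuous_intros)
    then show ?thesis unfolding G_def using F by measurable
  qed
  have "(\<lambda>\<eta>. \<integral>\<^sup>+x. G (x, measure \<eta> {x}) * indicator (ball 0 (real n)) x \<partial>\<eta>) \<in> borel_measurable discrete_radon_space"
    by (rule measurable_nn_integral_atom[OF G])
  also have "?this \<longleftrightarrow> ?thesis"
  proof (intro measurable_cong)
    fix \<eta> :: "'a measure" assume "\<eta> \<in> space discrete_radon_space"
    then have \<eta>: "\<eta> \<in> discrete_radon_measures" by (simp add: space_discrete_radon_space)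
    have "(\<lambda>x. (x, measure \<eta> {x})) \<in> borel_measurable borel"
      using measurable_measure_singleton[OF \<eta>] by (intro borel_measurable_Pair) auto
    then have "(\<lambda>x. G (x, measure \<eta> {x})) \<in> borel_measurable borel"
      using G by (rule measurable_compose)
    then have "(\<integral>\<^sup>+x. G (x, measure \<eta> {x}) * indicator (ball 0 (real n)) x \<partial>\<eta>) =
        (\<integral>\<^sup>+x. ennreal (measure \<eta> {x}) * (G (x, measure \<eta> {x}) * indicator (ball 0 (real n)) x) \<partial>count_space (atoms \<eta>))"
      by (intro discrete_radon_nn_integral(1)[OF \<eta>] borel_measurable_times_ennreal borel_measurable_indicator) auto
    also have "\<dots> = (\<integral>\<^sup>+x. F (x, measure \<eta> {x}) * indicator (ball 0 (real n)) x \<partial>count_space (atoms \<eta>))"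
    proof (intro nn_integral_cong)
      fix x assume "x \<in> space (count_space (atoms \<eta>))"
      then have "0 < measure \<eta> {x}" by (simp add: atoms_def)
      then have "ennreal (measure \<eta> {x}) * G (x, measure \<eta> {x}) = F (x, measure \<eta> {x})"
        using mult_divide_eq_ennreal[of "ennreal (measure \<eta> {x})" "F (x, measure \<eta> {x})"]
        by (simp add: G_def ennreal_times_divide mult.commute)
      then show "ennreal (measure \<eta> {x}) * (G (x, measure \<eta> {x}) * indicator (ball 0 (real n)) x) =
          F (x, measure \<eta> {x}) * indicator (ball 0 (real n)) x"
        by (simp add: mult.assoc[symmetric])
    qed
    also have "\<dots> = atom_sum n F \<eta>"
      unfolding atom_sum_def
      by (subst (1 2) nn_integral_count_space_indicator)
         (auto intro!: nn_integral_cong simp: indicator_def)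
    finally show "(\<integral>\<^sup>+x. G (x, measure \<eta> {x}) * indicator (ball 0 (real n)) x \<partial>\<eta>) = atom_sum n F \<eta>" .
  qed
  finally show ?thesis .
qed

section \<open>Poisson clusters\<close>

text \<open>Only finitely many coordinates enter, so the infinite product measure can be replaced by a finite
one.\<close>

lemma
  fixes f :: "'i \<Rightarrow> 'a \<Rightarrow> 'b::{real_normed_field, banach, second_countable_topology}"
  assumes M: "\<And>i. prob_space (M i)" and J: "finite J" "J \<subseteq> I"
    and f: "\<And>i. i \<in> J \<Longrightarrow> integrable (M i) (f i)"
  shows integrable_PiM_prod: "integrable (PiM I M) (\<lambda>\<omega>. \<Prod>i\<in>J. f i (\<omega> i))"
    and integral_PiM_prod: "(\<integral>\<omega>. (\<Prod>i\<in>J. f i (\<omega> i)) \<partial>PiM I M) = (\<Prod>i\<in>J. \<integral>x. f i x \<partial>M i)"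
proof -
  interpret product_prob_space M I by (rule product_prob_spaceI) (rule M)
  have R: "(\<lambda>\<omega>. restrict \<omega> J) \<in> measurable (PiM I M) (PiM J M)"
    by (rule measurable_restrict_subset[OF J(2)])
  have f': "(\<lambda>\<omega>. \<Prod>i\<in>J. f i (\<omega> i)) \<in> borel_measurable (PiM J M)"
    using product_integrable_prod[OF J(1) f] by (rule borel_measurable_integrable)
  note int = product_integrable_prod[OF J(1) f]
  have *: "(\<Prod>i\<in>J. f i (restrict \<omega> J i)) = (\<Prod>i\<in>J. f i (\<omega> i))" for \<omega>
    by (intro prod.cong) auto
  show "integrable (PiM I M) (\<lambda>\<omega>. \<Prod>i\<in>J. f i (\<omega> i))"
    using int integrable_distr_eq[OF R f'] by (simp add: * distr_PiM_restrict_finite[OF J])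
  have "(\<integral>\<omega>. (\<Prod>i\<in>J. f i (\<omega> i)) \<partial>PiM J M) = (\<integral>\<omega>. (\<Prod>i\<in>J. f i (\<omega> i)) \<partial>PiM I M)"
    using integral_distr[OF R f'] by (simp add: * distr_PiM_restrict_finite[OF J])
  then show "(\<integral>\<omega>. (\<Prod>i\<in>J. f i (\<omega> i)) \<partial>PiM I M) = (\<Prod>i\<in>J. \<integral>x. f i x \<partial>M i)"
    using product_integral_prod[OF J(1) f] by simp
qed

text \<open>Given by its density with respect to counting measure so that rate zero, where \<open>0 ^ 0 = 1\<close> makes it
the point mass at \<open>0\<close>, is included: cells of measure zero may occur.\<close>

definition poisson_law :: "real \<Rightarrow> nat measure" where
  "poisson_law lam = density (count_space UNIV) (\<lambda>k. ennreal (lam ^ k / fact k * exp (- lam)))"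

lemma sets_poisson_law [simp, measurable_cong]: "sets (poisson_law lam) = sets (count_space UNIV)"
  by (simp add: poisson_law_def)

lemma space_poisson_law [simp]: "space (poisson_law lam) = UNIV"
  by (simp add: poisson_law_def)

lemma
  fixes c :: "'b::{real_normed_field, banach, second_countable_topology}"
  assumes lam: "0 \<le> lam"
  shows integrable_poisson_power: "integrable (poisson_law lam) (\<lambda>k. c ^ k)"
    and integral_poisson_power: "(\<integral>k. c ^ k \<partial>poisson_law lam) = exp (of_real lam * (c - 1))"
proof -
  have term_eq: "(lam ^ k / fact k * exp (- lam)) *\<^sub>R c ^ k =
      of_real (exp (- lam)) * ((of_real lam * c) ^ k /\<^sub>R fact k)" for k
    by (simp add: scaleR_conv_of_real power_mult_distrib field_simps)
  have nn: "AE k in count_space UNIV. 0 \<le> lam ^ k / fact k * exp (- lam)"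
    using lam by simp
  have "summable (\<lambda>k. norm (of_real (exp (- lam)) * ((of_real lam * c) ^ k /\<^sub>R fact k)))"
    unfolding norm_mult by (intro summable_mult summable_norm_exp)
  then have int: "integrable (count_space UNIV) (\<lambda>k. (lam ^ k / fact k * exp (- lam)) *\<^sub>R c ^ k)"
    unfolding integrable_count_space_nat_iff term_eq .
  then show "integrable (poisson_law lam) (\<lambda>k. c ^ k)"
    unfolding poisson_law_def by (subst integrable_density) (use nn in auto)
  have "(\<lambda>k. (lam ^ k / fact k * exp (- lam)) *\<^sub>R c ^ k) sums (of_real (exp (- lam)) * exp (of_real lam * c))"
    unfolding term_eq by (intro sums_mult exp_converges)
  then have "(\<integral>k. (lam ^ k / fact k * exp (- lam)) *\<^sub>R c ^ k \<partial>count_space UNIV) =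
      of_real (exp (- lam)) * exp (of_real lam * c)"
    using sums_integral_count_space_nat[OF int] by (rule sums_unique2[symmetric])
  also have "\<dots> = exp (of_real (- lam)) * exp (of_real lam * c)"
    by (simp only: exp_of_real)
  also have "\<dots> = exp (of_real lam * (c - 1))"
    by (simp add: exp_add[symmetric] algebra_simps)
  finally show "(\<integral>k. c ^ k \<partial>poisson_law lam) = exp (of_real lam * (c - 1))"
    unfolding poisson_law_def by (subst integral_density) (use nn in auto)
qed

lemma prob_space_poisson_law:
  assumes "0 \<le> lam" shows "prob_space (poisson_law lam)"
proof
  have i: "integrable (poisson_law lam) (\<lambda>k. 1 :: real)"
    using integrable_poisson_power[OF assms, of "1 :: real"] by simp
  then have fin: "emeasure (poisson_law lam) UNIV < \<infinity>"
    by (simp add: integrable_iff_bounded)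
  have "measure (poisson_law lam) UNIV = 1"
    using integral_poisson_power[OF assms, of "1 :: real"] by simp
  with fin show "emeasure (poisson_law lam) (space (poisson_law lam)) = 1"
    by (simp add: emeasure_eq_ennreal_measure less_top)
qed

text \<open>A Poisson number of points together with an infinite independent sample; only the first \<open>fst z\<close>
entries of \<open>snd z\<close> count as points.\<close>

definition poisson_cluster :: "real \<Rightarrow> 'b measure \<Rightarrow> (nat \<times> (nat \<Rightarrow> 'b)) measure" where
  "poisson_cluster lam Q = poisson_law lam \<Otimes>\<^sub>M PiM UNIV (\<lambda>_. Q)"

lemma prob_space_poisson_cluster:
  assumes "0 \<le> lam" "prob_space Q" shows "prob_space (poisson_cluster lam Q)"
proof -
  interpret L: prob_space "poisson_law lam" by (rule prob_space_poisson_law[OF assms(1)])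
  interpret P: prob_space "PiM UNIV (\<lambda>_ :: nat. Q)" by (intro prob_space_PiM assms)
  interpret PP: pair_prob_space "poisson_law lam" "PiM UNIV (\<lambda>_ :: nat. Q)" ..
  show ?thesis unfolding poisson_cluster_def by (rule PP.prob_space_axioms)
qed

lemma measurable_poisson_cluster:
  assumes "\<And>k. (\<lambda>p. g (k, p)) \<in> measurable (PiM UNIV (\<lambda>_. Q)) K"
  shows "g \<in> measurable (poisson_cluster lam Q) K"
proof -
  have "g \<in> measurable (count_space UNIV \<Otimes>\<^sub>M PiM UNIV (\<lambda>_. Q)) K"
    by (intro measurable_pair_measure_countable1 assms) auto
  also have "measurable (count_space UNIV \<Otimes>\<^sub>M PiM UNIV (\<lambda>_. Q)) K = measurable (poisson_cluster lam Q) K"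
    unfolding poisson_cluster_def by (intro measurable_cong_sets sets_pair_measure_cong) simp_all
  finally show ?thesis .
qed

lemma
  fixes F :: "'a \<Rightarrow> 'b::{real_normed_field, banach, second_countable_topology}"
  assumes lam: "0 \<le> lam" and Q: "prob_space Q" and F: "integrable Q F"
  shows integrable_poisson_cluster: "integrable (poisson_cluster lam Q) (\<lambda>(k, p). \<Prod>i<k. F (p i))"
    and integral_poisson_cluster:
      "(\<integral>(k, p). (\<Prod>i<k. F (p i)) \<partial>poisson_cluster lam Q) = exp (of_real lam * ((\<integral>x. F x \<partial>Q) - 1))"
proof -
  let ?P = "PiM UNIV (\<lambda>_ :: nat. Q)" and ?G = "\<lambda>(k, p). \<Prod>i<k. F (p i)"
  interpret L: prob_space "poisson_law lam" by (rule prob_space_poisson_law[OF lam])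
  interpret P: prob_space ?P by (intro prob_space_PiM Q)
  interpret pair_sigma_finite "poisson_law lam" ?P ..
  have iG: "integrable ?P (\<lambda>p. \<Prod>i<k. F (p i))" for k
    by (rule integrable_PiM_prod) (use F Q in auto)
  have G: "(\<integral>p. (\<Prod>i<k. F (p i)) \<partial>?P) = (\<integral>x. F x \<partial>Q) ^ k" for k
    by (subst integral_PiM_prod) (use F Q in auto)
  have nG: "(\<integral>p. (\<Prod>i<k. norm (F (p i))) \<partial>?P) = (\<integral>x. norm (F x) \<partial>Q) ^ k" for k
    by (subst integral_PiM_prod) (use F Q in auto)
  have "integrable (poisson_law lam \<Otimes>\<^sub>M ?P) ?G"
  proof (rule Fubini_integrable)
    have "(\<lambda>(k, p). \<Prod>i<k. F (p i)) \<in> borel_measurable (poisson_cluster lam Q)"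
      by (rule measurable_poisson_cluster) (use borel_measurable_integrable[OF iG] in simp)
    then show "?G \<in> borel_measurable (poisson_law lam \<Otimes>\<^sub>M ?P)" by (simp add: poisson_cluster_def)
    show "integrable (poisson_law lam) (\<lambda>k. \<integral>p. norm (?G (k, p)) \<partial>?P)"
      using integrable_poisson_power[OF lam, of "\<integral>x. norm (F x) \<partial>Q"] by (simp add: nG prod_norm[symmetric])
    show "AE k in poisson_law lam. integrable ?P (\<lambda>p. ?G (k, p))" using iG by simp
  qed
  then show "integrable (poisson_cluster lam Q) ?G" by (simp add: poisson_cluster_def)
  have "(\<integral>z. ?G z \<partial>poisson_cluster lam Q) = (\<integral>k. \<integral>p. ?G (k, p) \<partial>?P \<partial>poisson_law lam)"
    unfolding poisson_cluster_def by (rule integral_fst'[symmetric]) fact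
  also have "\<dots> = exp (of_real lam * ((\<integral>x. F x \<partial>Q) - 1))"
    by (simp add: G integral_poisson_power[OF lam])
  finally show "(\<integral>z. ?G z \<partial>poisson_cluster lam Q) = exp (of_real lam * ((\<integral>x. F x \<partial>Q) - 1))" .
qed

text \<open>The expectation of \<open>\<Prod>i<k. indicator A (p i)\<close> is \<open>exp (lam * (measure Q A - 1)) = 1\<close>. A random
variable with values in \<open>{0, 1}\<close> and expectation \<open>1\<close> is almost surely \<open>1\<close>.\<close>

lemma AE_poisson_cluster_points:
  assumes lam: "0 \<le> lam" and Q: "prob_space Q" and A: "A \<in> sets Q" "lam * (1 - measure Q A) = 0"
  shows "AE z in poisson_cluster lam Q. \<forall>i<fst z. snd z i \<in> A"
proof -
  let ?G = "\<lambda>(k, p). \<Prod>i<k. indicat_real A (p i)"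
  interpret Q: prob_space Q by (fact Q)
  interpret C: prob_space "poisson_cluster lam Q" by (rule prob_space_poisson_cluster[OF lam Q])
  have F: "integrable Q (indicat_real A)"
    using A(1) by (simp add: integrable_indicator_iff Q.emeasure_eq_measure)
  note int = integrable_poisson_cluster[OF lam Q F]
  have "lam * (measure Q A - 1) = 0" using A(2) by (simp add: algebra_simps)
  then have "(\<integral>z. ?G z \<partial>poisson_cluster lam Q) = 1"
    using integral_poisson_cluster[OF lam Q F] A by simp
  then have "(\<integral>z. 1 - ?G z \<partial>poisson_cluster lam Q) = 0"
    using int by (subst Bochner_Integration.integral_diff) (auto simp: C.prob_space)
  moreover have "integrable (poisson_cluster lam Q) (\<lambda>z. 1 - ?G z)"
    using int by (intro Bochner_Integration.integrable_diff) auto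
  moreover have "0 \<le> 1 - ?G z" for z
    by (auto simp: split_beta intro!: prod_le_1)
  ultimately have "AE z in poisson_cluster lam Q. 1 - ?G z = 0"
    by (subst (asm) integral_nonneg_eq_0_iff_AE) (auto intro!: AE_I2 simp: split_beta)
  then show ?thesis
  proof (eventually_elim)
    case (elim z)
    then have "(\<Prod>i<fst z. indicat_real A (snd z i)) \<noteq> 0" by (simp add: split_beta)
    then show ?case by (auto simp: prod_zero_iff indicator_def split: if_splits)
  qed
qed

text \<open>Fubini: for each value of the other point, the location \<open>g\<close> hits it with probability zero.\<close>

lemma AE_PiM_distinct:
  fixes g :: "'b \<Rightarrow> 'a::euclidean_space"
  assumes Q: "prob_space Q" and g: "g \<in> borel_measurable Q"
    and null: "\<And>y. emeasure Q {q \<in> space Q. g q = y} = 0" and ij: "i \<noteq> (j :: nat)"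
  shows "AE p in PiM UNIV (\<lambda>_. Q). g (p i) \<noteq> g (p j)"
proof -
  interpret product_prob_space "\<lambda>_. Q" UNIV by (rule product_prob_spaceI) (rule Q)
  let ?I = "PiM UNIV (\<lambda>_ :: nat. Q)" and ?J = "PiM {i, j} (\<lambda>_. Q)"
  let ?f = "\<lambda>p. indicator {p. g (p i) = g (p j)} p :: ennreal"
  have R: "(\<lambda>p. restrict p {i, j}) \<in> measurable ?I ?J"
    by (rule measurable_restrict_subset) simp
  have [measurable]: "(\<lambda>p. g (p i)) \<in> borel_measurable ?J" "(\<lambda>p. g (p j)) \<in> borel_measurable ?J"
    by (rule measurable_compose[OF measurable_component_singleton[where M = "\<lambda>_. Q"] g]; simp)+
  have "(\<lambda>p. if g (p i) = g (p j) then 1 else 0 :: ennreal) \<in> borel_measurable ?J"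
    by measurable
  then have f: "?f \<in> borel_measurable ?J"
    by (rule measurable_cong[THEN iffD1, rotated]) (auto simp: indicator_def)
  have "(\<integral>\<^sup>+p. ?f p \<partial>?I) = (\<integral>\<^sup>+p. ?f (restrict p {i, j}) \<partial>?I)"
    by (intro nn_integral_cong) (simp add: indicator_def)
  also have "\<dots> = (\<integral>\<^sup>+p. ?f p \<partial>?J)"
    using nn_integral_distr[OF R, of ?f] f by (simp add: distr_PiM_restrict_finite)
  also have "\<dots> = (\<integral>\<^sup>+p. (\<integral>\<^sup>+q. ?f (p(i := q)) \<partial>Q) \<partial>PiM {j} (\<lambda>_. Q))"
    using ij f by (intro product_nn_integral_insert) auto
  also have "\<dots> = (\<integral>\<^sup>+p. 0 \<partial>PiM {j} (\<lambda>_. Q))"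
  proof (intro nn_integral_cong)
    fix p :: "nat \<Rightarrow> 'b"
    have "(\<integral>\<^sup>+q. ?f (p(i := q)) \<partial>Q) = (\<integral>\<^sup>+q. indicator {q \<in> space Q. g q = g (p j)} q \<partial>Q)"
      using ij by (intro nn_integral_cong) (auto simp: indicator_def)
    also have "\<dots> = emeasure Q {q \<in> space Q. g q = g (p j)}"
    proof (rule nn_integral_indicator)
      have "{q \<in> space Q. g q = g (p j)} = g -` {g (p j)} \<inter> space Q" by auto
      then show "{q \<in> space Q. g q = g (p j)} \<in> sets Q" using measurable_sets[OF g] by simp
    qed
    finally show "(\<integral>\<^sup>+q. ?f (p(i := q)) \<partial>Q) = 0" using null by simp
  qed
  finally have "(\<integral>\<^sup>+p. ?f p \<partial>?I) = 0" by simp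
  moreover have "?f \<in> borel_measurable ?I"
    using measurable_compose[OF R f] by (rule measurable_cong[THEN iffD1, rotated]) (auto simp: indicator_def)
  ultimately have "AE p in ?I. ?f p = 0"
    by (simp add: nn_integral_0_iff_AE)
  then show ?thesis by eventually_elim (simp add: indicator_def split: if_splits)
qed

lemma AE_poisson_cluster_distinct:
  fixes g :: "'b \<Rightarrow> 'a::euclidean_space"
  assumes lam: "0 \<le> lam" and Q: "prob_space Q" and g: "g \<in> borel_measurable Q"
    and null: "\<And>y. lam * measure Q {q \<in> space Q. g q = y} = 0"
  shows "AE z in poisson_cluster lam Q. inj_on (\<lambda>i. g (snd z i)) {..<fst z}"
proof (cases "lam = 0")
  case True
  have "AE z in poisson_cluster lam Q. \<forall>i<fst z. snd z i \<in> {}"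
    by (rule AE_poisson_cluster_points[OF lam Q]) (auto simp: True)
  then show ?thesis by eventually_elim (auto simp: inj_on_def)
next
  case False
  interpret Q: prob_space Q by (fact Q)
  interpret L: prob_space "poisson_law lam" by (rule prob_space_poisson_law[OF lam])
  interpret P: prob_space "PiM UNIV (\<lambda>_ :: nat. Q)" by (intro prob_space_PiM Q)
  interpret PP: pair_sigma_finite "poisson_law lam" "PiM UNIV (\<lambda>_ :: nat. Q)" ..
  have "AE p in PiM UNIV (\<lambda>_. Q). g (p i) \<noteq> g (p j)" if "i \<noteq> j" for i j :: nat
    using null False by (intro AE_PiM_distinct[OF Q g _ that]) (simp add: Q.emeasure_eq_measure)
  then have *: "AE p in PiM UNIV (\<lambda>_. Q). \<forall>i j :: nat. i \<noteq> j \<longrightarrow> g (p i) \<noteq> g (p j)"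
    unfolding AE_all_countable by (auto simp: AE_all_countable)
  have [measurable]: "(\<lambda>z. g (snd z i)) \<in> borel_measurable (poisson_law lam \<Otimes>\<^sub>M PiM UNIV (\<lambda>_. Q))" for i :: nat
    by (intro measurable_compose[OF measurable_snd] measurable_compose[OF measurable_component_singleton[where M = "\<lambda>_. Q"] g]) simp
  have "{z \<in> space (poisson_law lam \<Otimes>\<^sub>M PiM UNIV (\<lambda>_. Q)). \<forall>i j :: nat. i \<noteq> j \<longrightarrow> g (snd z i) \<noteq> g (snd z j)}
      \<in> sets (poisson_law lam \<Otimes>\<^sub>M PiM UNIV (\<lambda>_. Q))"
    by measurable
  then have "AE z in poisson_law lam \<Otimes>\<^sub>M PiM UNIV (\<lambda>_. Q). \<forall>i j :: nat. i \<noteq> j \<longrightarrow> g (snd z i) \<noteq> g (snd z j)"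
    using * by (intro PP.AE_pair_measure) auto
  then show ?thesis
    unfolding poisson_cluster_def by eventually_elim (auto simp: inj_on_def)
qed

section \<open>The compound Poisson random measure\<close>

text \<open>The hypotheses on \<open>m\<close> that do not involve diffeomorphisms. The transported measure satisfies them as
well, and inherits sigma-finiteness in this way.\<close>

locale marked_measure =
  fixes m :: "('a::euclidean_space \<times> real) measure"
  assumes sets_m: "sets m = sets marked_space"
    and null_fibre: "\<And>x. emeasure m ({x} \<times> {0<..}) = 0"
    and finite_strip: "\<And>\<Lambda>. \<Lambda> \<in> relatively_compact_borel \<Longrightarrow> emeasure m (\<Lambda> \<times> {0<..}) < \<infinity>"
begin

lemma space_m: "space m = UNIV \<times> {0<..}"
  using sets_eq_imp_space_eq[OF sets_m] by (simp add: marked_space_def space_restrict_space)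

lemma measurable_m_iff: "measurable m N = measurable marked_space N"
  by (rule measurable_cong_sets[OF sets_m refl])

lemma borel_measurable_m: "f \<in> borel_measurable borel \<Longrightarrow> f \<in> borel_measurable m"
  unfolding measurable_m_iff marked_space_def by (rule measurable_restrict_space1)

lemma fst_measurable: "fst \<in> borel_measurable m"
  by (intro borel_measurable_m borel_measurable_continuous_onI continuous_intros)

lemma snd_measurable: "snd \<in> borel_measurable m"
  by (intro borel_measurable_m borel_measurable_continuous_onI continuous_intros)

lemma strip_sets: "A \<in> sets borel \<Longrightarrow> A \<times> {0<..} \<in> sets m"
proof -
  assume "A \<in> sets borel"
  then have "fst -` A \<inter> space m \<in> sets m" by (rule measurable_sets[OF fst_measurable])
  also have "fst -` A \<inter> space m = A \<times> {0<..}" by (auto simp: space_m)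
  finally show ?thesis .
qed

text \<open>The annuli cut space into bounded pieces, and each centred ball of integer radius is a finite union
of them; the points above different annuli are generated independently.\<close>

definition annulus :: "nat \<Rightarrow> 'a set" where
  "annulus n = {x. real n \<le> norm x \<and> norm x < real (Suc n)}"

definition cell :: "nat \<Rightarrow> ('a \<times> real) set" where
  "cell n = annulus n \<times> {0<..}"

lemma annulus_ball: "x \<in> annulus n \<Longrightarrow> norm x < real k \<longleftrightarrow> n < k"
  by (auto simp: annulus_def)

lemma annulus_floor: "x \<in> annulus n \<longleftrightarrow> n = nat \<lfloor>norm x\<rfloor>"
  unfolding annulus_def by (auto simp: nat_eq_iff floor_eq_iff) linarith+

lemma annulus_sets: "annulus n \<in> sets borel"
  unfolding annulus_def by measurable

lemma cell_sets: "cell n \<in> sets m"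
  unfolding cell_def by (rule strip_sets[OF annulus_sets])

lemma bounded_strip_finite:
  assumes "A \<in> sets borel" "bounded A" shows "emeasure m (A \<times> {0<..}) < \<infinity>"
  using assms by (intro finite_strip) (simp add: relatively_compact_borel_def compact_closure)

lemma cell_finite: "emeasure m (cell n) < \<infinity>"
  unfolding cell_def
proof (rule bounded_strip_finite[OF annulus_sets])
  show "bounded (annulus n)"
    by (rule boundedI[of _ "real (Suc n)"]) (auto simp: annulus_def)
qed

definition rate :: "nat \<Rightarrow> real" where
  "rate n = measure m (cell n)"

lemma rate_nonneg: "0 \<le> rate n"
  by (simp add: rate_def)

lemma emeasure_cell: "emeasure m (cell n) = ennreal (rate n)"
  using cell_finite by (simp add: rate_def emeasure_eq_ennreal_measure less_top)

text \<open>The normalised restriction of \<open>m\<close> to a cell. On a cell of measure zero the number of points is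
almost surely zero, and the value \<open>(0, 1)\<close> is an arbitrary choice.\<close>

definition point_law :: "nat \<Rightarrow> ('a \<times> real) measure" where
  "point_law n = (if rate n = 0 then return m (0, 1)
     else density m (\<lambda>p. ennreal (indicat_real (cell n) p / rate n)))"

lemma sets_point_law [simp, measurable_cong]: "sets (point_law n) = sets m"
  by (simp add: point_law_def)

lemma space_point_law [simp]: "space (point_law n) = space m"
  by (simp add: point_law_def)

lemma prob_space_point_law: "prob_space (point_law n)"
proof (cases "rate n = 0")
  case True
  then show ?thesis
    by (simp add: point_law_def) (rule prob_space_return, simp add: space_m)
next
  case False
  have "emeasure (point_law n) (space m) = (\<integral>\<^sup>+p. ennreal (1 / rate n) * indicator (cell n) p \<partial>m)"
    using False cell_sets[of n] unfolding point_law_def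
    by (simp add: emeasure_density) (intro nn_integral_cong, auto simp: indicator_def)
  also have "\<dots> = ennreal (1 / rate n) * ennreal (rate n)"
    using cell_sets[of n] by (simp add: nn_integral_cmult_indicator emeasure_cell)
  also have "\<dots> = 1"
    using False rate_nonneg[of n] by (simp add: ennreal_mult[symmetric])
  finally show ?thesis by (intro prob_spaceI) simp
qed

text \<open>Multiplying by the rate undoes the normalisation, and on a cell of measure zero both sides vanish.
The value type is general because indicators and complex exponentials are both needed.\<close>

lemma
  fixes F :: "'a \<times> real \<Rightarrow> 'b::{real_normed_field, banach, second_countable_topology}"
  assumes F: "F \<in> borel_measurable m" and int: "integrable m (\<lambda>p. indicat_real (cell n) p *\<^sub>R (F p - 1))"
  shows integrable_point_law: "integrable (point_law n) F"
    and integral_point_law: "of_real (rate n) * ((\<integral>p. F p \<partial>point_law n) - 1) =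
      (\<integral>p. indicat_real (cell n) p *\<^sub>R (F p - 1) \<partial>m)"
proof -
  interpret P: prob_space "point_law n" by (rule prob_space_point_law)
  have ic: "integrable m (indicat_real (cell n))"
    using cell_sets cell_finite by (simp add: integrable_indicator_iff)
  have "integrable (point_law n) F \<and> of_real (rate n) * ((\<integral>p. F p \<partial>point_law n) - 1) =
      (\<integral>p. indicat_real (cell n) p *\<^sub>R (F p - 1) \<partial>m)"
  proof (cases "rate n = 0")
    case True
    have "AE p in m. p \<notin> cell n"
      using emeasure_cell[of n] True cell_sets[of n] by (intro AE_not_in) (simp add: null_setsI)
    then have "AE p in m. indicat_real (cell n) p *\<^sub>R (F p - 1) = 0"
      by eventually_elim simp
    then have "(\<integral>p. indicat_real (cell n) p *\<^sub>R (F p - 1) \<partial>m) = 0"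
      by (rule integral_eq_zero_AE)
    moreover have "integrable (return m (0, 1)) F"
      using F by (intro integrableI_bounded) (simp_all add: nn_integral_return space_m)
    ultimately show ?thesis using True by (simp add: point_law_def)
  next
    case False
    let ?g = "\<lambda>p. indicat_real (cell n) p / rate n"
    have g: "?g \<in> borel_measurable m" "AE p in m. 0 \<le> ?g p"
      using cell_sets[of n] rate_nonneg[of n] by auto
    have Q: "point_law n = density m (\<lambda>p. ennreal (?g p))" using False by (simp add: point_law_def)
    have "integrable m (\<lambda>p. ?g p *\<^sub>R (F p - 1))"
      using integrable_scaleR_right[OF int, of "1 / rate n"] by simp
    then have i1: "integrable (point_law n) (\<lambda>p. F p - 1)"
      unfolding Q by (subst integrable_density) (use F g in auto)
    then have "integrable (point_law n) (\<lambda>p. (F p - 1) + 1)"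
      by (intro Bochner_Integration.integrable_add) auto
    then have iF: "integrable (point_law n) F" by simp
    have "(\<integral>p. F p \<partial>point_law n) - 1 = (\<integral>p. F p - 1 \<partial>point_law n)"
      using iF P.prob_space by simp
    also have "\<dots> = (\<integral>p. ?g p *\<^sub>R (F p - 1) \<partial>m)"
      unfolding Q by (subst integral_density) (use F g in auto)
    also have "\<dots> = (\<integral>p. (1 / rate n) *\<^sub>R (indicat_real (cell n) p *\<^sub>R (F p - 1)) \<partial>m)"
      by simp
    also have "\<dots> = (1 / rate n) *\<^sub>R (\<integral>p. indicat_real (cell n) p *\<^sub>R (F p - 1) \<partial>m)"
      by (rule integral_scaleR_right)
    finally have "of_real (rate n) * ((\<integral>p. F p \<partial>point_law n) - 1) =
      (\<integral>p. indicat_real (cell n) p *\<^sub>R (F p - 1) \<partial>m)"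
      using False by (simp add: scaleR_conv_of_real)
    with iF show ?thesis by blast
  qed
  then show "integrable (point_law n) F" "of_real (rate n) * ((\<integral>p. F p \<partial>point_law n) - 1) =
      (\<integral>p. indicat_real (cell n) p *\<^sub>R (F p - 1) \<partial>m)" by blast+
qed

text \<open>In an element \<open>\<omega>\<close>, the number of points above the \<open>n\<close>-th annulus is \<open>fst (\<omega> n)\<close>, and \<open>snd (\<omega> n) i\<close> is
the \<open>i\<close>-th such point with its mark.\<close>

definition cluster_space :: "(nat \<Rightarrow> nat \<times> (nat \<Rightarrow> 'a \<times> real)) measure" where
  "cluster_space = PiM UNIV (\<lambda>n. poisson_cluster (rate n) (point_law n))"

lemma prob_space_cluster: "prob_space (poisson_cluster (rate n) (point_law n))"
  by (intro prob_space_poisson_cluster rate_nonneg prob_space_point_law)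

lemma prob_space_cluster_space: "prob_space cluster_space"
  unfolding cluster_space_def by (intro prob_space_PiM prob_space_cluster)

lemma cluster_point_space:
  assumes "\<omega> \<in> space cluster_space" shows "snd (\<omega> n) i \<in> UNIV \<times> {0<..}"
proof -
  have "\<omega> n \<in> space (poisson_cluster (rate n) (point_law n))"
    using assms by (auto simp: cluster_space_def space_PiM)
  then show ?thesis
    by (auto simp: poisson_cluster_def space_pair_measure space_PiM space_m PiE_iff)
qed

lemma AE_cluster_space:
  "AE z in poisson_cluster (rate n) (point_law n). P n z \<Longrightarrow> AE \<omega> in cluster_space. P n (\<omega> n)"
  unfolding cluster_space_def by (rule AE_PiM_component) (auto intro: prob_space_cluster)

lemma measurable_cluster_component:
  assumes "\<And>k. (\<lambda>p. g (k, p)) \<in> measurable (PiM UNIV (\<lambda>_. m)) K"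
  shows "(\<lambda>\<omega>. g (\<omega> n)) \<in> measurable cluster_space K"
proof -
  have "g \<in> measurable (poisson_cluster (rate n) (point_law n)) K"
  proof (rule measurable_poisson_cluster)
    fix k
    have "measurable (PiM UNIV (\<lambda>_ :: nat. m)) K = measurable (PiM UNIV (\<lambda>_. point_law n)) K"
      by (intro measurable_cong_sets sets_PiM_cong) simp_all
    then show "(\<lambda>p. g (k, p)) \<in> measurable (PiM UNIV (\<lambda>_. point_law n)) K" using assms by blast
  qed
  then show ?thesis unfolding cluster_space_def
    by (intro measurable_compose[OF measurable_component_singleton]) auto
qed

lemma AE_cluster_points:
  assumes A: "A \<in> sets m" "AE p in m. p \<in> A"
  shows "AE \<omega> in cluster_space. \<forall>n. \<forall>i<fst (\<omega> n). snd (\<omega> n) i \<in> A \<inter> cell n"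
proof -
  have "AE z in poisson_cluster (rate n) (point_law n). \<forall>i<fst z. snd z i \<in> A \<inter> cell n" for n
  proof (rule AE_poisson_cluster_points[OF rate_nonneg prob_space_point_law])
    interpret P: prob_space "point_law n" by (rule prob_space_point_law)
    let ?B = "A \<inter> cell n"
    show B: "?B \<in> sets (point_law n)" using A cell_sets by auto
    have "AE p in m. indicat_real (cell n) p *\<^sub>R (indicat_real ?B p - 1) = 0"
      using A(2) by eventually_elim (auto simp: indicator_def)
    moreover have Bm: "indicat_real ?B \<in> borel_measurable m" using B by simp
    moreover have "(\<lambda>p. indicat_real (cell n) p *\<^sub>R (indicat_real ?B p - 1)) \<in> borel_measurable m"
      using Bm cell_sets[of n] by simp
    ultimately have "integrable m (\<lambda>p. indicat_real (cell n) p *\<^sub>R (indicat_real ?B p - 1))"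
      and "(\<integral>p. indicat_real (cell n) p *\<^sub>R (indicat_real ?B p - 1) \<partial>m) = 0"
      by (auto intro!: integral_eq_zero_AE simp: integrable_cong_AE[where g = "\<lambda>_. 0"])
    then have "rate n * ((\<integral>p. indicat_real ?B p \<partial>point_law n) - 1) = 0"
      using integral_point_law[OF Bm] by simp
    then show "rate n * (1 - measure (point_law n) ?B) = 0"
      using B by (simp add: algebra_simps)
  qed
  then have "\<forall>n. AE \<omega> in cluster_space. \<forall>i<fst (\<omega> n). snd (\<omega> n) i \<in> A \<inter> cell n"
    by (intro allI AE_cluster_space[where P = "\<lambda>n z. \<forall>i<fst z. snd z i \<in> A \<inter> cell n"])
  then show ?thesis by (rule AE_all_countable[THEN iffD2])
qed

definition locations_injective :: "(nat \<Rightarrow> nat \<times> (nat \<Rightarrow> 'a \<times> real)) \<Rightarrow> bool" where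
  "locations_injective \<omega> \<longleftrightarrow> (\<forall>n. inj_on (\<lambda>i. fst (snd (\<omega> n) i)) {..<fst (\<omega> n)})"

text \<open>Since \<open>m\<close> does not charge any fibre \<open>{x} \<times> {0<..}\<close>, two sample points almost surely have different
locations.\<close>

lemma AE_locations_injective: "AE \<omega> in cluster_space. locations_injective \<omega>"
proof -
  have "AE z in poisson_cluster (rate n) (point_law n). inj_on (\<lambda>i. fst (snd z i)) {..<fst z}" for n
  proof (rule AE_poisson_cluster_distinct[OF rate_nonneg prob_space_point_law])
    show "fst \<in> borel_measurable (point_law n)"
      using fst_measurable by (simp cong: measurable_cong_sets)
    fix y :: 'a
    let ?B = "{q \<in> space (point_law n). fst q = y}"
    have B: "?B = {y} \<times> {0<..}" by (auto simp: space_m)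
    have Bm: "?B \<in> sets m" unfolding B by (rule strip_sets) simp
    have "emeasure (point_law n) ?B = 0" if "rate n \<noteq> 0"
    proof -
      have "AE p in m. p \<notin> ?B" using Bm null_fibre[of y] unfolding B by (intro AE_not_in) (simp add: null_setsI)
      then have "(\<integral>\<^sup>+p. ennreal (indicat_real (cell n) p / rate n) * indicator ?B p \<partial>m) = 0"
        by (subst nn_integral_0_iff_AE) (use Bm cell_sets[of n] in \<open>auto elim!: eventually_mono simp: indicator_def\<close>)
      then show ?thesis
        using that Bm cell_sets[of n] by (simp add: point_law_def emeasure_density)
    qed
    then show "rate n * measure (point_law n) ?B = 0" by (cases "rate n = 0") (simp_all add: measure_def)
  qed
  then have "\<forall>n. AE \<omega> in cluster_space. inj_on (\<lambda>i. fst (snd (\<omega> n) i)) {..<fst (\<omega> n)}"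
    by (intro allI AE_cluster_space[where P = "\<lambda>n z. inj_on (\<lambda>i. fst (snd z i)) {..<fst z}"])
  then show ?thesis unfolding locations_injective_def by (rule AE_all_countable[THEN iffD2])
qed

text \<open>Points whose location is outside their annulus, a null event, are discarded. The resulting measure
is then locally finite for every \<open>\<omega>\<close> and takes values in the discrete Radon measures
everywhere.\<close>

definition point_index :: "(nat \<Rightarrow> nat \<times> (nat \<Rightarrow> 'a \<times> real)) \<Rightarrow> (nat \<times> nat) set" where
  "point_index \<omega> = {(n, i). i < fst (\<omega> n) \<and> fst (snd (\<omega> n) i) \<in> annulus n}"

definition random_measure :: "(nat \<Rightarrow> nat \<times> (nat \<Rightarrow> 'a \<times> real)) \<Rightarrow> 'a measure" where
  "random_measure \<omega> = distr (density (count_space (point_index \<omega>)) (\<lambda>(n, i). ennreal (snd (snd (\<omega> n) i))))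
     borel (\<lambda>(n, i). fst (snd (\<omega> n) i))"

lemma sets_random_measure [simp]: "sets (random_measure \<omega>) = sets borel"
  by (simp add: random_measure_def)

lemma nn_integral_random_measure:
  assumes "h \<in> borel_measurable borel"
  shows "(\<integral>\<^sup>+x. h x \<partial>random_measure \<omega>) =
    (\<integral>\<^sup>+(n, i). ennreal (snd (snd (\<omega> n) i)) * h (fst (snd (\<omega> n) i)) \<partial>count_space (point_index \<omega>))"
  using assms unfolding random_measure_def
  by (simp add: nn_integral_distr nn_integral_density split_beta')

definition points_below :: "nat \<Rightarrow> (nat \<Rightarrow> nat \<times> (nat \<Rightarrow> 'a \<times> real)) \<Rightarrow> (nat \<times> nat) set" where
  "points_below k \<omega> = (SIGMA n:{..<k}. {..<fst (\<omega> n)})"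

lemma finite_points_below: "finite (points_below k \<omega>)"
  by (simp add: points_below_def)

lemma point_index_ball:
  "(n, i) \<in> point_index \<omega> \<Longrightarrow> norm (fst (snd (\<omega> n) i)) < real k \<longleftrightarrow> (n, i) \<in> points_below k \<omega>"
  by (auto simp: point_index_def points_below_def annulus_ball)

lemma random_measure_discrete:
  assumes \<omega>: "\<omega> \<in> space cluster_space"
  shows "random_measure \<omega> \<in> discrete_radon_measures"
proof -
  let ?x = "\<lambda>(n, i). fst (snd (\<omega> n) i)" and ?s = "\<lambda>(n, i). ennreal (snd (snd (\<omega> n) i))"
  have em: "emeasure (random_measure \<omega>) A = (\<integral>\<^sup>+j. ?s j * indicator A (?x j) \<partial>count_space (point_index \<omega>))"
    if "A \<in> sets borel" for A
    using nn_integral_random_measure[of "indicator A" \<omega>] that by (simp add: split_beta')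
  have ball: "emeasure (random_measure \<omega>) (ball 0 (real k)) < \<infinity>" for k
  proof -
    have "emeasure (random_measure \<omega>) (ball 0 (real k)) =
        (\<Sum>j\<in>points_below k \<omega> \<inter> point_index \<omega>. ?s j * indicator (ball 0 (real k)) (?x j))"
      unfolding em[OF borel_open[OF open_ball]]
      by (rule nn_integral_count_space')
         (use finite_points_below[of k \<omega>] point_index_ball[of _ _ \<omega> k] in \<open>auto simp: indicator_def\<close>)
    also have "\<dots> < \<infinity>"
      using finite_points_below[of k \<omega>]
      by (auto simp: less_top[symmetric] ennreal_mult_eq_top_iff indicator_def)
    finally show ?thesis .
  qed
  have radon: "random_measure \<omega> \<in> radon_measures"
    unfolding radon_measures_def
  proof (intro CollectI conjI allI impI)
    fix C :: "'a set" assume "compact C"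
    then obtain r where r: "\<forall>x\<in>C. norm x < r"
      using compact_imp_bounded bounded_pos_less by metis
    obtain k :: nat where "r \<le> real k" using real_arch_simple by blast
    then have "C \<subseteq> ball 0 (real k)" using r by force
    then have "emeasure (random_measure \<omega>) C \<le> emeasure (random_measure \<omega>) (ball 0 (real k))"
      by (intro emeasure_mono) auto
    with ball[of k] show "emeasure (random_measure \<omega>) C < \<infinity>" by simp
  qed simp
  define S where "S = ?x ` point_index \<omega>"
  have "countable (point_index \<omega>)" by (rule countableI_type)
  then have S: "countable S" unfolding S_def by (rule countable_image)
  have single: "emeasure (random_measure \<omega>) {y} < \<infinity>" for y
    by (rule radon_measure_bounded_finite[OF radon]) simp
  have single': "emeasure (random_measure \<omega>) {y} = ennreal (measure (random_measure \<omega>) {y})" for y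
    using single[of y] by (simp add: emeasure_eq_ennreal_measure less_top)
  have pos: "0 < measure (random_measure \<omega>) {y}" if y: "y \<in> S" for y
  proof -
    obtain n i where j: "(n, i) \<in> point_index \<omega>" "y = fst (snd (\<omega> n) i)" using y by (auto simp: S_def)
    have "0 < ?s (n, i)" using cluster_point_space[OF \<omega>, of n i] by (auto simp: mem_Times_iff)
    also have "?s (n, i) = (\<integral>\<^sup>+j. ?s j * indicator {(n, i)} j \<partial>count_space (point_index \<omega>))"
      using j by (subst nn_integral_count_space'[where A = "{(n, i)}"]) auto
    also have "\<dots> \<le> emeasure (random_measure \<omega>) {y}"
      unfolding em[OF borel_singleton[OF sets.empty_sets]]
      using j by (intro nn_integral_mono) (auto simp: indicator_def)
    finally show ?thesis using single[of y] by (simp add: measure_def enn2real_positive_iff)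
  qed
  have "emeasure (random_measure \<omega>) A =
      (\<integral>\<^sup>+x. ennreal (measure (random_measure \<omega>) {x}) * emeasure (return borel x) A \<partial>count_space S)"
    if A: "A \<in> sets borel" for A
  proof -
    have "emeasure (random_measure \<omega>) A = emeasure (random_measure \<omega>) (A \<inter> S)"
    proof -
      have "A \<inter> S \<in> sets borel" by (rule sets.Int[OF A sets.countable[OF _ S]]) simp
      then show ?thesis
        unfolding em[OF A] by (subst em) (auto intro!: nn_integral_cong simp: indicator_def S_def)
    qed
    also have "\<dots> = (\<integral>\<^sup>+x. emeasure (random_measure \<omega>) {x} \<partial>count_space (A \<inter> S))"
      using S by (intro emeasure_countable_singleton) auto
    also have "\<dots> = (\<integral>\<^sup>+x. emeasure (random_measure \<omega>) {x} * indicator (A \<inter> S) x \<partial>count_space UNIV)"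
      by (simp add: nn_integral_count_space_indicator)
    also have "\<dots> = (\<integral>\<^sup>+x. ennreal (measure (random_measure \<omega>) {x}) * emeasure (return borel x) A * indicator S x \<partial>count_space UNIV)"
      using A single' by (intro nn_integral_cong) (auto simp: indicator_def)
    also have "\<dots> = (\<integral>\<^sup>+x. ennreal (measure (random_measure \<omega>) {x}) * emeasure (return borel x) A \<partial>count_space S)"
      by (simp add: nn_integral_count_space_indicator)
    finally show ?thesis .
  qed
  with radon S pos show ?thesis
    unfolding discrete_radon_measures_def
    by (intro CollectI conjI exI[of _ S] exI[of _ "\<lambda>x. measure (random_measure \<omega>) {x}"]) auto
qed

text \<open>Only the points in the first \<open>k\<close> annuli can meet the support of \<open>f\<close>, so the integral is a finite sum
with random but finite index sets; this is what makes it measurable in \<open>\<omega>\<close>.\<close>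

lemma integral_random_measure:
  assumes \<omega>: "\<omega> \<in> space cluster_space" and f: "f \<in> test_functions" "\<And>x. f x \<noteq> 0 \<Longrightarrow> norm x < real k"
  shows "(\<integral>x. f x \<partial>random_measure \<omega>) =
    (\<Sum>n<k. \<Sum>i<fst (\<omega> n). case snd (\<omega> n) i of (x, s) \<Rightarrow> if x \<in> annulus n then s * f x else 0)"
proof -
  let ?x = "\<lambda>(n, i). fst (snd (\<omega> n) i)" and ?s = "\<lambda>(n, i). snd (snd (\<omega> n) i)"
  have s: "0 < ?s j" for j using cluster_point_space[OF \<omega>] by (auto simp: split_beta mem_Times_iff)
  let ?h = "\<lambda>j. ?s j * f (?x j)"
  have "random_measure \<omega> = distr (density (count_space (point_index \<omega>)) (\<lambda>j. ennreal (?s j))) borel ?x"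
    unfolding random_measure_def by (simp add: split_beta')
  then have "(\<integral>x. f x \<partial>random_measure \<omega>) = (\<integral>j. f (?x j) \<partial>density (count_space (point_index \<omega>)) (\<lambda>j. ennreal (?s j)))"
    using test_function_measurable[OF f(1)] by (simp add: integral_distr)
  also have "\<dots> = (\<integral>j. ?h j \<partial>count_space (point_index \<omega>))"
    using s by (subst integral_density) (auto intro!: AE_I2 intro: less_imp_le)
  also have "\<dots> = (\<Sum>j | j \<in> point_index \<omega> \<and> ?h j \<noteq> 0. ?h j)"
  proof (rule lebesgue_integral_count_space_finite_support)
    show "finite {j \<in> point_index \<omega>. ?h j \<noteq> 0}"
      by (rule finite_subset[OF _ finite_points_below[of k \<omega>]])
         (use f(2) point_index_ball[of _ _ \<omega> k] in auto)
  qed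
  also have "\<dots> = (\<Sum>j\<in>points_below k \<omega>. if j \<in> point_index \<omega> then ?h j else 0)"
    by (intro sum.mono_neutral_cong_left finite_points_below)
       (use f(2) point_index_ball[of _ _ \<omega> k] in auto)
  also have "\<dots> = (\<Sum>n<k. \<Sum>i<fst (\<omega> n). if (n, i) \<in> point_index \<omega> then ?h (n, i) else 0)"
    unfolding points_below_def by (subst sum.Sigma) (auto intro!: sum.cong)
  also have "\<dots> = (\<Sum>n<k. \<Sum>i<fst (\<omega> n). case snd (\<omega> n) i of (x, s) \<Rightarrow> if x \<in> annulus n then s * f x else 0)"
    by (intro sum.cong) (auto simp: point_index_def split_beta)
  finally show ?thesis .
qed

lemma measurable_random_measure: "random_measure \<in> measurable cluster_space discrete_radon_space"
proof (rule measurable_discrete_radon_spaceI[OF random_measure_discrete])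
  fix l :: nat
  let ?f = "test_seq l :: 'a \<Rightarrow> real"
  obtain k :: nat where k: "\<And>x. ?f x \<noteq> 0 \<Longrightarrow> norm x < real k"
    using test_function_support[OF test_seq] by blast
  define H where "H n p = (case p of (x, s) \<Rightarrow> if x \<in> annulus n then s * ?f x else 0)" for n p
  have H: "H n \<in> borel_measurable m" for n
  proof -
    have "(\<lambda>p. if p \<in> cell n then snd p * ?f (fst p) else 0) \<in> borel_measurable m"
      using cell_sets[of n]
      by (intro measurable_If_set borel_measurable_times snd_measurable
            measurable_compose[OF fst_measurable test_function_measurable[OF test_seq]]) auto
    then show ?thesis
      by (rule measurable_cong[THEN iffD1, rotated]) (auto simp: H_def cell_def space_m split: if_splits)
  qed
  have "(\<lambda>\<omega>. \<Sum>n<k. \<Sum>i<fst (\<omega> n). H n (snd (\<omega> n) i)) \<in> borel_measurable cluster_space"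
    by (intro borel_measurable_sum measurable_cluster_component[where g = "\<lambda>z. \<Sum>i<fst z. H _ (snd z i)"])
       (simp, intro borel_measurable_sum measurable_compose[OF measurable_component_singleton[where M = "\<lambda>_. m"] H], simp)
  then show "(\<lambda>\<omega>. \<integral>x. ?f x \<partial>random_measure \<omega>) \<in> borel_measurable cluster_space"
    by (rule measurable_cong[THEN iffD1, rotated])
       (simp add: integral_random_measure[OF _ test_seq k] H_def)
qed

definition law :: "'a measure measure" where
  "law = distr cluster_space discrete_radon_space random_measure"

lemma sets_law [simp]: "sets law = sets discrete_radon_space"
  by (simp add: law_def)

lemma prob_space_law: "prob_space law"
  unfolding law_def
  by (rule prob_space.prob_space_distr[OF prob_space_cluster_space measurable_random_measure])

text \<open>The clusters are independent, and each contributes the exponential of the integral of \<open>F - 1\<close> over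
its cell. The support condition makes the product over all points a finite one.\<close>

lemma
  fixes F :: "'a \<times> real \<Rightarrow> 'b::{real_normed_field, banach, second_countable_topology}"
  assumes F: "F \<in> borel_measurable m" and int: "integrable m (\<lambda>p. F p - 1)"
    and supp: "\<And>p. F p \<noteq> 1 \<Longrightarrow> norm (fst p) < real k"
  shows integrable_point_prod: "integrable cluster_space (\<lambda>\<omega>. \<Prod>n<k. \<Prod>i<fst (\<omega> n). F (snd (\<omega> n) i))"
    and integral_point_prod: "(\<integral>\<omega>. (\<Prod>n<k. \<Prod>i<fst (\<omega> n). F (snd (\<omega> n) i)) \<partial>cluster_space) =
      exp (\<integral>p. F p - 1 \<partial>m)"
proof -
  let ?G = "\<lambda>z. \<Prod>i<fst z. F (snd z i)"
  have ic: "integrable m (\<lambda>p. indicat_real (cell n) p *\<^sub>R (F p - 1))" for n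
    using integrable_mult_indicator[OF cell_sets int] .
  have iG: "integrable (poisson_cluster (rate n) (point_law n)) ?G" for n
    using integrable_poisson_cluster[OF rate_nonneg prob_space_point_law integrable_point_law[OF F ic]]
    by (simp add: split_beta')
  have G: "(\<integral>z. ?G z \<partial>poisson_cluster (rate n) (point_law n)) =
      exp (\<integral>p. indicat_real (cell n) p *\<^sub>R (F p - 1) \<partial>m)" for n
    using integral_poisson_cluster[OF rate_nonneg prob_space_point_law integrable_point_law[OF F ic]]
    by (simp add: split_beta' integral_point_law[OF F ic])
  show "integrable cluster_space (\<lambda>\<omega>. \<Prod>n<k. ?G (\<omega> n))"
    unfolding cluster_space_def by (rule integrable_PiM_prod) (use prob_space_cluster iG in auto)
  have "(\<integral>\<omega>. (\<Prod>n<k. ?G (\<omega> n)) \<partial>cluster_space) = (\<Prod>n<k. \<integral>z. ?G z \<partial>poisson_cluster (rate n) (point_law n))"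
    unfolding cluster_space_def by (rule integral_PiM_prod) (use prob_space_cluster iG in auto)
  also have "\<dots> = exp (\<Sum>n<k. \<integral>p. indicat_real (cell n) p *\<^sub>R (F p - 1) \<partial>m)"
    by (simp add: G exp_sum)
  also have "(\<Sum>n<k. \<integral>p. indicat_real (cell n) p *\<^sub>R (F p - 1) \<partial>m) =
      (\<integral>p. (\<Sum>n<k. indicat_real (cell n) p *\<^sub>R (F p - 1)) \<partial>m)"
    using ic by (intro Bochner_Integration.integral_sum[symmetric])
  also have "\<dots> = (\<integral>p. F p - 1 \<partial>m)"
  proof (intro Bochner_Integration.integral_cong refl)
    fix p assume p: "p \<in> space m"
    let ?l = "nat \<lfloor>norm (fst p)\<rfloor>"
    have "p \<in> cell n \<longleftrightarrow> n = ?l" for n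
      using p by (auto simp: cell_def annulus_floor space_m)
    then have "(\<Sum>n<k. indicat_real (cell n) p *\<^sub>R (F p - 1)) = (\<Sum>n<k. if n = ?l then F p - 1 else 0)"
      by (intro sum.cong) (auto simp: indicator_def)
    also have "\<dots> = (if ?l < k then F p - 1 else 0)" by simp
    also have "\<dots> = F p - 1"
      using supp[of p] annulus_ball[of "fst p" ?l k] by (auto simp: annulus_floor)
    finally show "(\<Sum>n<k. indicat_real (cell n) p *\<^sub>R (F p - 1)) = F p - 1" .
  qed
  finally show "(\<integral>\<omega>. (\<Prod>n<k. ?G (\<omega> n)) \<partial>cluster_space) = exp (\<integral>p. F p - 1 \<partial>m)" .
qed

text \<open>If the points lie in their cells and have distinct locations, no two of them are merged into one
atom, so the atoms carry exactly the locations and marks of the points.\<close>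

lemma atom_sum_random_measure:
  assumes \<omega>: "\<omega> \<in> space cluster_space" and inj: "locations_injective \<omega>"
    and cells: "\<And>n i. i < fst (\<omega> n) \<Longrightarrow> snd (\<omega> n) i \<in> cell n"
  shows "atom_sum k F (random_measure \<omega>) = (\<Sum>(n, i)\<in>points_below k \<omega>. F (snd (\<omega> n) i))"
proof -
  let ?x = "\<lambda>(n, i). fst (snd (\<omega> n) i)" and ?s = "\<lambda>(n, i). snd (snd (\<omega> n) i)"
  have s: "0 < ?s j" for j using cluster_point_space[OF \<omega>] by (auto simp: split_beta mem_Times_iff)
  have J: "point_index \<omega> = {(n, i). i < fst (\<omega> n)}"
    using cells by (auto simp: point_index_def cell_def mem_Times_iff)
  have inj_x: "inj_on ?x (point_index \<omega>)"
  proof (rule inj_onI, clarify)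
    fix n i n' i' assume a: "(n, i) \<in> point_index \<omega>" "(n', i') \<in> point_index \<omega>"
      and eq: "fst (snd (\<omega> n) i) = fst (snd (\<omega> n') i')"
    then have "n = n'" by (auto simp: point_index_def annulus_floor)
    then show "n = n' \<and> i = i'"
      using a eq inj by (auto simp: locations_injective_def J dest: inj_onD)
  qed
  have em: "emeasure (random_measure \<omega>) {y} =
      (\<integral>\<^sup>+j. ennreal (?s j) * indicator {y} (?x j) \<partial>count_space (point_index \<omega>))" for y
    using nn_integral_random_measure[of "indicator {y}" \<omega>] by (simp add: split_beta')
  have meas: "measure (random_measure \<omega>) {?x j} = ?s j" if j: "j \<in> point_index \<omega>" for j
  proof -
    have "i = j" if "i \<in> point_index \<omega>" "?x i = ?x j" for i
      using inj_x that j by (blast dest: inj_onD)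
    then have "emeasure (random_measure \<omega>) {?x j} = ennreal (?s j)"
      unfolding em using j
      by (subst nn_integral_count_space'[where A = "{j}"]) (auto simp: indicator_def)
    then show ?thesis using s[of j] by (simp add: measure_def)
  qed
  have at1: "y \<in> ?x ` point_index \<omega>" if "0 < measure (random_measure \<omega>) {y}" for y
  proof (rule ccontr)
    assume "y \<notin> ?x ` point_index \<omega>"
    then have "emeasure (random_measure \<omega>) {y} = (\<integral>\<^sup>+j. 0 \<partial>count_space (point_index \<omega>))"
      unfolding em by (intro nn_integral_cong) (auto simp: indicator_def)
    with that show False by (simp add: measure_def)
  qed
  have at2: "0 < measure (random_measure \<omega>) {?x j}" if "j \<in> point_index \<omega>" for j
    using meas[OF that] s[of j] by simp
  have atoms: "atoms (random_measure \<omega>) = ?x ` point_index \<omega>"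
  proof (intro equalityI subsetI)
    fix y assume "y \<in> atoms (random_measure \<omega>)"
    then show "y \<in> ?x ` point_index \<omega>" by (intro at1) (simp add: atoms_def)
  next
    fix y assume "y \<in> ?x ` point_index \<omega>"
    then obtain j where "j \<in> point_index \<omega>" "y = ?x j" by (rule imageE)
    then show "y \<in> atoms (random_measure \<omega>)" using at2[of j] unfolding atoms_def by simp
  qed
  have below: "points_below k \<omega> \<subseteq> point_index \<omega>" by (auto simp: J points_below_def)
  have "atoms (random_measure \<omega>) \<inter> ball 0 (real k) = ?x ` points_below k \<omega>"
    unfolding atoms using point_index_ball[of _ _ \<omega> k] below by (auto simp: image_iff)
  then have "atom_sum k F (random_measure \<omega>) =
      (\<integral>\<^sup>+x. F (x, measure (random_measure \<omega>) {x}) \<partial>count_space (?x ` points_below k \<omega>))"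
    by (simp add: atom_sum_def)
  also have "\<dots> = (\<Sum>x\<in>?x ` points_below k \<omega>. F (x, measure (random_measure \<omega>) {x}))"
    using finite_points_below by (intro nn_integral_count_space_finite) auto
  also have "\<dots> = (\<Sum>j\<in>points_below k \<omega>. F (?x j, measure (random_measure \<omega>) {?x j}))"
    using inj_on_subset[OF inj_x below] by (simp add: sum.reindex)
  also have "\<dots> = (\<Sum>(n, i)\<in>points_below k \<omega>. F (snd (\<omega> n) i))"
    using meas below by (intro sum.cong) (auto simp: subset_iff)
  finally show "atom_sum k F (random_measure \<omega>) = (\<Sum>(n, i)\<in>points_below k \<omega>. F (snd (\<omega> n) i))" .
qed

end

section \<open>Weights and the Fourier transform\<close>

text \<open>The product of a positive function over the atoms in a ball. Passing to logarithms expresses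
  it through sums over atoms, which are measurable.\<close>

definition atom_weight :: "nat \<Rightarrow> ('a::euclidean_space \<times> real \<Rightarrow> real) \<Rightarrow> 'a measure \<Rightarrow> real" where
  "atom_weight k r \<eta> = exp (enn2real (atom_sum k (\<lambda>p. ennreal (ln (r p))) \<eta>) -
     enn2real (atom_sum k (\<lambda>p. ennreal (- ln (r p))) \<eta>))"

lemma measurable_atom_weight:
  assumes [measurable]: "r \<in> borel_measurable borel"
  shows "atom_weight k r \<in> borel_measurable discrete_radon_space"
proof -
  have [measurable]: "atom_sum k (\<lambda>p. ennreal (ln (r p))) \<in> borel_measurable discrete_radon_space"
    "atom_sum k (\<lambda>p. ennreal (- ln (r p))) \<in> borel_measurable discrete_radon_space"
    by (intro measurable_atom_sum; measurable)+
  show ?thesis unfolding atom_weight_def[abs_def] by measurable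
qed

lemma exp_ln_sums:
  assumes "finite A" "\<And>a. a \<in> A \<Longrightarrow> 0 < (r a :: real)"
  shows "exp (enn2real (\<Sum>a\<in>A. ennreal (ln (r a))) - enn2real (\<Sum>a\<in>A. ennreal (- ln (r a)))) = (\<Prod>a\<in>A. r a)"
proof -
  have *: "enn2real (\<Sum>a\<in>A. ennreal (g a)) = (\<Sum>a\<in>A. max 0 (g a))" for g :: "_ \<Rightarrow> real"
  proof -
    have "(\<Sum>a\<in>A. ennreal (g a)) = (\<Sum>a\<in>A. ennreal (max 0 (g a)))"
      by (intro sum.cong) (auto simp: max_def ennreal_neg)
    also have "\<dots> = ennreal (\<Sum>a\<in>A. max 0 (g a))" by (intro sum_ennreal) simp
    finally show ?thesis by (simp only: enn2real_ennreal sum_nonneg max.cobounded1)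
  qed
  have "(\<Sum>a\<in>A. max 0 (ln (r a))) - (\<Sum>a\<in>A. max 0 (- ln (r a))) = (\<Sum>a\<in>A. ln (r a))"
    by (simp add: sum_subtractf[symmetric]) (intro sum.cong, auto simp: max_def)
  then show ?thesis
    using assms by (simp add: * exp_sum)
qed

lemma atom_weight_eq_prod:
  assumes "finite (atoms \<eta> \<inter> ball 0 (real k))" "\<And>p. 0 < r p"
  shows "atom_weight k r \<eta> = (\<Prod>x\<in>atoms \<eta> \<inter> ball 0 (real k). r (x, measure \<eta> {x}))"
  unfolding atom_weight_def atom_sum_def using assms
  by (simp add: nn_integral_count_space_finite exp_ln_sums)

context marked_measure
begin

lemma prod_points_below:
  "(\<Prod>n<k. \<Prod>i<fst (\<omega> n). F (snd (\<omega> n) i)) = (\<Prod>(n, i)\<in>points_below k \<omega>. F (snd (\<omega> n) i))"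
  unfolding points_below_def by (subst prod.Sigma) auto

lemma atom_weight_random_measure:
  assumes \<omega>: "\<omega> \<in> space cluster_space" and inj: "locations_injective \<omega>"
    and cells: "\<And>n i. i < fst (\<omega> n) \<Longrightarrow> snd (\<omega> n) i \<in> cell n"
    and r: "\<And>p. 0 < r p" "\<And>p. r p \<noteq> 1 \<Longrightarrow> norm (fst p) < real k" and kl: "k \<le> l"
  shows "atom_weight k r (random_measure \<omega>) = (\<Prod>n<l. \<Prod>i<fst (\<omega> n). r (snd (\<omega> n) i))"
proof -
  have sums: "atom_sum k F (random_measure \<omega>) = (\<Sum>(n, i)\<in>points_below k \<omega>. F (snd (\<omega> n) i))" for F
    by (rule atom_sum_random_measure[OF \<omega> inj cells])
  have "atom_weight k r (random_measure \<omega>) = (\<Prod>(n, i)\<in>points_below k \<omega>. r (snd (\<omega> n) i))"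
    unfolding atom_weight_def sums
    using exp_ln_sums[OF finite_points_below[of k \<omega>], of "\<lambda>(n, i). r (snd (\<omega> n) i)"] r(1)
    by (simp add: split_beta')
  also have "\<dots> = (\<Prod>n<k. \<Prod>i<fst (\<omega> n). r (snd (\<omega> n) i))"
    by (rule prod_points_below[symmetric])
  also have "\<dots> = (\<Prod>n<l. \<Prod>i<fst (\<omega> n). r (snd (\<omega> n) i))"
  proof (rule prod.mono_neutral_left)
    show "\<forall>n\<in>{..<l} - {..<k}. (\<Prod>i<fst (\<omega> n). r (snd (\<omega> n) i)) = 1"
    proof
      fix n assume n: "n \<in> {..<l} - {..<k}"
      have "r (snd (\<omega> n) i) = 1" if "i < fst (\<omega> n)" for i
      proof (rule ccontr)
        assume "r (snd (\<omega> n) i) \<noteq> 1"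
        then have "norm (fst (snd (\<omega> n) i)) < real k" by (rule r(2))
        moreover have "fst (snd (\<omega> n) i) \<in> annulus n" using cells[OF that] by (auto simp: cell_def)
        ultimately show False using n annulus_ball by auto
      qed
      then show "(\<Prod>i<fst (\<omega> n). r (snd (\<omega> n) i)) = 1" by (intro prod.neutral) auto
    qed
  qed (use kl in auto)
  finally show ?thesis .
qed

text \<open>Almost sure statements about the law are checked on the underlying clusters. Only for a measurable
set does a null preimage imply that the set itself is null.\<close>

lemma AE_law:
  assumes "AE \<omega> in cluster_space. P (random_measure \<omega>)"
    and "{\<eta> \<in> space discrete_radon_space. P \<eta>} \<in> sets discrete_radon_space"
  shows "AE \<eta> in law. P \<eta>"
  unfolding law_def using assms by (subst AE_distr_iff[OF measurable_random_measure]) auto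

lemma AE_good:
  "AE \<omega> in cluster_space. \<omega> \<in> space cluster_space \<and> locations_injective \<omega> \<and>
     (\<forall>n. \<forall>i<fst (\<omega> n). snd (\<omega> n) i \<in> cell n)"
proof -
  have "AE \<omega> in cluster_space. \<forall>n. \<forall>i<fst (\<omega> n). snd (\<omega> n) i \<in> space m \<inter> cell n"
    by (rule AE_cluster_points) auto
  with AE_space AE_locations_injective show ?thesis by eventually_elim auto
qed

lemma integrable_iexp_strip:
  assumes f: "f \<in> test_functions"
  shows "integrable m (\<lambda>p. iexp (snd p * f (fst p)) - 1)"
proof -
  obtain k :: nat where k: "\<And>x. f x \<noteq> 0 \<Longrightarrow> norm x < real k"
    using test_function_support[OF f] by blast
  have "(\<lambda>p. snd p * f (fst p)) \<in> borel_measurable m"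
    by (intro borel_measurable_times snd_measurable measurable_compose[OF fst_measurable test_function_measurable[OF f]])
  then have me: "(\<lambda>p. iexp (snd p * f (fst p)) - 1) \<in> borel_measurable m" by measurable
  show ?thesis
  proof (rule integrableI_bounded_set[where A = "ball 0 (real k) \<times> {0<..}" and B = 2])
    show "ball 0 (real k) \<times> {0<..} \<in> sets m" by (rule strip_sets) simp
    show "emeasure m (ball 0 (real k) \<times> {0<..}) < \<infinity>" by (rule bounded_strip_finite) auto
    show "AE p\<in>ball 0 (real k) \<times> {0<..} in m. norm (iexp (snd p * f (fst p)) - 1) \<le> 2"
      by (intro AE_I2 impI) (rule order_trans[OF norm_triangle_ineq4], simp)
    show "AE p in m. p \<notin> ball 0 (real k) \<times> {0<..} \<longrightarrow> iexp (snd p * f (fst p)) - 1 = 0"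
    proof (intro AE_I2 impI)
      fix p assume "p \<in> space m" "p \<notin> ball 0 (real k) \<times> {0<..}"
      then have "f (fst p) = 0" using k[of "fst p"] by (auto simp: space_m mem_Times_iff)
      then show "iexp (snd p * f (fst p)) - 1 = 0" by simp
    qed
  qed (rule me)
qed

text \<open>For almost all \<open>\<omega>\<close> the integrand is the product over the points of \<open>F (x, s) = r (x, s) exp (\<i> s f x)\<close>,
to which the exponential formula applies. With \<open>r = 1\<close> this is the Fourier transform of the law;
with \<open>r = dm\<^sub>\<phi>/dm\<close> it will be that of the transported law.\<close>

lemma
  assumes r: "r \<in> borel_measurable borel" "\<And>p. 0 < r p" "\<And>p. r p \<noteq> 1 \<Longrightarrow> norm (fst p) < real k"
    and int: "integrable m (\<lambda>p. r p - 1)" and f: "f \<in> test_functions"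
  shows integrable_weight_iexp: "integrable law (\<lambda>\<eta>. atom_weight k r \<eta> *\<^sub>R iexp (\<integral>x. f x \<partial>\<eta>))"
    and integrable_weighted_strip: "integrable m (\<lambda>p. r p *\<^sub>R iexp (snd p * f (fst p)) - 1)"
    and integral_weight_iexp: "(\<integral>\<eta>. atom_weight k r \<eta> *\<^sub>R iexp (\<integral>x. f x \<partial>\<eta>) \<partial>law) =
      exp (\<integral>p. r p *\<^sub>R iexp (snd p * f (fst p)) - 1 \<partial>m)"
proof -
  let ?e = "\<lambda>p. iexp (snd p * f (fst p))" and ?F = "\<lambda>p. r p *\<^sub>R iexp (snd p * f (fst p))"
  obtain k' :: nat where k': "\<And>x. f x \<noteq> 0 \<Longrightarrow> norm x < real k'"
    using test_function_support[OF f] by blast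
  define l where "l = max k k'"
  have fl: "f x \<noteq> 0 \<Longrightarrow> norm x < real l" for x using k'[of x] by (auto simp: l_def)
  have "(\<lambda>p. snd p * f (fst p)) \<in> borel_measurable m"
    by (intro borel_measurable_times snd_measurable measurable_compose[OF fst_measurable test_function_measurable[OF f]])
  then have e: "?e \<in> borel_measurable m" by measurable
  have rm: "r \<in> borel_measurable m" by (rule borel_measurable_m[OF r(1)])
  have "integrable m (\<lambda>p. (r p - 1) *\<^sub>R ?e p)"
    by (rule Bochner_Integration.integrable_bound[OF int]) (use rm e in \<open>auto intro!: borel_measurable_scaleR\<close>)
  then have "integrable m (\<lambda>p. (r p - 1) *\<^sub>R ?e p + (?e p - 1))"
    using integrable_iexp_strip[OF f] by (rule Bochner_Integration.integrable_add)
  then show intF: "integrable m (\<lambda>p. ?F p - 1)" by (simp add: algebra_simps)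
  have Fm: "?F \<in> borel_measurable m" using rm e by (rule borel_measurable_scaleR)
  have suppF: "norm (fst p) < real l" if "?F p \<noteq> 1" for p
  proof (cases "r p = 1")
    case True
    then have "f (fst p) \<noteq> 0" using that by auto
    then show ?thesis by (rule fl)
  next
    case False
    then show ?thesis using r(3)[of p] by (simp add: l_def)
  qed
  let ?P = "\<lambda>\<omega>. \<Prod>n<l. \<Prod>i<fst (\<omega> n). ?F (snd (\<omega> n) i)"
  let ?W = "\<lambda>\<eta>. atom_weight k r \<eta> *\<^sub>R iexp (\<integral>x. f x \<partial>\<eta>)"
  have Wm: "?W \<in> borel_measurable discrete_radon_space"
    by (intro borel_measurable_scaleR measurable_atom_weight[OF r(1)]
        measurable_compose[OF measurable_integral_test_function[OF f], where g = "\<lambda>t. iexp t"]) simp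
  have eq: "AE \<omega> in cluster_space. ?W (random_measure \<omega>) = ?P \<omega>"
    using AE_good
  proof eventually_elim
    case (elim \<omega>)
    then have \<omega>: "\<omega> \<in> space cluster_space" "locations_injective \<omega>"
      "\<And>n i. i < fst (\<omega> n) \<Longrightarrow> snd (\<omega> n) i \<in> cell n" by auto
    have "(\<integral>x. f x \<partial>random_measure \<omega>) =
        (\<Sum>n<l. \<Sum>i<fst (\<omega> n). case snd (\<omega> n) i of (x, s) \<Rightarrow> if x \<in> annulus n then s * f x else 0)"
      by (rule integral_random_measure[OF \<omega>(1) f fl])
    also have "\<dots> = (\<Sum>n<l. \<Sum>i<fst (\<omega> n). snd (snd (\<omega> n) i) * f (fst (snd (\<omega> n) i)))"
    proof (intro sum.cong refl)
      fix n i assume "i \<in> {..<fst (\<omega> n)}"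
      then have "snd (\<omega> n) i \<in> cell n" using \<omega>(3) by simp
      then show "(case snd (\<omega> n) i of (x, s) \<Rightarrow> if x \<in> annulus n then s * f x else 0) =
          snd (snd (\<omega> n) i) * f (fst (snd (\<omega> n) i))"
        by (auto simp: cell_def split: prod.split)
    qed
    finally have "(\<integral>x. f x \<partial>random_measure \<omega>) =
        (\<Sum>n<l. \<Sum>i<fst (\<omega> n). snd (snd (\<omega> n) i) * f (fst (snd (\<omega> n) i)))" .
    then have "iexp (\<integral>x. f x \<partial>random_measure \<omega>) = (\<Prod>n<l. \<Prod>i<fst (\<omega> n). ?e (snd (\<omega> n) i))"
      by (simp add: sum_distrib_left exp_sum)
    moreover have "atom_weight k r (random_measure \<omega>) = (\<Prod>n<l. \<Prod>i<fst (\<omega> n). r (snd (\<omega> n) i))"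
      by (rule atom_weight_random_measure[OF \<omega> r(2,3)]) (auto simp: l_def)
    ultimately show ?case by (simp add: scaleR_conv_of_real prod.distrib)
  qed
  have WY: "(\<lambda>\<omega>. ?W (random_measure \<omega>)) \<in> borel_measurable cluster_space"
    using measurable_compose[OF measurable_random_measure Wm] .
  have Pi: "integrable cluster_space ?P" by (rule integrable_point_prod[OF Fm intF suppF])
  have "integrable cluster_space (\<lambda>\<omega>. ?W (random_measure \<omega>))"
    by (rule iffD2[OF integrable_cong_AE[OF WY borel_measurable_integrable[OF Pi] eq] Pi])
  then show "integrable law ?W"
    unfolding law_def by (subst integrable_distr_eq[OF measurable_random_measure Wm])
  have "(\<integral>\<eta>. ?W \<eta> \<partial>law) = (\<integral>\<omega>. ?W (random_measure \<omega>) \<partial>cluster_space)"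
    unfolding law_def by (rule integral_distr[OF measurable_random_measure Wm])
  also have "\<dots> = (\<integral>\<omega>. ?P \<omega> \<partial>cluster_space)"
    by (rule integral_cong_AE[OF WY borel_measurable_integrable[OF Pi] eq])
  also have "\<dots> = exp (\<integral>p. ?F p - 1 \<partial>m)" by (rule integral_point_prod[OF Fm intF suppF])
  finally show "(\<integral>\<eta>. ?W \<eta> \<partial>law) = exp (\<integral>p. ?F p - 1 \<partial>m)" .
qed

lemma fourier_law:
  assumes f: "f \<in> test_functions"
  shows "(\<integral>\<eta>. iexp (\<integral>x. f x \<partial>\<eta>) \<partial>law) = exp (\<integral>p. iexp (snd p * f (fst p)) - 1 \<partial>m)"
  using integral_weight_iexp[where k = 0 and r = "\<lambda>p. 1", OF _ _ _ _ f]
  by (simp add: atom_weight_def atom_sum_def)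

lemma law_of_levy_measure_eq: "law_of_levy_measure m = law"
  unfolding law_of_levy_measure_def
proof (rule the_equality)
  show "prob_space law \<and> sets law = sets discrete_radon_space \<and>
     (\<forall>f\<in>test_functions. (\<integral>\<eta>. iexp (\<integral>x. f x \<partial>\<eta>) \<partial>law) = exp (\<integral>(x, s). (iexp (s * f x) - 1) \<partial>m))"
    using prob_space_law fourier_law by (simp add: split_beta')
next
  fix \<mu> :: "'a measure measure"
  assume "prob_space \<mu> \<and> sets \<mu> = sets discrete_radon_space \<and>
     (\<forall>f\<in>test_functions. (\<integral>\<eta>. iexp (\<integral>x. f x \<partial>\<eta>) \<partial>\<mu>) = exp (\<integral>(x, s). (iexp (s * f x) - 1) \<partial>m))"
  then show "\<mu> = law"
    by (intro discrete_law_eqI prob_space_law sets_law) (auto simp: fourier_law split_beta')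
qed

lemma sigma_finite_m: "sigma_finite_measure m"
proof
  let ?A = "range (\<lambda>n. ball (0::'a) (real n) \<times> {0::real<..})"
  show "\<exists>A. countable A \<and> A \<subseteq> sets m \<and> \<Union> A = space m \<and> (\<forall>a\<in>A. emeasure m a \<noteq> \<infinity>)"
  proof (intro exI[of _ ?A] conjI ballI)
    show "?A \<subseteq> sets m" using strip_sets by auto
    show "\<Union> ?A = space m" using reals_Archimedean2 by (auto simp: space_m)
    show "emeasure m a \<noteq> \<infinity>" if a: "a \<in> ?A" for a
    proof -
      obtain n :: nat where "a = ball 0 (real n) \<times> {0<..}" using a by blast
      then show ?thesis using bounded_strip_finite[of "ball 0 (real n)"] by auto
    qed
  qed simp
qed

end

section \<open>The action of compactly supported diffeomorphisms\<close>

lemma Diff0_continuous: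
  assumes "\<phi> \<in> Diff0" shows "continuous_on UNIV \<phi>"
proof -
  have "n_times_cont_diff 0 \<phi>" using assms unfolding Diff0_def smooth_def by blast
  then show ?thesis by simp
qed

lemma Diff0_measurable:
  assumes "\<phi> \<in> Diff0" shows "\<phi> \<in> borel_measurable borel"
  by (intro borel_measurable_continuous_onI Diff0_continuous assms)

lemma Diff0_fixes_outside_ball:
  assumes "\<phi> \<in> Diff0"
  obtains k :: nat where "\<And>x. \<not> norm x < real k \<Longrightarrow> \<phi> x = x"
proof -
  obtain C where C: "compact C" "\<And>x. x \<notin> C \<Longrightarrow> \<phi> x = x" using assms by (auto simp: Diff0_def)
  obtain R where R: "\<And>x. x \<in> C \<Longrightarrow> norm x < R"
    using compact_imp_bounded[OF C(1)] unfolding bounded_pos_less by blast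
  obtain k :: nat where "R \<le> real k" using real_arch_simple by blast
  with R C(2) that show thesis by (meson order_less_le_trans)
qed

lemma Diff0_bij: "\<phi> \<in> Diff0 \<Longrightarrow> bij \<phi>"
  by (simp add: Diff0_def)

lemma Diff0_ball:
  assumes "\<phi> \<in> Diff0" and k: "\<And>x. \<not> norm x < real k \<Longrightarrow> \<phi> x = x"
  shows "norm (\<phi> x) < real k \<longleftrightarrow> norm x < real k"
  using k[of x] k[of "\<phi> x"] bij_is_inj[OF Diff0_bij[OF assms(1)]] by (metis injD)

lemma Diff0_vimage_bounded:
  assumes \<phi>: "\<phi> \<in> Diff0" and C: "bounded C" shows "bounded (\<phi> -` C)"
proof -
  obtain k :: nat where k: "\<And>x. \<not> norm x < real k \<Longrightarrow> \<phi> x = x"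
    using Diff0_fixes_outside_ball[OF \<phi>] by blast
  have "\<phi> -` C \<subseteq> C \<union> ball 0 (real k)"
  proof
    fix x assume "x \<in> \<phi> -` C"
    then show "x \<in> C \<union> ball 0 (real k)" using k[of x] by (cases "norm x < real k") auto
  qed
  then show ?thesis using C by (meson bounded_Un bounded_ball bounded_subset)
qed

lemma test_function_Diff0:
  assumes \<phi>: "\<phi> \<in> Diff0" and f: "f \<in> test_functions"
  shows "(\<lambda>x. f (\<phi> x)) \<in> test_functions"
proof -
  obtain R where R: "\<And>x. f x \<noteq> 0 \<Longrightarrow> norm x < R" using f by (auto simp: test_function_iff)
  then have "bounded {x. f x \<noteq> 0}" by (intro boundedI[of _ R]) (auto intro: less_imp_le)
  then have "bounded (\<phi> -` {x. f x \<noteq> 0})" by (rule Diff0_vimage_bounded[OF \<phi>])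
  then obtain S where "\<And>x. f (\<phi> x) \<noteq> 0 \<Longrightarrow> norm x < S" unfolding bounded_pos_less by auto
  moreover have "continuous_on UNIV (\<lambda>x. f (\<phi> x))"
    by (rule continuous_on_compose2[OF test_function_continuous[OF f] Diff0_continuous[OF \<phi>]]) auto
  ultimately show ?thesis by (auto simp: test_function_iff)
qed

lemma measurable_radon: "\<eta> \<in> radon_measures \<Longrightarrow> g \<in> measurable borel N \<Longrightarrow> g \<in> measurable \<eta> N"
  using radon_measureD(1) by (metis measurable_cong_sets)

lemma push_discrete:
  fixes \<eta> :: "'a::euclidean_space measure"
  assumes \<phi>: "\<phi> \<in> Diff0" and \<eta>: "\<eta> \<in> discrete_radon_measures"
  shows "distr \<eta> borel \<phi> \<in> discrete_radon_measures"
proof -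
  note \<eta>r = discrete_imp_radon[OF \<eta>]
  have \<phi>m: "\<phi> \<in> measurable \<eta> borel" by (rule measurable_radon[OF \<eta>r Diff0_measurable[OF \<phi>]])
  have sp: "space \<eta> = UNIV" by (rule radon_measureD(2)[OF \<eta>r])
  have em: "emeasure (distr \<eta> borel \<phi>) A = emeasure \<eta> (\<phi> -` A)" if "A \<in> sets borel" for A
    using emeasure_distr[OF \<phi>m that] sp by simp
  have "emeasure (distr \<eta> borel \<phi>) C < \<infinity>" if "compact C" for C
  proof -
    have "bounded (\<phi> -` C)" by (rule Diff0_vimage_bounded[OF \<phi> compact_imp_bounded[OF that]])
    then show ?thesis
      using em[OF borel_compact[OF that]] radon_measure_bounded_finite[OF \<eta>r] by simp
  qed
  then have radon: "distr \<eta> borel \<phi> \<in> radon_measures" by (simp add: radon_measures_def)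
  obtain S s where S: "countable S" "\<And>x. x \<in> S \<Longrightarrow> 0 < s x"
    and eq: "\<And>A. A \<in> sets borel \<Longrightarrow> emeasure \<eta> A =
      (\<integral>\<^sup>+x. ennreal (s x) * emeasure (return borel x) A \<partial>count_space S)"
    using \<eta> by (auto simp: discrete_radon_measures_def)
  have inj: "inj \<phi>" by (rule bij_is_inj[OF Diff0_bij[OF \<phi>]])
  have "emeasure (distr \<eta> borel \<phi>) A =
      (\<integral>\<^sup>+x. ennreal (s (inv \<phi> x)) * emeasure (return borel x) A \<partial>count_space (\<phi> ` S))"
    if A: "A \<in> sets borel" for A
  proof -
    have A': "\<phi> -` A \<in> sets borel" using measurable_sets[OF Diff0_measurable[OF \<phi>] A] by simp
    have "bij_betw \<phi> S (\<phi> ` S)" using inj_on_subset[OF inj subset_UNIV] by (simp add: bij_betw_def)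
    then have "(\<integral>\<^sup>+x. ennreal (s (inv \<phi> x)) * emeasure (return borel x) A \<partial>count_space (\<phi> ` S)) =
        (\<integral>\<^sup>+x. ennreal (s (inv \<phi> (\<phi> x))) * emeasure (return borel (\<phi> x)) A \<partial>count_space S)"
      by (rule nn_integral_bij_count_space[symmetric])
    also have "\<dots> = (\<integral>\<^sup>+x. ennreal (s x) * emeasure (return borel x) (\<phi> -` A) \<partial>count_space S)"
      using A A' inj by (intro nn_integral_cong) (simp add: indicator_def)
    also have "\<dots> = emeasure (distr \<eta> borel \<phi>) A" using eq[OF A'] em[OF A] by simp
    finally show ?thesis by simp
  qed
  moreover have "\<forall>x\<in>\<phi> ` S. 0 < s (inv \<phi> x)" using S(2) inj by auto
  ultimately show ?thesis
    unfolding discrete_radon_measures_def using radon countable_image[OF S(1)]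
    by (intro CollectI conjI exI[of _ "\<phi> ` S"] exI[of _ "\<lambda>x. s (inv \<phi> x)"]) auto
qed

lemma integral_push:
  assumes \<phi>: "\<phi> \<in> Diff0" and \<eta>: "\<eta> \<in> discrete_radon_measures" and f: "f \<in> test_functions"
  shows "(\<integral>x. f x \<partial>distr \<eta> borel \<phi>) = (\<integral>x. f (\<phi> x) \<partial>\<eta>)"
  by (rule integral_distr[OF measurable_radon[OF discrete_imp_radon[OF \<eta>] Diff0_measurable[OF \<phi>]]
        test_function_measurable[OF f]])

lemma measurable_push:
  assumes \<phi>: "\<phi> \<in> Diff0"
  shows "(\<lambda>\<eta>. distr \<eta> borel \<phi>) \<in> measurable discrete_radon_space discrete_radon_space"
proof (rule measurable_discrete_radon_spaceI)
  fix n
  have "(\<lambda>\<eta>. \<integral>x. test_seq n (\<phi> x) \<partial>\<eta>) \<in> borel_measurable discrete_radon_space"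
    by (intro measurable_integral_test_function test_function_Diff0[OF \<phi>] test_seq)
  then show "(\<lambda>\<eta>. \<integral>x. test_seq n x \<partial>distr \<eta> borel \<phi>) \<in> borel_measurable discrete_radon_space"
    by (rule measurable_cong[THEN iffD1, rotated])
       (simp add: integral_push[OF \<phi> _ test_seq] space_discrete_radon_space)
qed (use push_discrete[OF \<phi>] in \<open>simp add: space_discrete_radon_space\<close>)

section \<open>The density of the transported law\<close>

lemma has_unordered_prod_eventually_one:
  assumes B: "finite B" "B \<subseteq> A" and one: "\<And>x. x \<in> A - B \<Longrightarrow> g x = 1"
  shows "has_unordered_prod g A (\<Prod>x\<in>B. g x)"
  unfolding has_unordered_prod_def
proof (rule tendsto_eventually)
  have "prod g Y = prod g B" if "finite Y" "B \<subseteq> Y" "Y \<subseteq> A" for Y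
    using that one by (intro prod.mono_neutral_right) auto
  then show "\<forall>\<^sub>F Y in finite_subsets_at_top A. prod g Y = prod g B"
    unfolding eventually_finite_subsets_at_top using B by blast
qed

context marked_measure
begin

lemma measurable_push_marked:
  assumes \<phi>: "\<phi> \<in> Diff0"
  shows "(\<lambda>(x, s). (\<phi> x, s)) \<in> measurable m marked_space"
  unfolding marked_space_def
proof (rule measurable_restrict_space2)
  show "(\<lambda>(x, s). (\<phi> x, s)) \<in> space m \<rightarrow> UNIV \<times> {0<..}" by (auto simp: space_m)
  have "(\<lambda>p. (\<phi> (fst p), snd p)) \<in> borel_measurable m"
    by (intro borel_measurable_Pair snd_measurable measurable_compose[OF fst_measurable Diff0_measurable[OF \<phi>]])
  then show "(\<lambda>(x, s). (\<phi> x, s)) \<in> borel_measurable m" by (simp add: split_beta')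
qed

lemma sets_push_marked [simp]: "sets (push_marked \<phi> m) = sets m"
  by (simp add: push_marked_def sets_m)

lemma emeasure_push_marked:
  assumes \<phi>: "\<phi> \<in> Diff0" and A: "A \<in> sets m"
  shows "emeasure (push_marked \<phi> m) A = emeasure m {p \<in> space m. (\<phi> (fst p), snd p) \<in> A}"
proof -
  have "emeasure (push_marked \<phi> m) A = emeasure m ((\<lambda>(x, s). (\<phi> x, s)) -` A \<inter> space m)"
    unfolding push_marked_def using A sets_m by (intro emeasure_distr measurable_push_marked[OF \<phi>]) simp
  also have "(\<lambda>(x, s). (\<phi> x, s)) -` A \<inter> space m = {p \<in> space m. (\<phi> (fst p), snd p) \<in> A}" by auto
  finally show ?thesis .
qed

lemma emeasure_push_marked_strip:
  assumes \<phi>: "\<phi> \<in> Diff0" and A: "A \<in> sets borel"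
  shows "emeasure (push_marked \<phi> m) (A \<times> {0<..}) = emeasure m ((\<phi> -` A) \<times> {0<..})"
  unfolding emeasure_push_marked[OF \<phi> strip_sets[OF A]]
  by (rule arg_cong[of _ _ "emeasure m"]) (auto simp: space_m)

lemma marked_measure_push:
  assumes \<phi>: "\<phi> \<in> Diff0" shows "marked_measure (push_marked \<phi> m)"
proof
  show "sets (push_marked \<phi> m) = sets marked_space" by (simp add: sets_m)
  show "emeasure (push_marked \<phi> m) ({x} \<times> {0<..}) = 0" for x
  proof -
    have "\<phi> -` {x} = {inv \<phi> x}"
      using Diff0_bij[OF \<phi>] by (auto simp: bij_is_inj bij_is_surj surj_f_inv_f)
    then show ?thesis using emeasure_push_marked_strip[OF \<phi>, of "{x}"] null_fibre by simp
  qed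
  show "emeasure (push_marked \<phi> m) (\<Lambda> \<times> {0<..}) < \<infinity>" if "\<Lambda> \<in> relatively_compact_borel" for \<Lambda>
  proof -
    have \<Lambda>: "\<Lambda> \<in> sets borel" "bounded \<Lambda>"
      using that by (auto simp: relatively_compact_borel_def compact_closure)
    show ?thesis
      unfolding emeasure_push_marked_strip[OF \<phi> \<Lambda>(1)]
      using measurable_sets[OF Diff0_measurable[OF \<phi>] \<Lambda>(1)]
      by (intro bounded_strip_finite Diff0_vimage_bounded[OF \<phi> \<Lambda>(2)]) simp
  qed
qed

text \<open>A version \<open>r\<close> of the Radon-Nikodym density that is positive and finite everywhere and equal to \<open>1\<close>
off a ball. Off a ball containing the support of \<open>\<phi>\<close> the two measures agree; on it equivalence
excludes the value \<open>0\<close> up to null sets. As \<open>\<phi>\<close> maps the ball onto itself, both measures give it the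
same finite mass, which is why \<open>r - 1\<close> integrates to zero.\<close>

lemma push_marked_density:
  assumes \<phi>: "\<phi> \<in> Diff0" and equiv: "equivalent_measures m (push_marked \<phi> m)"
  obtains k r where "r \<in> borel_measurable borel" "\<And>p. 0 < r p" "\<And>p. r p \<noteq> 1 \<Longrightarrow> norm (fst p) < real k"
    "integrable m (\<lambda>p. r p - 1)" "(\<integral>p. r p - 1 \<partial>m) = 0"
    "density m (\<lambda>p. ennreal (r p)) = push_marked \<phi> m"
    "AE p in m. RN_deriv m (push_marked \<phi> m) p = ennreal (r p)"
proof -
  let ?N = "push_marked \<phi> m"
  obtain k :: nat where k: "\<And>x. \<not> norm x < real k \<Longrightarrow> \<phi> x = x"
    using Diff0_fixes_outside_ball[OF \<phi>] by blast
  interpret M: sigma_finite_measure m by (rule sigma_finite_m)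
  interpret N: marked_measure ?N by (rule marked_measure_push[OF \<phi>])
  define S where "S = ball (0::'a) (real k) \<times> {0::real<..}"
  have S: "S \<in> sets m" unfolding S_def by (rule strip_sets) simp
  have Sfin: "emeasure m S < \<infinity>" unfolding S_def by (rule bounded_strip_finite) auto
  have Smem: "p \<in> S \<longleftrightarrow> norm (fst p) < real k" if "p \<in> space m" for p
    using that by (auto simp: S_def space_m)
  have NS: "emeasure ?N S = emeasure m S"
  proof -
    have "\<phi> -` ball 0 (real k) = ball 0 (real k)" using Diff0_ball[OF \<phi> k] by auto
    then show ?thesis unfolding S_def by (simp add: emeasure_push_marked_strip[OF \<phi>])
  qed
  have N_off: "emeasure ?N A = emeasure m A" if A: "A \<in> sets m" "A \<inter> S = {}" for A
  proof -
    have "{p \<in> space m. (\<phi> (fst p), snd p) \<in> A} = A"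
    proof (intro equalityI subsetI)
      fix p assume p: "p \<in> {p \<in> space m. (\<phi> (fst p), snd p) \<in> A}"
      then have q: "(\<phi> (fst p), snd p) \<notin> S" "(\<phi> (fst p), snd p) \<in> space m" using A(2) by (auto simp: space_m)
      then have "\<not> norm (\<phi> (fst p)) < real k" using Smem[OF q(2)] by simp
      then have "\<not> norm (fst p) < real k" using Diff0_ball[OF \<phi> k] by simp
      then show "p \<in> A" using k[of "fst p"] p by simp
    next
      fix p assume p: "p \<in> A"
      then have ps: "p \<in> space m" using sets.sets_into_space[OF A(1)] by auto
      then have "\<not> norm (fst p) < real k" using Smem[OF ps] p A(2) by auto
      then show "p \<in> {p \<in> space m. (\<phi> (fst p), snd p) \<in> A}" using k[of "fst p"] ps p by simp
    qed
    then show ?thesis by (simp add: emeasure_push_marked[OF \<phi> A(1)])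
  qed
  define \<rho> where "\<rho> = RN_deriv m ?N"
  have \<rho>: "\<rho> \<in> borel_measurable m" by (simp add: \<rho>_def)
  have ac: "absolutely_continuous m ?N" "absolutely_continuous ?N m"
    using equiv by (auto simp: equivalent_measures_def)
  have dens: "density m \<rho> = ?N"
    unfolding \<rho>_def by (rule M.density_RN_deriv[OF ac(1)]) simp
  define D where "D p = (if p \<in> S then \<rho> p else 1)" for p
  have D: "D \<in> borel_measurable m"
    unfolding D_def by (rule measurable_If_set[OF \<rho> borel_measurable_const]) (use S in auto)
  have "density m D = ?N"
  proof (rule measure_eqI)
    fix A assume "A \<in> sets (density m D)"
    then have A: "A \<in> sets m" by simp
    have "emeasure (density m D) A = (\<integral>\<^sup>+p. D p * indicator A p \<partial>m)" by (rule emeasure_density[OF D A])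
    also have "\<dots> = (\<integral>\<^sup>+p. \<rho> p * indicator (A \<inter> S) p + indicator (A - S) p \<partial>m)"
      by (intro nn_integral_cong) (auto simp: D_def indicator_def)
    also have "\<dots> = (\<integral>\<^sup>+p. \<rho> p * indicator (A \<inter> S) p \<partial>m) + (\<integral>\<^sup>+p. indicator (A - S) p \<partial>m)"
      using A S \<rho> by (intro nn_integral_add) auto
    also have "\<dots> = emeasure (density m \<rho>) (A \<inter> S) + emeasure m (A - S)"
      using A S \<rho> by (simp add: emeasure_density)
    also have "\<dots> = emeasure ?N (A \<inter> S) + emeasure ?N (A - S)"
      using A S by (subst N_off) (auto simp: dens)
    also have "\<dots> = emeasure ?N ((A \<inter> S) \<union> (A - S))"
      using A S by (intro plus_emeasure) auto
    also have "(A \<inter> S) \<union> (A - S) = A" by auto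
    finally show "emeasure (density m D) A = emeasure ?N A" .
  qed simp
  then have \<rho>_off: "AE p in m. D p = \<rho> p"
    unfolding \<rho>_def by (rule M.RN_deriv_unique[OF D])
  have \<rho>_fin: "AE p in m. \<rho> p \<noteq> \<infinity>"
    unfolding \<rho>_def by (rule M.RN_deriv_finite[OF N.sigma_finite_m ac(1)]) simp
  have \<rho>_pos: "AE p in m. \<rho> p \<noteq> 0"
  proof -
    let ?Z = "{p \<in> space m. \<rho> p = 0}"
    have Z: "?Z \<in> sets m" using \<rho> by measurable
    have "emeasure ?N ?Z = (\<integral>\<^sup>+p. \<rho> p * indicator ?Z p \<partial>m)"
      unfolding dens[symmetric] by (rule emeasure_density[OF \<rho> Z])
    also have "\<dots> = (\<integral>\<^sup>+p. 0 \<partial>m)" by (intro nn_integral_cong) (auto simp: indicator_def)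
    finally have "?Z \<in> null_sets ?N" using Z by (simp add: null_setsI)
    then have "?Z \<in> null_sets m" using ac(2) by (auto simp: absolutely_continuous_def)
    then show ?thesis by (rule AE_I') auto
  qed
  define G where "G = {p \<in> S. 0 < \<rho> p \<and> \<rho> p < \<infinity>}"
  define r where "r p = (if p \<in> G then enn2real (\<rho> p) else 1)" for p
  have Gm: "G \<in> sets m"
  proof -
    have "G = S \<inter> {p \<in> space m. 0 < \<rho> p \<and> \<rho> p < \<infinity>}"
      using sets.sets_into_space[OF S] by (auto simp: G_def)
    moreover have "{p \<in> space m. 0 < \<rho> p \<and> \<rho> p < \<infinity>} \<in> sets m" using \<rho> by measurable
    ultimately show ?thesis using S by simp
  qed
  have strip: "UNIV \<times> {0<..} \<in> sets (borel :: ('a \<times> real) measure)"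
    by (intro borel_open open_Times) auto
  have rm: "r \<in> borel_measurable borel"
  proof -
    have "(\<lambda>p. if p \<in> G then enn2real (\<rho> p) else 1) \<in> borel_measurable m"
      using Gm \<rho> by (intro measurable_If_set) auto
    then have "r \<in> borel_measurable (restrict_space borel (UNIV \<times> {0<..}))"
      unfolding measurable_m_iff marked_space_def r_def[abs_def] .
    then have "(\<lambda>p. if p \<in> UNIV \<times> {0<..} then r p else 1) \<in> borel_measurable borel"
      using strip by (subst (asm) measurable_restrict_space_iff[of _ _ 1]) auto
    also have "(\<lambda>p. if p \<in> UNIV \<times> {0<..} then r p else 1) = r"
      by (rule ext) (auto simp: r_def G_def S_def)
    finally show ?thesis .
  qed
  have rpos: "0 < r p" for p by (auto simp: r_def G_def enn2real_positive_iff)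
  have r1: "norm (fst p) < real k" if "r p \<noteq> 1" for p
    using that by (auto simp: r_def G_def S_def split: if_splits)
  have r\<rho>: "AE p in m. \<rho> p = ennreal (r p)"
    using \<rho>_off \<rho>_fin \<rho>_pos
  proof eventually_elim
    case (elim p)
    then show ?case
      by (cases "p \<in> S") (auto simp: r_def G_def D_def less_top zero_less_iff_neq_zero)
  qed
  have "density m (\<lambda>p. ennreal (r p)) = density m \<rho>"
    using r\<rho> \<rho> borel_measurable_m[OF rm] by (intro density_cong) (auto elim: eventually_mono)
  then have dens_r: "density m (\<lambda>p. ennreal (r p)) = ?N" using dens by simp
  have rmm: "r \<in> borel_measurable m" by (rule borel_measurable_m[OF rm])
  have rS: "(\<integral>\<^sup>+p. ennreal (r p * indicat_real S p) \<partial>m) = emeasure m S"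
  proof -
    have "(\<integral>\<^sup>+p. ennreal (r p * indicat_real S p) \<partial>m) = (\<integral>\<^sup>+p. ennreal (r p) * indicator S p \<partial>m)"
      by (intro nn_integral_cong) (auto simp: indicator_def)
    also have "\<dots> = emeasure (density m (\<lambda>p. ennreal (r p))) S"
      using rmm S by (subst emeasure_density) auto
    finally show ?thesis by (simp add: dens_r NS)
  qed
  have irS: "integrable m (\<lambda>p. r p * indicat_real S p)"
    using rS Sfin rmm S rpos
    by (intro integrableI_nonneg) (auto intro!: AE_I2 mult_nonneg_nonneg less_imp_le[OF rpos])
  have iS: "integrable m (indicat_real S)" using S Sfin by (simp add: integrable_indicator_iff)
  have r_eq: "r p - 1 = r p * indicat_real S p - indicat_real S p" if "p \<in> space m" for p
    using r1[of p] Smem[OF that] by (auto simp: indicator_def)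
  have int: "integrable m (\<lambda>p. r p - 1)"
    using Bochner_Integration.integrable_diff[OF irS iS] r_eq
    by (subst Bochner_Integration.integrable_cong[OF refl r_eq]) auto
  have "(\<integral>p. r p * indicat_real S p \<partial>m) = measure m S"
    using rS rmm S rpos
    by (subst integral_eq_nn_integral)
       (auto intro!: AE_I2 mult_nonneg_nonneg less_imp_le[OF rpos] simp: measure_def)
  then have zero: "(\<integral>p. r p - 1 \<partial>m) = 0"
    using irS iS S by (subst Bochner_Integration.integral_cong[OF refl r_eq]) auto
  show thesis
  proof (rule that)
    show "norm (fst p) < real k" if "r p \<noteq> 1" for p using that by (rule r1)
  qed (fact rm rpos int zero dens_r r\<rho>[unfolded \<rho>_def])+
qed

lemma measurable_push_law: "\<phi> \<in> Diff0 \<Longrightarrow> (\<lambda>\<eta>. distr \<eta> borel \<phi>) \<in> measurable law discrete_radon_space"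
  using measurable_push by (simp cong: measurable_cong_sets)

lemma space_law: "space law = discrete_radon_measures"
  by (rule space_discrete_sets[OF sets_law])

text \<open>Both sides have the Fourier transform \<open>exp (\<integral>(exp (\<i> s f x) - 1) dm\<^sub>\<phi>)\<close>: on the left by substitution,
on the right because \<open>r exp (\<i> s f x) - 1 = r (exp (\<i> s f x) - 1) + (r - 1)\<close> and the last term
integrates to zero. Taking \<open>f = 0\<close> shows that the right-hand side is a probability measure.\<close>

lemma push_law_density:
  assumes \<phi>: "\<phi> \<in> Diff0"
    and r: "r \<in> borel_measurable borel" "\<And>p. 0 < r p" "\<And>p. r p \<noteq> 1 \<Longrightarrow> norm (fst p) < real k"
    and int: "integrable m (\<lambda>p. r p - 1)" "(\<integral>p. r p - 1 \<partial>m) = 0"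
    and dens: "density m (\<lambda>p. ennreal (r p)) = push_marked \<phi> m"
  shows "push_law \<phi> law = density law (\<lambda>\<eta>. ennreal (atom_weight k r \<eta>))"
proof -
  let ?W = "atom_weight k r :: 'a measure \<Rightarrow> real"
  interpret L: prob_space law by (rule prob_space_law)
  have W: "?W \<in> borel_measurable law"
    using measurable_atom_weight[OF r(1)] by (simp cong: measurable_cong_sets)
  have Wpos: "0 < ?W \<eta>" for \<eta> by (simp add: atom_weight_def)
  have intW: "integrable law (\<lambda>\<eta>. complex_of_real (?W \<eta>))"
    using integrable_weight_iexp[OF r int(1) test_function_zero] by (simp add: scaleR_conv_of_real)
  have "(\<integral>\<eta>. complex_of_real (?W \<eta>) \<partial>law) = exp (\<integral>p. complex_of_real (r p - 1) \<partial>m)"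
    using integral_weight_iexp[OF r int(1) test_function_zero] by (simp add: scaleR_conv_of_real)
  also have "\<dots> = 1" unfolding integral_complex_of_real int(2) by simp
  finally have "complex_of_real (\<integral>\<eta>. ?W \<eta> \<partial>law) = 1" unfolding integral_complex_of_real .
  then have W1: "(\<integral>\<eta>. ?W \<eta> \<partial>law) = 1" by (simp only: of_real_eq_1_iff)
  have "integrable law ?W"
    using integrable_norm[OF intW] Wpos by (simp add: abs_of_pos)
  then have "(\<integral>\<^sup>+\<eta>. ennreal (?W \<eta>) \<partial>law) = 1"
    using W1 Wpos by (subst nn_integral_eq_integral) (auto intro: less_imp_le)
  moreover have "emeasure (density law (\<lambda>\<eta>. ennreal (?W \<eta>))) (space law) =
      (\<integral>\<^sup>+\<eta>. ennreal (?W \<eta>) * indicator (space law) \<eta> \<partial>law)"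
    by (rule emeasure_density[OF measurable_compose[OF W measurable_ennreal] sets.top])
  moreover have "\<dots> = (\<integral>\<^sup>+\<eta>. ennreal (?W \<eta>) \<partial>law)"
    by (intro nn_integral_cong) simp
  ultimately have "emeasure (density law (\<lambda>\<eta>. ennreal (?W \<eta>))) (space law) = 1" by simp
  then have prob: "prob_space (density law (\<lambda>\<eta>. ennreal (?W \<eta>)))" by (intro prob_spaceI) simp
  show ?thesis
  proof (rule discrete_law_eqI[OF _ _ prob])
    show "prob_space (push_law \<phi> law)"
      unfolding push_law_def by (rule L.prob_space_distr[OF measurable_push_law[OF \<phi>]])
    show "sets (push_law \<phi> law) = sets discrete_radon_space" by (simp add: push_law_def)
    show "sets (density law (\<lambda>\<eta>. ennreal (?W \<eta>))) = sets discrete_radon_space" by simp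
    fix f :: "'a \<Rightarrow> real" assume f: "f \<in> test_functions"
    let ?e = "\<lambda>p. iexp (snd p * f (fst p))"
    have iexp: "(\<lambda>\<eta>. iexp (\<integral>x. f x \<partial>\<eta>)) \<in> borel_measurable discrete_radon_space"
      by (intro measurable_compose[OF measurable_integral_test_function[OF f], where g = "\<lambda>t. iexp t"]) simp
    then have iexpL: "(\<lambda>\<eta>. iexp (\<integral>x. f x \<partial>\<eta>)) \<in> borel_measurable law"
      by (simp cong: measurable_cong_sets)
    have e: "(\<lambda>p. ?e p - 1) \<in> borel_measurable m"
      using integrable_iexp_strip[OF f] by (rule borel_measurable_integrable)
    have ws: "integrable m (\<lambda>p. r p *\<^sub>R ?e p - 1)"
      by (rule integrable_weighted_strip[OF r int(1) f])
    have "(\<integral>\<eta>. iexp (\<integral>x. f x \<partial>\<eta>) \<partial>push_law \<phi> law) = (\<integral>\<eta>. iexp (\<integral>x. f x \<partial>distr \<eta> borel \<phi>) \<partial>law)"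
      unfolding push_law_def by (rule integral_distr[OF measurable_push_law[OF \<phi>] iexp])
    also have "\<dots> = (\<integral>\<eta>. iexp (\<integral>x. f (\<phi> x) \<partial>\<eta>) \<partial>law)"
      by (intro Bochner_Integration.integral_cong refl)
         (simp add: integral_push[OF \<phi> _ f] space_law)
    also have "\<dots> = exp (\<integral>p. iexp (snd p * f (\<phi> (fst p))) - 1 \<partial>m)"
      by (rule fourier_law[OF test_function_Diff0[OF \<phi> f]])
    also have "(\<integral>p. iexp (snd p * f (\<phi> (fst p))) - 1 \<partial>m) = (\<integral>p. ?e p - 1 \<partial>push_marked \<phi> m)"
      unfolding push_marked_def using e measurable_m_iff
      by (subst integral_distr[OF measurable_push_marked[OF \<phi>]]) (auto simp: split_beta')
    also have "\<dots> = (\<integral>p. r p *\<^sub>R (?e p - 1) \<partial>m)"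
      unfolding dens[symmetric]
      by (rule integral_density[OF e borel_measurable_m[OF r(1)]]) (intro AE_I2 less_imp_le r(2))
    also have "\<dots> = (\<integral>p. (r p *\<^sub>R ?e p - 1) - complex_of_real (r p - 1) \<partial>m)"
      by (intro Bochner_Integration.integral_cong refl) (simp add: scaleR_conv_of_real algebra_simps)
    also have "\<dots> = (\<integral>p. r p *\<^sub>R ?e p - 1 \<partial>m) - (\<integral>p. complex_of_real (r p - 1) \<partial>m)"
      using ws integrable_of_real[OF int(1)] by (rule Bochner_Integration.integral_diff)
    also have "(\<integral>p. complex_of_real (r p - 1) \<partial>m) = 0"
      unfolding integral_complex_of_real int(2) by simp
    also have "exp ((\<integral>p. r p *\<^sub>R ?e p - 1 \<partial>m) - 0) = (\<integral>\<eta>. ?W \<eta> *\<^sub>R iexp (\<integral>x. f x \<partial>\<eta>) \<partial>law)"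
      using integral_weight_iexp[OF r int(1) f] by simp
    also have "\<dots> = (\<integral>\<eta>. iexp (\<integral>x. f x \<partial>\<eta>) \<partial>density law (\<lambda>\<eta>. ennreal (?W \<eta>)))"
      by (rule integral_density[symmetric, OF iexpL W]) (use Wpos in \<open>auto intro: less_imp_le\<close>)
    finally show "(\<integral>\<eta>. iexp (\<integral>x. f x \<partial>\<eta>) \<partial>push_law \<phi> law) =
        (\<integral>\<eta>. iexp (\<integral>x. f x \<partial>\<eta>) \<partial>density law (\<lambda>\<eta>. ennreal (?W \<eta>)))" .
  qed
qed

text \<open>The sum over the atoms of the indicator of the complement of \<open>A\<close> is measurable, and it vanishes on
almost all clusters.\<close>

lemma AE_law_atoms:
  assumes A: "A \<in> sets m" "AE p in m. p \<in> A"
  shows "AE \<eta> in law. \<forall>x\<in>atoms \<eta>. (x, measure \<eta> {x}) \<in> A"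
proof -
  define F where "F p = (indicator (space m - A) p :: ennreal)" for p
  have "space m - A \<in> sets marked_space" using A(1) sets_m by auto
  then have "space m - A \<in> sets borel"
    unfolding marked_space_def
    by (subst (asm) sets_restrict_space_iff) (auto intro!: borel_open open_Times)
  then have F: "F \<in> borel_measurable borel" unfolding F_def[abs_def] by simp
  have "AE \<omega> in cluster_space. \<forall>k. atom_sum k F (random_measure \<omega>) = 0"
    using AE_good AE_cluster_points[OF A]
  proof eventually_elim
    case (elim \<omega>)
    then have \<omega>: "\<omega> \<in> space cluster_space" "locations_injective \<omega>"
      "\<And>n i. i < fst (\<omega> n) \<Longrightarrow> snd (\<omega> n) i \<in> cell n" by auto
    have "atom_sum k F (random_measure \<omega>) = (\<Sum>(n, i)\<in>points_below k \<omega>. F (snd (\<omega> n) i))" for k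
      by (rule atom_sum_random_measure[OF \<omega>])
    moreover have "(\<Sum>(n, i)\<in>points_below k \<omega>. F (snd (\<omega> n) i)) = 0" for k
      using elim(2) by (intro sum.neutral) (auto simp: points_below_def F_def)
    ultimately show ?case by simp
  qed
  moreover have "{\<eta> \<in> space discrete_radon_space. \<forall>k. atom_sum k F \<eta> = 0} \<in> sets discrete_radon_space"
    using measurable_atom_sum[OF F] by measurable
  ultimately have "AE \<eta> in law. \<forall>k. atom_sum k F \<eta> = 0" by (rule AE_law)
  with AE_space show ?thesis
  proof eventually_elim
    case (elim \<eta>)
    show ?case
    proof
      fix x assume x: "x \<in> atoms \<eta>"
      obtain k :: nat where k: "norm x < real k" using reals_Archimedean2 by blast
      have "AE y in count_space (atoms \<eta> \<inter> ball 0 (real k)). F (y, measure \<eta> {y}) = 0"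
        using elim(2)[rule_format, of k] unfolding atom_sum_def by (subst (asm) nn_integral_0_iff_AE) auto
      then have "F (x, measure \<eta> {x}) = 0" using x k by (auto simp: AE_count_space)
      moreover have "(x, measure \<eta> {x}) \<in> space m" using x by (auto simp: atoms_def space_m)
      ultimately show "(x, measure \<eta> {x}) \<in> A" by (auto simp: F_def indicator_def split: if_splits)
    qed
  qed
qed

lemma AE_law_finite_atoms: "AE \<eta> in law. finite (atoms \<eta> \<inter> ball 0 (real k))"
proof -
  define F where "F p = (1 :: ennreal)" for p :: "'a \<times> real"
  have F: "F \<in> borel_measurable borel" unfolding F_def[abs_def] by simp
  have "AE \<omega> in cluster_space. atom_sum k F (random_measure \<omega>) < \<infinity>"
    using AE_good
  proof eventually_elim
    case (elim \<omega>)
    then have \<omega>: "\<omega> \<in> space cluster_space" "locations_injective \<omega>"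
      "\<And>n i. i < fst (\<omega> n) \<Longrightarrow> snd (\<omega> n) i \<in> cell n" by auto
    have "atom_sum k F (random_measure \<omega>) = (\<Sum>(n, i)\<in>points_below k \<omega>. F (snd (\<omega> n) i))"
      by (rule atom_sum_random_measure[OF \<omega>])
    also have "\<dots> = of_nat (card (points_below k \<omega>))" by (simp add: F_def)
    also have "\<dots> < \<infinity>" by (simp add: of_nat_less_top)
    finally show ?case .
  qed
  moreover have "{\<eta> \<in> space discrete_radon_space. atom_sum k F \<eta> < \<infinity>} \<in> sets discrete_radon_space"
    using measurable_atom_sum[OF F] by measurable
  ultimately have "AE \<eta> in law. atom_sum k F \<eta> < \<infinity>" by (rule AE_law)
  then show ?thesis
  proof eventually_elim
    case (elim \<eta>)
    then have "emeasure (count_space (atoms \<eta> \<inter> ball 0 (real k))) (atoms \<eta> \<inter> ball 0 (real k)) < \<infinity>"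
      by (simp add: atom_sum_def F_def)
    then show ?case by (simp add: emeasure_count_space split: if_splits)
  qed
qed

text \<open>The weight \<open>atom_weight k r\<close> is strictly positive, so the density gives equivalence and not only
absolute continuity. Almost surely it is the product of \<open>dm\<^sub>\<phi>/dm\<close> over the finitely many atoms in
a ball, and all atoms outside contribute the factor \<open>1\<close>, so the unordered product over all atoms is
eventually constant.\<close>

theorem quasi_invariance_with_density:
  assumes \<phi>: "\<phi> \<in> Diff0" and equiv: "equivalent_measures m (push_marked \<phi> m)"
  shows "equivalent_measures (push_law \<phi> law) law"
    and "AE \<eta> in law. has_unordered_prod (\<lambda>x. RN_deriv m (push_marked \<phi> m) (x, measure \<eta> {x}))
      (atoms \<eta>) (RN_deriv law (push_law \<phi> law) \<eta>)"
proof -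
  let ?\<rho> = "RN_deriv m (push_marked \<phi> m)"
  obtain k r where r: "r \<in> borel_measurable borel" "\<And>p. 0 < r p" "\<And>p. r p \<noteq> 1 \<Longrightarrow> norm (fst p) < real k"
    and int: "integrable m (\<lambda>p. r p - 1)" "(\<integral>p. r p - 1 \<partial>m) = 0"
    and dens: "density m (\<lambda>p. ennreal (r p)) = push_marked \<phi> m"
    and RN: "AE p in m. ?\<rho> p = ennreal (r p)"
    by (rule push_marked_density[OF \<phi> equiv]) blast
  let ?W = "atom_weight k r :: 'a measure \<Rightarrow> real"
  interpret L: prob_space law by (rule prob_space_law)
  have push: "push_law \<phi> law = density law (\<lambda>\<eta>. ennreal (?W \<eta>))"
    by (rule push_law_density[OF \<phi> r int dens])
  have W: "(\<lambda>\<eta>. ennreal (?W \<eta>)) \<in> borel_measurable law"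
    using measurable_atom_weight[OF r(1)] by (simp cong: measurable_cong_sets)
  have Wpos: "0 < ?W \<eta>" for \<eta> by (simp add: atom_weight_def)
  have "absolutely_continuous law (push_law \<phi> law)"
    unfolding push by (rule absolutely_continuousI_density[OF W])
  moreover have "absolutely_continuous (push_law \<phi> law) law"
    unfolding absolutely_continuous_def push
  proof
    fix A assume "A \<in> null_sets (density law (\<lambda>\<eta>. ennreal (?W \<eta>)))"
    then have "A \<in> sets law" "AE \<eta> in law. \<eta> \<in> A \<longrightarrow> ennreal (?W \<eta>) = 0"
      using null_sets_density_iff[OF W] by auto
    moreover have "\<not> ?W \<eta> \<le> 0" for \<eta> using Wpos[of \<eta>] by simp
    ultimately show "A \<in> null_sets law"
      by (intro AE_iff_null_sets[THEN iffD2]) (auto simp: ennreal_eq_0_iff)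
  qed
  ultimately show "equivalent_measures (push_law \<phi> law) law"
    by (simp add: equivalent_measures_def push_law_def)
  have RNW: "AE \<eta> in law. ennreal (?W \<eta>) = RN_deriv law (push_law \<phi> law) \<eta>"
    by (rule L.RN_deriv_unique[OF W push[symmetric]])
  define A where "A = {p \<in> space m. ?\<rho> p = ennreal (r p)}"
  have "A \<in> sets m"
    unfolding A_def using borel_measurable_m[OF r(1)] by measurable
  moreover have "AE p in m. p \<in> A" using RN AE_space unfolding A_def by eventually_elim simp
  ultimately have "AE \<eta> in law. \<forall>x\<in>atoms \<eta>. (x, measure \<eta> {x}) \<in> A" by (rule AE_law_atoms)
  with RNW AE_law_finite_atoms[of k]
  show "AE \<eta> in law. has_unordered_prod (\<lambda>x. ?\<rho> (x, measure \<eta> {x}))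
      (atoms \<eta>) (RN_deriv law (push_law \<phi> law) \<eta>)"
  proof eventually_elim
    case (elim \<eta>)
    let ?B = "atoms \<eta> \<inter> ball 0 (real k)"
    have \<rho>: "?\<rho> (x, measure \<eta> {x}) = ennreal (r (x, measure \<eta> {x}))" if "x \<in> atoms \<eta>" for x
      using elim(3) that by (auto simp: A_def)
    have "has_unordered_prod (\<lambda>x. ?\<rho> (x, measure \<eta> {x})) (atoms \<eta>) (\<Prod>x\<in>?B. ?\<rho> (x, measure \<eta> {x}))"
    proof (rule has_unordered_prod_eventually_one)
      fix x assume x: "x \<in> atoms \<eta> - ?B"
      then have "r (x, measure \<eta> {x}) = 1" using r(3)[of "(x, measure \<eta> {x})"] by auto
      then show "?\<rho> (x, measure \<eta> {x}) = 1" using \<rho>[of x] x by simp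
    qed (use elim(2) in auto)
    also have "(\<Prod>x\<in>?B. ?\<rho> (x, measure \<eta> {x})) = (\<Prod>x\<in>?B. ennreal (r (x, measure \<eta> {x})))"
      using \<rho> by (intro prod.cong) auto
    also have "\<dots> = ennreal (\<Prod>x\<in>?B. r (x, measure \<eta> {x}))"
      using r(2) by (intro prod_ennreal) (auto intro: less_imp_le)
    also have "\<dots> = ennreal (?W \<eta>)" by (simp add: atom_weight_eq_prod[OF elim(2) r(2)])
    also have "\<dots> = RN_deriv law (push_law \<phi> law) \<eta>" by (rule elim(1))
    finally show ?case .
  qed
qed

end

theorem corollary33:
  fixes m :: "((real ^ 'n) \<times> real) measure"
  assumes "sets m = sets marked_space"
    and "\<forall>x. emeasure m ({x} \<times> {0<..}) = 0"
    and "\<forall>\<phi>\<in>Diff0. equivalent_measures m (push_marked \<phi> m)"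
    and "\<forall>\<Lambda>\<in>relatively_compact_borel. emeasure m (\<Lambda> \<times> {0<..}) < \<infinity>"
  shows "quasi_invariant_Diff0 (law_of_levy_measure m) \<and>
    (\<forall>\<phi>\<in>Diff0. AE \<eta> in law_of_levy_measure m.
       has_unordered_prod (\<lambda>x. RN_deriv m (push_marked \<phi> m) (x, measure \<eta> {x})) (atoms \<eta>)
         (RN_deriv (law_of_levy_measure m) (push_law \<phi> (law_of_levy_measure m)) \<eta>))"
proof -
  interpret marked_measure m
    using assms(1,2,4) by unfold_locales blast+
  show ?thesis
    unfolding law_of_levy_measure_eq quasi_invariant_Diff0_def
    using quasi_invariance_with_density assms(3) by blast
qed

end
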